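(* Let $\Omega\subseteq\mathbb{C}^n$ be a smoothly bounded domain, let $s$ be a non-negative integer, and let $0\le q\le n-1$. Let $\bar\partial^*$ be the $W^s(\Omega)$-Hilbert space adjoint of $\bar\partial:W^s_{(0,q)}(\Omega)\to W^s_{(0,q+1)}(\Omega)$. Then $$ \operatorname{dom}\bar\partial^*\cap C^\infty_{(0,q+1)}(\bar\Omega)=\bigl\{\psi\in C^\infty_{(0,q+1)}(\bar\Omega):\ N^s\bigl(\psi\llcorner\bar\partial\varrho\bigr)_I=0\ \text{ on } b\Omega\ \text{ for all } I \text{ with } |I|=q\bigr\}, $$ where $N^s$ denotes the $s$-fold composition of the vector field $N$ with itself.
   Context: Write $z_j=x_j+ix_{j+n}$, $j=1,\dots,n$, for the coordinates on $\mathbb{C}^n$ and $D_k=\partial/\partial x_k$, $k=1,\dots,2n$. For a multi-index $\alpha\in\mathbb{Z}_{\ge0}^{2n}$ put $\gamma_\alpha=|\alpha|!/\alpha!$. Set $\langle f,g\rangle_s=\sum_{|\alpha|\le s}\gamma_\alpha\int_\Omega D^\alpha f\,\overline{D^\alpha g}$; $W^s(\Omega)$ is the closure of $C^\infty(\bar\Omega)$ with respect to this inner product. $W^s_{(0,q)}(\Omega)$ is the space of $(0,q)$ forms $\phi=\sum_{|J|=q}\phi_J\,d\bar z^J$ ($J$ running over strictly increasing $q$-tuples from $\{1,\dots,n\}$) with coefficients in $W^s(\Omega)$, with inner product $\langle\phi,\psi\rangle_s=\sum_{|J|=q}\langle\phi_J,\psi_J\rangle_s$. $C^\infty_{(0,q)}(\bar\Omega)$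 denotes the $(0,q)$ forms with coefficients in $C^\infty(\bar\Omega)$. On $C^\infty_{(0,q)}(\bar\Omega)$, $\bar\partial\phi=\sum_{|K|=q+1}\sum_{k,J}\varepsilon^K_{kJ}\frac{\partial\phi_J}{\partial\bar z_k}d\bar z^K$, where $\varepsilon^K_{kJ}$ is the sign of the permutation $kJ\mapsto K$ if $\{k\}\cup J=K$ as sets and $0$ otherwise. The symbol $\bar\partial$ also denotes the closure of this operator in the $W^s$ topology, an unbounded, densely defined, closed operator $W^s_{(0,q)}(\Omega)\to W^s_{(0,q+1)}(\Omega)$. $\varrho$ is the signed Euclidean distance from the boundary $b\Omega$ (negative inside $\Omega$, positive outside), which is $C^\infty$ on $\overline{U}$ for a suitable tubular neighborhood $U$ of $b\Omega$. $N=\operatorname{grad}\varrho=\sum_{j=1}^{2n}\nu_jD_j$ is the corresponding vector field on $U$ (it extends the outward unit normal and satisfies $N\nu_j=0$ on $U$). The contraction of a $(0,q+1)$ form $\psi=\sum_K\psi_K d\bar z^K$ with a $(0,1)$ form $\omega=\sum_k\omega_k\,d\bar z_k$ is the $(0,q)$ form $\psi\llcorner\omega=\sum_{|I|=q}\sum_{k,K}\varepsilon^K_{kI}\psi_K\bar\omega_k\,d\bar z^I$, and $(\psi\llcorner\omega)_I$ denotes its $d\bar z^I$-coefficient. *)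

theory Defs
  imports "HOL-Analysis.Analysis" "HOL-Combinatorics.Permutations"
begin

text \<open>
  The space of \<open>n\<close> complex variables is \<open>complex ^ 'n\<close>, where \<open>'n\<close> is an arbitrary finite
  linearly ordered index type (an ordered copy of \<open>{1..n}\<close>). The \<open>2n\<close> real coordinates are indexed
  by \<open>'n + 'n\<close>: writing \<open>z\<^sub>j = x\<^sub>j + i x\<^bsub>j+n\<^esub>\<close>, the index \<open>Inl j\<close> stands for \<open>j\<close> and
  \<open>Inr j\<close> for \<open>j + n\<close>.
\<close>

type_synonym 'n cspace = "(complex, 'n) vec"

fun unit_vec :: "'n + 'n \<Rightarrow> 'n::finite cspace" where
  "unit_vec (Inl j) = axis j 1"
| "unit_vec (Inr j) = axis j \<i>"

definition D :: "'n + 'n \<Rightarrow> ('n::finite cspace \<Rightarrow> 'b::real_normed_vector) \<Rightarrow> 'n cspace \<Rightarrow> 'b" where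
  "D k f x = frechet_derivative f (at x) (unit_vec k)"

text \<open>All iterated partial derivatives exist and are differentiable (hence continuous).
  Meant for open \<open>U\<close>.\<close>

definition smooth_on :: "'n::finite cspace set \<Rightarrow> ('n cspace \<Rightarrow> 'b::real_normed_vector) \<Rightarrow> bool" where
  "smooth_on U f \<longleftrightarrow> (\<forall>ks. \<forall>x\<in>U. foldr D ks f differentiable (at x))"

type_synonym 'n multiindex = "'n + 'n \<Rightarrow> nat"

definition msize :: "'n::finite multiindex \<Rightarrow> nat" where
  "msize \<alpha> = (\<Sum>k\<in>UNIV. \<alpha> k)"

definition mfact :: "'n::finite multiindex \<Rightarrow> nat" where
  "mfact \<alpha> = (\<Prod>k\<in>UNIV. fact (\<alpha> k))"

definition mcoeff :: "'n::finite multiindex \<Rightarrow> real" where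
  "mcoeff \<alpha> = fact (msize \<alpha>) / real (mfact \<alpha>)"

definition coords :: "('n::{finite,linorder} + 'n) list" where
  "coords = map Inl (sorted_list_of_set UNIV) @ map Inr (sorted_list_of_set UNIV)"

text \<open>\<open>D\<^sub>1\<close> to the power \<open>\<alpha>\<^sub>1\<close>, \<dots>, \<open>D\<^bsub>2n\<^esub>\<close> to the power \<open>\<alpha>\<^bsub>2n\<^esub>\<close>, composed in this order; the
  order is immaterial for smooth functions.\<close>

definition mD :: "'n::{finite,linorder} multiindex \<Rightarrow> ('n cspace \<Rightarrow> 'b::real_normed_vector)
    \<Rightarrow> 'n cspace \<Rightarrow> 'b" where
  "mD \<alpha> f = foldr (\<lambda>k. D k ^^ \<alpha> k) coords f"

definition dzbar :: "'n \<Rightarrow> ('n::finite cspace \<Rightarrow> complex) \<Rightarrow> 'n cspace \<Rightarrow> complex" where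
  "dzbar j f x = (D (Inl j) f x + \<i> * D (Inr j) f x) / 2"

definition smoothly_bounded_domain :: "'n::finite cspace set \<Rightarrow> bool" where
  "smoothly_bounded_domain \<Omega> \<longleftrightarrow>
     open \<Omega> \<and> connected \<Omega> \<and> \<Omega> \<noteq> {} \<and> bounded \<Omega> \<and>
     (\<forall>p\<in>frontier \<Omega>. \<exists>V (r :: 'n cspace \<Rightarrow> real).
        open V \<and> p \<in> V \<and> smooth_on V r \<and> (\<forall>x\<in>V. \<exists>k. D k r x \<noteq> 0) \<and>
        \<Omega> \<inter> V = {x \<in> V. r x < 0})"

definition signed_dist :: "'n::finite cspace set \<Rightarrow> 'n cspace \<Rightarrow> real" where
  "signed_dist \<Omega> x = (if x \<in> \<Omega> then - infdist x (frontier \<Omega>) else infdist x (frontier \<Omega>))"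

definition normal_field :: "'n::finite cspace set \<Rightarrow> ('n cspace \<Rightarrow> complex) \<Rightarrow> 'n cspace \<Rightarrow> complex" where
  "normal_field \<Omega> f x = (\<Sum>k\<in>UNIV. D k (signed_dist \<Omega>) x *\<^sub>R D k f x)"

text \<open>Smooth functions on the closure of \<open>\<Omega>\<close> are represented by functions on the whole space that
  are smooth in some neighbourhood of the closure; their values elsewhere are arbitrary.\<close>

definition Cinf :: "'n::finite cspace set \<Rightarrow> ('n cspace \<Rightarrow> complex) set" where
  "Cinf \<Omega> = {f. \<exists>U. open U \<and> closure \<Omega> \<subseteq> U \<and> smooth_on U f}"

definition L2 :: "'n::finite cspace set \<Rightarrow> ('n cspace \<Rightarrow> complex) set" where
  "L2 \<Omega> = {f \<in> borel_measurable (lebesgue_on \<Omega>). integrable (lebesgue_on \<Omega>) (\<lambda>x. (cmod (f x))\<^sup>2)}"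

definition test_functions :: "'n::finite cspace set \<Rightarrow> ('n cspace \<Rightarrow> complex) set" where
  "test_functions \<Omega> =
     {\<phi>. smooth_on UNIV \<phi> \<and> compact (closure {x. \<phi> x \<noteq> 0}) \<and> closure {x. \<phi> x \<noteq> 0} \<subseteq> \<Omega>}"

definition has_weak_deriv :: "'n::{finite,linorder} cspace set \<Rightarrow> 'n multiindex
    \<Rightarrow> ('n cspace \<Rightarrow> complex) \<Rightarrow> ('n cspace \<Rightarrow> complex) \<Rightarrow> bool" where
  "has_weak_deriv \<Omega> \<alpha> f g \<longleftrightarrow> g \<in> L2 \<Omega> \<and>
     (\<forall>\<phi>\<in>test_functions \<Omega>.
        (LINT x|lebesgue_on \<Omega>. f x * mD \<alpha> \<phi> x) = (-1) ^ msize \<alpha> * (LINT x|lebesgue_on \<Omega>. g x * \<phi> x))"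

text \<open>Unique up to null sets when it exists; for functions in \<open>Cinf \<Omega>\<close> it is the classical
  derivative almost everywhere.\<close>

definition weak_deriv :: "'n::{finite,linorder} cspace set \<Rightarrow> 'n multiindex
    \<Rightarrow> ('n cspace \<Rightarrow> complex) \<Rightarrow> 'n cspace \<Rightarrow> complex" where
  "weak_deriv \<Omega> \<alpha> f = (SOME g. has_weak_deriv \<Omega> \<alpha> f g)"

definition W_inner :: "'n::{finite,linorder} cspace set \<Rightarrow> nat
    \<Rightarrow> ('n cspace \<Rightarrow> complex) \<Rightarrow> ('n cspace \<Rightarrow> complex) \<Rightarrow> complex" where
  "W_inner \<Omega> s f g = (\<Sum>\<alpha> | msize \<alpha> \<le> s. of_real (mcoeff \<alpha>) *
     (LINT x|lebesgue_on \<Omega>. weak_deriv \<Omega> \<alpha> f x * cnj (weak_deriv \<Omega> \<alpha> g x)))"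

definition W_norm :: "'n::{finite,linorder} cspace set \<Rightarrow> nat \<Rightarrow> ('n cspace \<Rightarrow> complex) \<Rightarrow> real" where
  "W_norm \<Omega> s f = sqrt (Re (W_inner \<Omega> s f f))"

text \<open>The closure of \<open>Cinf \<Omega>\<close>, realised inside the square-integrable functions with
  square-integrable weak derivatives up to order \<open>s\<close> (functions equal almost everywhere in \<open>\<Omega>\<close>
  represent the same element).\<close>

definition W :: "'n::{finite,linorder} cspace set \<Rightarrow> nat \<Rightarrow> ('n cspace \<Rightarrow> complex) set" where
  "W \<Omega> s = {f \<in> L2 \<Omega>. (\<forall>\<alpha>. msize \<alpha> \<le> s \<longrightarrow> (\<exists>g. has_weak_deriv \<Omega> \<alpha> f g)) \<and>
     (\<exists>u. (\<forall>m::nat. u m \<in> Cinf \<Omega>) \<and> (\<lambda>m. W_norm \<Omega> s (\<lambda>x. u m x - f x)) \<longlonglongrightarrow> 0)}"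

text \<open>A \<open>(0,q)\<close> form is the family of its coefficients, indexed by the strictly increasing
  \<open>q\<close>-tuples (and \<open>undefined\<close> at all other lists).\<close>

definition tuples :: "nat \<Rightarrow> 'n::{finite,linorder} list set" where
  "tuples q = {J. length J = q \<and> sorted_wrt (<) J}"

type_synonym 'n form = "'n list \<Rightarrow> 'n cspace \<Rightarrow> complex"

definition Cinf_form :: "'n::{finite,linorder} cspace set \<Rightarrow> nat \<Rightarrow> 'n form set" where
  "Cinf_form \<Omega> q = (tuples q \<rightarrow>\<^sub>E Cinf \<Omega>)"

definition W_form :: "'n::{finite,linorder} cspace set \<Rightarrow> nat \<Rightarrow> nat \<Rightarrow> 'n form set" where
  "W_form \<Omega> s q = (tuples q \<rightarrow>\<^sub>E W \<Omega> s)"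

definition form_inner :: "'n::{finite,linorder} cspace set \<Rightarrow> nat \<Rightarrow> nat \<Rightarrow> 'n form \<Rightarrow> 'n form \<Rightarrow> complex" where
  "form_inner \<Omega> s q \<phi> \<psi> = (\<Sum>J\<in>tuples q. W_inner \<Omega> s (\<phi> J) (\<psi> J))"

definition form_dist :: "'n::{finite,linorder} cspace set \<Rightarrow> nat \<Rightarrow> nat \<Rightarrow> 'n form \<Rightarrow> 'n form \<Rightarrow> real" where
  "form_dist \<Omega> s q \<phi> \<psi> =
     (let \<delta> = (\<lambda>J x. \<phi> J x - \<psi> J x) in sqrt (Re (form_inner \<Omega> s q \<delta> \<delta>)))"

text \<open>The sign of the permutation taking \<open>k # J\<close> to \<open>K\<close>, or \<open>0\<close>. It is only used with \<open>J\<close> and \<open>K\<close>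
  strictly increasing and \<open>length K = length J + 1\<close>; then equality of the underlying sets forces
  \<open>k \<notin> set J\<close>, so that the permutation is unique.\<close>

definition eps :: "'n list \<Rightarrow> 'n \<Rightarrow> 'n list \<Rightarrow> complex" where
  "eps K k J = (if set K = insert k (set J)
     then of_int (sign (THE p. p permutes {..<length K} \<and> permute_list p (k # J) = K)) else 0)"

definition dbar :: "nat \<Rightarrow> 'n::{finite,linorder} form \<Rightarrow> 'n form" where
  "dbar q \<phi> = (\<lambda>K\<in>tuples (q + 1). \<lambda>x. \<Sum>k\<in>UNIV. \<Sum>J\<in>tuples q. eps K k J * dzbar k (\<phi> J) x)"

text \<open>The second argument of \<open>contract\<close> is a \<open>(0,1)\<close> form, given by its coefficients.\<close>

definition contract :: "nat \<Rightarrow> 'n::{finite,linorder} form \<Rightarrow> ('n \<Rightarrow> 'n cspace \<Rightarrow> complex) \<Rightarrow> 'n form" where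
  "contract q \<psi> \<omega> =
     (\<lambda>I\<in>tuples q. \<lambda>x. \<Sum>k\<in>UNIV. \<Sum>K\<in>tuples (q + 1). eps K k I * \<psi> K x * cnj (\<omega> k x))"

definition dbar_rho :: "'n::finite cspace set \<Rightarrow> 'n \<Rightarrow> 'n cspace \<Rightarrow> complex" where
  "dbar_rho \<Omega> k = dzbar k (\<lambda>x. of_real (signed_dist \<Omega> x))"

text \<open>Both unbounded operators are given by their graphs.\<close>

definition dbar_closure :: "'n::{finite,linorder} cspace set \<Rightarrow> nat \<Rightarrow> nat \<Rightarrow> ('n form \<times> 'n form) set" where
  "dbar_closure \<Omega> s q = {(\<phi>, \<eta>). \<phi> \<in> W_form \<Omega> s q \<and> \<eta> \<in> W_form \<Omega> s (q + 1) \<and>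
     (\<exists>u. (\<forall>m::nat. u m \<in> Cinf_form \<Omega> q) \<and>
        (\<lambda>m. form_dist \<Omega> s q (u m) \<phi>) \<longlonglongrightarrow> 0 \<and>
        (\<lambda>m. form_dist \<Omega> s (q + 1) (dbar q (u m)) \<eta>) \<longlonglongrightarrow> 0)}"

definition dbar_adjoint :: "'n::{finite,linorder} cspace set \<Rightarrow> nat \<Rightarrow> nat \<Rightarrow> ('n form \<times> 'n form) set" where
  "dbar_adjoint \<Omega> s q = {(\<psi>, \<theta>). \<psi> \<in> W_form \<Omega> s (q + 1) \<and> \<theta> \<in> W_form \<Omega> s q \<and>
     (\<forall>(\<phi>, \<eta>)\<in>dbar_closure \<Omega> s q. form_inner \<Omega> s (q + 1) \<eta> \<psi> = form_inner \<Omega> s q \<phi> \<theta>)}"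

end

theory Submission
  imports Defs "HOL-Combinatorics.Multiset_Permutations"
begin

text \<open>
  By the Riesz representation theorem, \<open>\<psi>\<close> lies in the domain of the adjoint iff
  \<open>\<phi> \<mapsto> \<langle>dbar \<phi>, \<psi>\<rangle>\<^sub>s\<close> is bounded on smooth forms. Writing the derivatives of order \<open>l\<close> as words of
  length \<open>l\<close> absorbs the multinomial weights, and the terms in which at most \<open>s\<close> derivatives
  fall on \<open>\<phi>\<close> are bounded by Cauchy-Schwarz. What remains, for each coefficient \<open>f\<close> of \<open>\<phi>\<close>, is a functional
  \<open>f \<mapsto> \<Sum>u. \<integral> a\<^sub>u D\<^sub>u f\<close> with \<open>u\<close> running over words of length \<open>s + 1\<close>; it is bounded iff its symbol
  \<open>\<Sum>u. a\<^sub>u \<nu>\<^sub>u\<close> in the normal direction vanishes on the frontier, which is the claimed condition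
  because \<open>N \<nu> = 0\<close>.

  No surface measure is needed: the only integration theorem used is that \<open>D\<^sub>k h\<close> has integral zero
  over \<open>\<Omega>\<close> when \<open>h\<close> vanishes on the frontier. Applied to \<open>r D\<^sub>j G\<close>, with \<open>r\<close> a local defining
  function, it shows that tangential derivatives can be integrated by parts. Hence
  all words may be turned into the normal direction up to bounded terms, which yields sufficiency.
  Necessity follows by testing with \<open>t\<^sup>-\<^sup>s exp (t r) \<theta>\<close> for \<open>t \<rightarrow> \<infinity>\<close>.
\<close>

section \<open>Smooth functions and partial derivatives\<close>

text \<open>The boundary condition is a pure power of \<open>N\<close> because the weights
  |\<alpha>|!/\<alpha>! count the words with the letters of \<alpha>: the symbol is an unweighted
  sum of \<nu>_j \<nu>_w D_w g_j over letters j and words w of length s, with g a field formed from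
  \<psi>. Since \<open>N\<close> annihilates each \<nu>_j, this is, up to conjugation, N^s of the
  contraction, the sum of the \<nu>_j g_j.

  The factor t^(-s) is forced: a derivative of order m multiplies exp(t r) by a polynomial of degree
  m in t. After scaling, orders up to s have bounded factors while exp(t r) tends to 0 where r < 0;
  at order s + 1 one factor t survives, and t exp(t r) acts like a measure on the frontier.

  The signed distance is given only as an infimum and is not smooth globally. The analysis therefore
  uses arbitrary smooth local defining functions; the distance enters through two facts: on the
  frontier its gradient is proportional to theirs, and near it the gradient is constant along normal
  lines, which gives N \<nu> = 0.\<close>

lemma D_eqI:
  assumes "(f has_derivative f') (at x)"
  shows "D k f x = f' (unit_vec k)"
  by (simp add: D_def frechet_derivative_at[OF assms, symmetric])

lemma D_cong_open:
  assumes "open U" "x \<in> U" "\<And>y. y \<in> U \<Longrightarrow> f y = g y"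
  shows "D k f x = D k g x"
proof -
  have "(f has_derivative f') (at x) = (g has_derivative f') (at x)" for f'
    using assms has_derivative_transform_within_open[OF _ assms(1,2)] by metis
  then show ?thesis by (simp add: D_def frechet_derivative_def)
qed

lemma differentiable_cong_open:
  assumes "open U" "x \<in> U" "\<And>y. y \<in> U \<Longrightarrow> f y = g y"
  shows "f differentiable (at x) \<longleftrightarrow> g differentiable (at x)"
proof -
  have "(f has_derivative f') (at x) = (g has_derivative f') (at x)" for f'
    using assms has_derivative_transform_within_open[OF _ assms(1,2)] by metis
  then show ?thesis by (simp add: differentiable_def)
qed

lemma foldr_D_cong:
  assumes "open U" "\<And>y. y \<in> U \<Longrightarrow> f y = g y" "x \<in> U"
  shows "foldr D ks f x = foldr D ks g x"
  using assms(3)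
proof (induction ks arbitrary: x)
  case (Cons k ks)
  then show ?case using D_cong_open[OF assms(1), of x "foldr D ks f" "foldr D ks g"] by simp
qed (use assms in simp)

text \<open>Derivatives of products, inverses and compositions are built from functions of the same
  kind that are smooth to one order less; bounding the order turns each closure property into an
  induction on \<open>m\<close>.\<close>

definition smooth_upto :: "nat \<Rightarrow> 'n::finite cspace set \<Rightarrow> ('n cspace \<Rightarrow> 'b::real_normed_vector) \<Rightarrow> bool" where
  "smooth_upto m U f \<longleftrightarrow> (\<forall>ks. length ks \<le> m \<longrightarrow> (\<forall>x\<in>U. foldr D ks f differentiable (at x)))"

lemma smooth_on_iff_upto: "smooth_on U f \<longleftrightarrow> (\<forall>m. smooth_upto m U f)"
  unfolding smooth_on_def smooth_upto_def by blast

lemma smooth_upto_0: "smooth_upto 0 U f \<longleftrightarrow> (\<forall>x\<in>U. f differentiable (at x))"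
  by (simp add: smooth_upto_def)

lemma smooth_upto_Suc:
  "smooth_upto (Suc m) U f \<longleftrightarrow> (\<forall>x\<in>U. f differentiable (at x)) \<and> (\<forall>k. smooth_upto m U (D k f))"
  (is "?L \<longleftrightarrow> ?R")
proof
  assume L: ?L
  have "foldr D ks (D k f) differentiable (at x)" if "length ks \<le> m" "x \<in> U" for k ks x
    using L[unfolded smooth_upto_def, rule_format, of "ks @ [k]" x] that by simp
  moreover have "f differentiable (at x)" if "x \<in> U" for x
    using L[unfolded smooth_upto_def, rule_format, of "[]" x] that by simp
  ultimately show ?R by (simp add: smooth_upto_def)
next
  assume R: ?R
  have "foldr D ks f differentiable (at x)" if "length ks \<le> Suc m" "x \<in> U" for ks x
  \<comment> \<open>\<open>foldr D\<close> applies the last letter first, so the derivative to be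
    split off sits at the end of the list.\<close>
  proof (cases ks rule: rev_cases)
    case (snoc ks' k)
    then show ?thesis using R that by (simp add: smooth_upto_def)
  qed (use R that in simp)
  then show ?L by (simp add: smooth_upto_def)
qed

lemma smooth_upto_differentiable: "smooth_upto m U f \<Longrightarrow> x \<in> U \<Longrightarrow> f differentiable (at x)"
  by (cases m) (simp_all add: smooth_upto_0 smooth_upto_Suc)

lemma smooth_upto_SucD: "smooth_upto (Suc m) U f \<Longrightarrow> smooth_upto m U f"
  by (simp add: smooth_upto_def)

lemma smooth_upto_cong:
  assumes "open U" "\<And>y. y \<in> U \<Longrightarrow> f y = g y"
  shows "smooth_upto m U f \<longleftrightarrow> smooth_upto m U g"
proof -
  have "foldr D ks f differentiable (at x) \<longleftrightarrow> foldr D ks g differentiable (at x)" if "x \<in> U" for ks x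
    by (rule differentiable_cong_open[OF assms(1) that foldr_D_cong[OF assms]])
  then show ?thesis by (simp add: smooth_upto_def)
qed

lemma smooth_on_cong:
  assumes "open U" "\<And>y. y \<in> U \<Longrightarrow> f y = g y"
  shows "smooth_on U f \<longleftrightarrow> smooth_on U g"
  unfolding smooth_on_iff_upto by (simp add: smooth_upto_cong[OF assms(1), of f g] assms(2))

lemma smooth_on_D: "smooth_on U f \<Longrightarrow> smooth_on U (D k f)"
  unfolding smooth_on_iff_upto using smooth_upto_Suc by blast

lemma smooth_on_foldr_D: "smooth_on U f \<Longrightarrow> smooth_on U (foldr D ks f)"
  by (induction ks) (simp_all add: smooth_on_D)

lemma smooth_on_differentiable: "smooth_on U f \<Longrightarrow> x \<in> U \<Longrightarrow> f differentiable (at x)"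
  using smooth_on_iff_upto smooth_upto_differentiable by blast

lemma smooth_on_subset: "smooth_on U f \<Longrightarrow> V \<subseteq> U \<Longrightarrow> smooth_on V f"
  by (auto simp: smooth_on_def)

lemma smooth_on_Un: "smooth_on U f \<Longrightarrow> smooth_on V f \<Longrightarrow> smooth_on (U \<union> V) f"
  by (auto simp: smooth_on_def)

lemma smooth_on_continuous_on: "smooth_on U f \<Longrightarrow> continuous_on U f"
  using smooth_on_differentiable differentiable_imp_continuous_within
  by (metis continuous_at_imp_continuous_on)

lemma D_const [simp]: "D k (\<lambda>x. c) = (\<lambda>x. 0)"
  by (rule ext, rule D_eqI[where f' = "\<lambda>_. 0"]) simp

lemma D_add:
  assumes "f differentiable (at x)" "g differentiable (at x)"
  shows "D k (\<lambda>x. f x + g x) x = D k f x + D k g x"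
  unfolding D_def[of k f] D_def[of k g]
  by (rule D_eqI[where f' = "\<lambda>h. frechet_derivative f (at x) h + frechet_derivative g (at x) h"],
      rule has_derivative_add) (use assms in \<open>simp_all add: frechet_derivative_works\<close>)

lemma D_bounded_linear:
  assumes "bounded_linear L" "f differentiable (at x)"
  shows "D k (\<lambda>x. L (f x)) x = L (D k f x)"
  unfolding D_def[of k f]
  by (rule D_eqI[where f' = "\<lambda>h. L (frechet_derivative f (at x) h)"], rule bounded_linear.has_derivative)
     (use assms in \<open>simp_all add: frechet_derivative_works\<close>)

lemma D_mult:
  fixes f g :: "'n::finite cspace \<Rightarrow> 'b::real_normed_algebra"
  assumes "f differentiable (at x)" "g differentiable (at x)"
  shows "D k (\<lambda>x. f x * g x) x = D k f x * g x + f x * D k g x"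
  unfolding D_def[of k f] D_def[of k g]
  by (subst D_eqI[OF has_derivative_mult]) (use assms in \<open>simp_all add: frechet_derivative_works add.commute\<close>)

lemma has_derivative_compose_real:
  fixes f :: "'n::finite cspace \<Rightarrow> real"
  assumes "(h has_real_derivative h') (at (f x))" "f differentiable (at x)"
  shows "((\<lambda>x. h (f x)) has_derivative (\<lambda>v. h' * frechet_derivative f (at x) v)) (at x)"
  using has_derivative_compose[of f "frechet_derivative f (at x)" x UNIV h "\<lambda>v. h' * v"] assms
  by (simp add: frechet_derivative_works has_field_derivative_def)

lemma D_compose_real:
  fixes f :: "'n::finite cspace \<Rightarrow> real"
  assumes "(h has_real_derivative h') (at (f x))" "f differentiable (at x)"
  shows "D k (\<lambda>x. h (f x)) x = h' * D k f x"
  using D_eqI[OF has_derivative_compose_real[OF assms]] by (simp add: D_def)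

lemma differentiable_compose_real:
  fixes f :: "'n::finite cspace \<Rightarrow> real"
  assumes "(h has_real_derivative h') (at (f x))" "f differentiable (at x)"
  shows "(\<lambda>x. h (f x)) differentiable (at x)"
  using has_derivative_compose_real[OF assms] unfolding differentiable_def by blast

lemma differentiable_bounded_linear:
  assumes "bounded_linear L" "f differentiable (at x)"
  shows "(\<lambda>x. L (f x)) differentiable (at x)"
  using assms bounded_linear.has_derivative unfolding differentiable_def by blast

lemma smooth_upto_const: "smooth_upto m U (\<lambda>x. c)"
  by (induction m arbitrary: c) (simp_all add: smooth_upto_0 smooth_upto_Suc)

lemma smooth_upto_add:
  assumes "open U"
  shows "smooth_upto m U f \<Longrightarrow> smooth_upto m U g \<Longrightarrow> smooth_upto m U (\<lambda>x. f x + g x)"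
proof (induction m arbitrary: f g)
  case (Suc m)
  have "smooth_upto m U (D k (\<lambda>x. f x + g x))" for k
    by (subst smooth_upto_cong[OF assms, of _ "\<lambda>x. D k f x + D k g x"])
       (use Suc in \<open>auto simp: smooth_upto_Suc D_add\<close>)
  then show ?case using Suc.prems by (simp add: smooth_upto_Suc)
qed (simp add: smooth_upto_0)

lemma smooth_upto_bounded_linear:
  assumes "open U" "bounded_linear L"
  shows "smooth_upto m U f \<Longrightarrow> smooth_upto m U (\<lambda>x. L (f x))"
proof (induction m arbitrary: f)
  case (Suc m)
  have "smooth_upto m U (D k (\<lambda>x. L (f x)))" for k
    by (subst smooth_upto_cong[OF assms(1), of _ "\<lambda>x. L (D k f x)"])
       (use Suc in \<open>auto simp: smooth_upto_Suc D_bounded_linear[OF assms(2)]\<close>)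
  then show ?case using Suc.prems differentiable_bounded_linear[OF assms(2)]
    by (auto simp: smooth_upto_Suc)
qed (auto simp: smooth_upto_0 differentiable_bounded_linear assms)

lemma smooth_upto_mult:
  fixes f g :: "'n::finite cspace \<Rightarrow> 'b::real_normed_algebra"
  assumes "open U"
  shows "smooth_upto m U f \<Longrightarrow> smooth_upto m U g \<Longrightarrow> smooth_upto m U (\<lambda>x. f x * g x)"
proof (induction m arbitrary: f g)
  case (Suc m)
  have fg: "smooth_upto m U f" "smooth_upto m U g" using Suc.prems smooth_upto_SucD by blast+
  have "smooth_upto m U (D k (\<lambda>x. f x * g x))" for k
    by (subst smooth_upto_cong[OF assms, of _ "\<lambda>x. D k f x * g x + f x * D k g x"])
       (use Suc fg in \<open>auto simp: smooth_upto_Suc D_mult intro!: smooth_upto_add[OF assms]\<close>)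
  then show ?case using Suc.prems by (simp add: smooth_upto_Suc)
qed (simp add: smooth_upto_0)

text \<open>The induction needs all derivatives of the outer function at once. A set
  \<open>H\<close> that is closed under differentiation on \<open>T\<close> supplies them without
  naming them; it will be \<open>{exp}\<close> or \<open>range flat\<close>.\<close>

lemma smooth_upto_compose_real:
  fixes f :: "'n::finite cspace \<Rightarrow> real"
  assumes "open U"
    and H: "\<And>h. h \<in> H \<Longrightarrow> \<exists>h'\<in>H. \<forall>t\<in>T. (h has_real_derivative h' t) (at t)"
    and T: "\<And>x. x \<in> U \<Longrightarrow> f x \<in> T"
  shows "smooth_upto m U f \<Longrightarrow> h \<in> H \<Longrightarrow> smooth_upto m U (\<lambda>x. h (f x))"
proof (induction m arbitrary: h)
  case 0
  then show ?case using H[OF \<open>h \<in> H\<close>] T unfolding smooth_upto_0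
    by (metis differentiable_compose_real)
next
  case (Suc m)
  obtain h' where h': "h' \<in> H" "\<forall>t\<in>T. (h has_real_derivative h' t) (at t)"
    using H[OF \<open>h \<in> H\<close>] by blast
  have "smooth_upto m U (\<lambda>x. h' (f x))" using Suc h' smooth_upto_SucD by blast
  then have "smooth_upto m U (D k (\<lambda>x. h (f x)))" for k
    by (subst smooth_upto_cong[OF assms(1), of _ "\<lambda>x. h' (f x) * D k f x"])
       (use Suc h' T in \<open>auto simp: smooth_upto_Suc
          intro!: smooth_upto_mult[OF assms(1)] D_compose_real\<close>)
  moreover have "\<forall>x\<in>U. (\<lambda>x. h (f x)) differentiable (at x)"
    using h' T Suc.prems(1) unfolding smooth_upto_Suc
    by (metis differentiable_compose_real)
  ultimately show ?case by (simp add: smooth_upto_Suc)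
qed

lemma smooth_on_const [simp]: "smooth_on U (\<lambda>x. c)"
  by (simp add: smooth_on_iff_upto smooth_upto_const)

lemma smooth_on_add: "open U \<Longrightarrow> smooth_on U f \<Longrightarrow> smooth_on U g \<Longrightarrow> smooth_on U (\<lambda>x. f x + g x)"
  by (simp add: smooth_on_iff_upto smooth_upto_add)

lemma smooth_on_mult:
  fixes f g :: "'n::finite cspace \<Rightarrow> 'b::real_normed_algebra"
  shows "open U \<Longrightarrow> smooth_on U f \<Longrightarrow> smooth_on U g \<Longrightarrow> smooth_on U (\<lambda>x. f x * g x)"
  by (simp add: smooth_on_iff_upto smooth_upto_mult)

lemma smooth_on_bounded_linear:
  "open U \<Longrightarrow> bounded_linear L \<Longrightarrow> smooth_on U f \<Longrightarrow> smooth_on U (\<lambda>x. L (f x))"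
  by (simp add: smooth_on_iff_upto smooth_upto_bounded_linear)

lemma smooth_on_compose_real:
  fixes f :: "'n::finite cspace \<Rightarrow> real"
  assumes "open U" "smooth_on U f" "h \<in> H"
    and "\<And>h. h \<in> H \<Longrightarrow> \<exists>h'\<in>H. \<forall>t\<in>T. (h has_real_derivative h' t) (at t)"
    and "\<And>x. x \<in> U \<Longrightarrow> f x \<in> T"
  shows "smooth_on U (\<lambda>x. h (f x))"
  using smooth_upto_compose_real[OF assms(1), of H T f] assms by (simp add: smooth_on_iff_upto)

lemma smooth_on_of_real: "open U \<Longrightarrow> smooth_on U f \<Longrightarrow> smooth_on U (\<lambda>x. complex_of_real (f x))"
  by (rule smooth_on_bounded_linear[OF _ bounded_linear_of_real])

lemma smooth_on_cnj: "open U \<Longrightarrow> smooth_on U f \<Longrightarrow> smooth_on U (\<lambda>x. cnj (f x))"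
  by (rule smooth_on_bounded_linear[OF _ bounded_linear_cnj])

lemma smooth_on_cmult:
  fixes f :: "'n::finite cspace \<Rightarrow> 'b::real_normed_algebra"
  shows "open U \<Longrightarrow> smooth_on U f \<Longrightarrow> smooth_on U (\<lambda>x. c * f x)"
  by (rule smooth_on_bounded_linear[OF _ bounded_linear_mult_right])

lemma smooth_on_minus: "open U \<Longrightarrow> smooth_on U f \<Longrightarrow> smooth_on U (\<lambda>x. - f x)"
  by (rule smooth_on_bounded_linear[OF _ bounded_linear_minus[OF bounded_linear_ident]])

lemma smooth_on_diff: "open U \<Longrightarrow> smooth_on U f \<Longrightarrow> smooth_on U g \<Longrightarrow> smooth_on U (\<lambda>x. f x - g x)"
  using smooth_on_add[of U f "\<lambda>x. - g x"] smooth_on_minus[of U g] by simp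

lemma smooth_on_sum: "open U \<Longrightarrow> (\<And>i. i \<in> I \<Longrightarrow> smooth_on U (f i)) \<Longrightarrow> smooth_on U (\<lambda>x. \<Sum>i\<in>I. f i x)"
  by (induction I rule: infinite_finite_induct) (simp_all add: smooth_on_add)

lemma smooth_on_linear:
  assumes "bounded_linear L"
  shows "smooth_on U L"
proof -
  have D: "D k L = (\<lambda>x. L (unit_vec k))" for k
    by (rule ext, rule D_eqI) (simp add: assms bounded_linear_imp_has_derivative)
  have "smooth_upto m UNIV L" for m
    using bounded_linear_imp_differentiable[OF assms]
    by (cases m) (auto simp: smooth_upto_0 smooth_upto_Suc D smooth_upto_const)
  then show ?thesis using smooth_on_iff_upto smooth_on_subset by blast
qed

text \<open>The derivative of 1/f is - Df (1/f)^2, which involves only Df and 1/f itself; both are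
  smooth to the lower order by induction.\<close>

lemma smooth_upto_inverse:
  fixes f :: "'n::finite cspace \<Rightarrow> 'b::real_normed_field"
  assumes "open U" "\<And>x. x \<in> U \<Longrightarrow> f x \<noteq> 0"
  shows "smooth_upto m U f \<Longrightarrow> smooth_upto m U (\<lambda>x. inverse (f x))"
proof (induction m)
  case 0 then show ?case using assms by (simp add: smooth_upto_0 differentiable_inverse)
next
  case (Suc m)
  have I: "smooth_upto m U (\<lambda>x. inverse (f x))" using Suc smooth_upto_SucD by blast
  have "D k (\<lambda>x. inverse (f x)) x = - 1 * (D k f x * (inverse (f x) * inverse (f x)))" if "x \<in> U" for k x
  proof -
    have "(f has_derivative frechet_derivative f (at x)) (at x)"
      using smooth_upto_differentiable[OF Suc.prems that] by (simp add: frechet_derivative_works)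
    from D_eqI[OF Deriv.has_derivative_inverse[OF assms(2)[OF that] this]] show ?thesis
      by (simp add: D_def mult_ac)
  qed
  moreover have "smooth_upto m U (\<lambda>x. - 1 * (D k f x * (inverse (f x) * inverse (f x))))" for k
    by (intro smooth_upto_mult[OF assms(1)] smooth_upto_const I) (use Suc.prems in \<open>simp add: smooth_upto_Suc\<close>)
  ultimately have "smooth_upto m U (D k (\<lambda>x. inverse (f x)))" for k
    using smooth_upto_cong[OF assms(1), of "D k (\<lambda>x. inverse (f x))"
      "\<lambda>x. - 1 * (D k f x * (inverse (f x) * inverse (f x)))" m] by simp
  then show ?case using Suc.prems assms by (simp add: smooth_upto_Suc differentiable_inverse)
qed

lemma smooth_on_inverse:
  fixes f :: "'n::finite cspace \<Rightarrow> 'b::real_normed_field"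
  shows "open U \<Longrightarrow> (\<And>x. x \<in> U \<Longrightarrow> f x \<noteq> 0) \<Longrightarrow> smooth_on U f \<Longrightarrow> smooth_on U (\<lambda>x. inverse (f x))"
  by (simp add: smooth_on_iff_upto smooth_upto_inverse)

lemma smooth_on_exp:
  fixes f :: "'n::finite cspace \<Rightarrow> real"
  shows "open U \<Longrightarrow> smooth_on U f \<Longrightarrow> smooth_on U (\<lambda>x. exp (f x))"
  by (rule smooth_on_compose_real[where H = "{exp}" and T = UNIV]) (auto intro: DERIV_exp)

section \<open>Mixed derivatives and bump functions\<close>

lemma inner_unit_vec: "unit_vec j \<bullet> unit_vec k = (if j = k then 1 else 0)"
proof -
  have "axis a x \<bullet> axis b y = (if a = b then x \<bullet> y else 0)" for a b :: 'a and x y :: complex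
    by (simp add: inner_axis_axis)
  then show ?thesis by (cases j; cases k) (auto simp: inner_complex_def)
qed

lemma norm_unit_vec [simp]: "norm (unit_vec k) = 1"
  by (simp add: norm_eq_sqrt_inner inner_unit_vec)

lemma Basis_eq_range_unit_vec: "(Basis :: 'n::finite cspace set) = range unit_vec"
proof -
  have "(Basis :: 'n cspace set) = range (\<lambda>i. axis i 1) \<union> range (\<lambda>i. axis i \<i>)"
    by (auto simp: Basis_vec_def Basis_complex_def)
  moreover have "range unit_vec = range (unit_vec \<circ> Inl) \<union> range (unit_vec \<circ> Inr :: 'n \<Rightarrow> _)"
    by (simp add: UNIV_sum image_Un image_comp)
  ultimately show ?thesis by (simp add: comp_def)
qed

lemma inj_unit_vec: "inj unit_vec"
  using inner_unit_vec by (metis injI zero_neq_one)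

lemma sum_unit_vec_Basis: "(\<Sum>k\<in>UNIV. f (unit_vec k)) = (\<Sum>b\<in>(Basis :: 'n::finite cspace set). f b)"
  unfolding Basis_eq_range_unit_vec by (simp add: sum.reindex[OF inj_unit_vec])

lemma cspace_expansion: "x = (\<Sum>k\<in>UNIV. (x \<bullet> unit_vec k) *\<^sub>R unit_vec k)" for x :: "'n::finite cspace"
  using sum_unit_vec_Basis[of "\<lambda>b. (x \<bullet> b) *\<^sub>R b"] euclidean_representation[of x] by simp

lemma inner_expansion: "x \<bullet> y = (\<Sum>k\<in>UNIV. (x \<bullet> unit_vec k) * (y \<bullet> unit_vec k))" for x y :: "'n::finite cspace"
  using sum_unit_vec_Basis[of "\<lambda>b. (x \<bullet> b) * (y \<bullet> b)"] euclidean_inner[of x y] by simp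

lemma frechet_derivative_eq_sum_D:
  fixes f :: "'n::finite cspace \<Rightarrow> 'b::real_normed_vector"
  assumes "f differentiable (at x)"
  shows "frechet_derivative f (at x) v = (\<Sum>k\<in>UNIV. (v \<bullet> unit_vec k) *\<^sub>R D k f x)"
proof -
  interpret bounded_linear "frechet_derivative f (at x)"
    using assms frechet_derivative_works has_derivative_bounded_linear by blast
  have "frechet_derivative f (at x) v = frechet_derivative f (at x) (\<Sum>k\<in>UNIV. (v \<bullet> unit_vec k) *\<^sub>R unit_vec k)"
    using cspace_expansion[of v] by simp
  then show ?thesis by (simp add: sum scaleR D_def)
qed

lemma has_derivative_sum_D:
  fixes f :: "'n::finite cspace \<Rightarrow> 'b::real_normed_vector"
  assumes "f differentiable (at x)"
  shows "(f has_derivative (\<lambda>v. \<Sum>k\<in>UNIV. (v \<bullet> unit_vec k) *\<^sub>R D k f x)) (at x)"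
  using frechet_derivative_works[THEN iffD1, OF assms] frechet_derivative_eq_sum_D[OF assms]
  by (metis (no_types, lifting) ext)

lemma has_vector_derivative_along_unit_vec:
  assumes "f differentiable (at (x + t *\<^sub>R unit_vec k))"
  shows "((\<lambda>t. f (x + t *\<^sub>R unit_vec k)) has_vector_derivative D k f (x + t *\<^sub>R unit_vec k)) (at t)"
proof -
  let ?p = "x + t *\<^sub>R unit_vec k"
  interpret bounded_linear "frechet_derivative f (at ?p)"
    using assms frechet_derivative_works has_derivative_bounded_linear by blast
  have "((\<lambda>t. x + t *\<^sub>R unit_vec k) has_derivative (\<lambda>s. s *\<^sub>R unit_vec k)) (at t)"
    by (auto intro!: derivative_eq_intros)
  from has_derivative_compose[OF this, of f "frechet_derivative f (at ?p)"]
  show ?thesis using assms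
    by (simp add: has_vector_derivative_def D_def frechet_derivative_works scaleR)
qed

lemma has_real_derivative_along_unit_vec:
  fixes f :: "'n::finite cspace \<Rightarrow> real"
  assumes "f differentiable (at (x + t *\<^sub>R unit_vec k))"
  shows "((\<lambda>t. f (x + t *\<^sub>R unit_vec k)) has_real_derivative D k f (x + t *\<^sub>R unit_vec k)) (at t)"
  using has_vector_derivative_along_unit_vec[OF assms]
  by (simp add: has_real_derivative_iff_has_vector_derivative)

lemma D_mean_value:
  fixes f :: "'n::finite cspace \<Rightarrow> real"
  assumes "a < b" "\<And>t. a \<le> t \<Longrightarrow> t \<le> b \<Longrightarrow> f differentiable (at (x + t *\<^sub>R unit_vec k))"
  obtains t where "a < t" "t < b"
    "f (x + b *\<^sub>R unit_vec k) - f (x + a *\<^sub>R unit_vec k) = (b - a) * D k f (x + t *\<^sub>R unit_vec k)"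
  using MVT2[OF assms(1), of "\<lambda>t. f (x + t *\<^sub>R unit_vec k)" "\<lambda>t. D k f (x + t *\<^sub>R unit_vec k)"]
    has_real_derivative_along_unit_vec assms(2) by blast

text \<open>Two applications of the mean value theorem: along \<open>i\<close> to the increment
  \<open>g\<close> in direction \<open>j\<close>, then along \<open>j\<close> to
  \<open>D i f\<close>. The left-hand side is symmetric in \<open>i\<close> and \<open>j\<close>,
  which is what yields the symmetry of mixed derivatives. Two steps of length at most
  \<open>h\<close> stay within \<open>3 * h\<close> of \<open>x\<close>.\<close>

lemma second_difference:
  fixes f :: "'n::finite cspace \<Rightarrow> real"
  assumes "open U" "smooth_on U f" "h > 0" "ball x (3 * h) \<subseteq> U"
  obtains y where "dist x y < 3 * h"
    "f (x + h *\<^sub>R unit_vec i + h *\<^sub>R unit_vec j) - f (x + h *\<^sub>R unit_vec i) - f (x + h *\<^sub>R unit_vec j) + f x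
       = h\<^sup>2 * D j (D i f) y"
proof -
  have bnd: "norm (a *\<^sub>R unit_vec k + b *\<^sub>R unit_vec l) < 3 * h"
    if "0 \<le> a" "a \<le> h" "0 \<le> b" "b \<le> h" for a b and k l :: "'n + 'n"
    using norm_triangle_ineq[of "a *\<^sub>R unit_vec k" "b *\<^sub>R unit_vec l"] that \<open>h > 0\<close> by simp
  have inU: "x + a *\<^sub>R unit_vec k + b *\<^sub>R unit_vec l \<in> U"
    if "0 \<le> a" "a \<le> h" "0 \<le> b" "b \<le> h" for a b and k l :: "'n + 'n"
    using assms(4) bnd[OF that, of k l] by (auto simp: dist_norm norm_minus_commute add.assoc subset_iff)
  define g where "g = (\<lambda>y. f (y + h *\<^sub>R unit_vec j) + (-1) * f y)"
  have sh: "D i (\<lambda>y. f (y + h *\<^sub>R unit_vec j)) y = D i f (y + h *\<^sub>R unit_vec j)"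
    "(\<lambda>y. f (y + h *\<^sub>R unit_vec j)) differentiable (at y)" if "y + h *\<^sub>R unit_vec j \<in> U" for y
  proof -
    have s: "((\<lambda>y. y + h *\<^sub>R unit_vec j) has_derivative (\<lambda>v. v)) (at y)"
      by (auto intro!: derivative_eq_intros)
    from has_derivative_compose[OF s, of f "frechet_derivative f (at (y + h *\<^sub>R unit_vec j))"]
    have *: "((\<lambda>y. f (y + h *\<^sub>R unit_vec j)) has_derivative frechet_derivative f (at (y + h *\<^sub>R unit_vec j))) (at y)"
      using smooth_on_differentiable[OF assms(2) that] by (simp add: frechet_derivative_works)
    then show "(\<lambda>y. f (y + h *\<^sub>R unit_vec j)) differentiable (at y)" by (auto simp: differentiable_def)
    show "D i (\<lambda>y. f (y + h *\<^sub>R unit_vec j)) y = D i f (y + h *\<^sub>R unit_vec j)"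
      using D_eqI[OF *] by (simp add: D_def)
  qed
  have fd: "f differentiable (at y)" if "y \<in> U" for y using smooth_on_differentiable[OF assms(2) that] .
  have gd: "g differentiable (at (x + t *\<^sub>R unit_vec i))" if "0 \<le> t" "t \<le> h" for t
    unfolding g_def using inU[OF that, of h i j] inU[OF that, of 0 i j] \<open>h > 0\<close>
    by (intro differentiable_add differentiable_mult differentiable_const sh fd) simp_all
  obtain t where t: "0 < t" "t < h"
    "g (x + h *\<^sub>R unit_vec i) - g (x + 0 *\<^sub>R unit_vec i) = (h - 0) * D i g (x + t *\<^sub>R unit_vec i)"
    using D_mean_value[of 0 h g x i] gd \<open>h > 0\<close> by metis
  let ?z = "x + t *\<^sub>R unit_vec i"
  have zU: "?z + b *\<^sub>R unit_vec j \<in> U" if "0 \<le> b" "b \<le> h" for b using inU[of t b i j] t that by simp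
  have "D i g ?z = D i f (?z + h *\<^sub>R unit_vec j) - D i f ?z"
    unfolding g_def using zU[of h] zU[of 0] \<open>h > 0\<close> sh[of ?z] fd[of ?z]
    by (subst D_add) (auto simp: D_bounded_linear[OF bounded_linear_minus[OF bounded_linear_ident]] intro: differentiable_minus)
  moreover obtain b where b: "0 < b" "b < h"
    "D i f (?z + h *\<^sub>R unit_vec j) - D i f (?z + 0 *\<^sub>R unit_vec j) = (h - 0) * D j (D i f) (?z + b *\<^sub>R unit_vec j)"
    using D_mean_value[of 0 h "D i f" ?z j] smooth_on_differentiable[OF smooth_on_D[OF assms(2)]] zU \<open>h > 0\<close>
    by metis
  ultimately have "g (x + h *\<^sub>R unit_vec i) - g x = h\<^sup>2 * D j (D i f) (?z + b *\<^sub>R unit_vec j)"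
    using t(3) by (simp add: power2_eq_square)
  then have *: "f (x + h *\<^sub>R unit_vec i + h *\<^sub>R unit_vec j) - f (x + h *\<^sub>R unit_vec i) - f (x + h *\<^sub>R unit_vec j) + f x
       = h\<^sup>2 * D j (D i f) (?z + b *\<^sub>R unit_vec j)" by (simp add: g_def)
  have "dist x (?z + b *\<^sub>R unit_vec j) < 3 * h"
    unfolding dist_commute[of x] using bnd[of t b i j] t b by (simp add: dist_norm add.assoc)
  then show ?thesis using * by (rule that)
qed

text \<open>Schwarz's theorem: the same second difference is \<open>h\<^sup>2\<close> times either
  mixed derivative at suitable points near \<open>x\<close>, and both mixed derivatives are
  continuous there. Half of the assumed gap serves as the tolerance for each.\<close>

lemma D_commute_real:
  fixes f :: "'n::finite cspace \<Rightarrow> real"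
  assumes "open U" "smooth_on U f" "x \<in> U"
  shows "D i (D j f) x = D j (D i f) x"
proof (rule ccontr)
  assume neq: "D i (D j f) x \<noteq> D j (D i f) x"
  define \<epsilon> where "\<epsilon> = \<bar>D i (D j f) x - D j (D i f) x\<bar> / 2"
  have "\<epsilon> > 0" using neq by (simp add: \<epsilon>_def)
  have c: "continuous (at x) (D k (D l f))" for k l
    using smooth_on_differentiable[OF smooth_on_D[OF smooth_on_D[OF assms(2)]] assms(3)]
      differentiable_imp_continuous_within by blast
  have ex: "\<exists>d>0. \<forall>y. dist y x < d \<longrightarrow> dist (D k (D l f) y) (D k (D l f) x) < \<epsilon>" for k l
    using c[of k l] \<open>\<epsilon> > 0\<close> unfolding continuous_at_eps_delta by blast
  obtain d1 d2 where d: "d1 > 0" "d2 > 0"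
    "\<And>y. dist y x < d1 \<Longrightarrow> dist (D i (D j f) y) (D i (D j f) x) < \<epsilon>"
    "\<And>y. dist y x < d2 \<Longrightarrow> dist (D j (D i f) y) (D j (D i f) x) < \<epsilon>"
    using ex[of i j] ex[of j i] by metis
  obtain d3 where d3: "d3 > 0" "ball x d3 \<subseteq> U" using assms open_contains_ball by blast
  define h where "h = min d1 (min d2 d3) / 3"
  have h: "h > 0" "3 * h \<le> d1" "3 * h \<le> d2" "ball x (3 * h) \<subseteq> U"
    using d d3 by (auto simp: h_def)
  obtain y where y: "dist x y < 3 * h"
    "f (x + h *\<^sub>R unit_vec i + h *\<^sub>R unit_vec j) - f (x + h *\<^sub>R unit_vec i) - f (x + h *\<^sub>R unit_vec j) + f x
       = h\<^sup>2 * D j (D i f) y"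
    using second_difference[OF assms(1,2) h(1,4)] by metis
  obtain z where z: "dist x z < 3 * h"
    "f (x + h *\<^sub>R unit_vec j + h *\<^sub>R unit_vec i) - f (x + h *\<^sub>R unit_vec j) - f (x + h *\<^sub>R unit_vec i) + f x
       = h\<^sup>2 * D i (D j f) z"
    using second_difference[OF assms(1,2) h(1,4)] by metis
  have "h\<^sup>2 * D j (D i f) y = h\<^sup>2 * D i (D j f) z"
    using y(2) z(2) by (simp add: algebra_simps)
  then have "D j (D i f) y = D i (D j f) z" using h(1) by simp
  moreover have "\<bar>D j (D i f) y - D j (D i f) x\<bar> < \<epsilon>" "\<bar>D i (D j f) z - D i (D j f) x\<bar> < \<epsilon>"
    using d(3)[of z] d(4)[of y] y z h by (auto simp: dist_commute dist_real_def)
  ultimately show False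
    using abs_triangle_ineq4[of "D i (D j f) z - D i (D j f) x" "D i (D j f) z - D j (D i f) x"]
    by (simp add: \<epsilon>_def abs_minus_commute)
qed

text \<open>The mean value theorem needs real values, so the real and imaginary parts are treated
  separately.\<close>

lemma D_commute:
  fixes f :: "'n::finite cspace \<Rightarrow> complex"
  assumes "open U" "smooth_on U f" "x \<in> U"
  shows "D i (D j f) x = D j (D i f) x"
proof -
  have L: "D k (D l (\<lambda>x. L (f x))) x = L (D k (D l f) x)" if "bounded_linear L" for k l and L :: "complex \<Rightarrow> real"
  proof -
    have "D k (D l (\<lambda>x. L (f x))) x = D k (\<lambda>x. L (D l f x)) x"
      by (rule D_cong_open[OF assms(1,3)]) (simp add: D_bounded_linear[OF that] smooth_on_differentiable[OF assms(2)])
    then show ?thesis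
      using D_bounded_linear[OF that smooth_on_differentiable[OF smooth_on_D[OF assms(2)] assms(3)]] by simp
  qed
  have "L (D i (D j f) x) = L (D j (D i f) x)" if "bounded_linear L" for L :: "complex \<Rightarrow> real"
    using L[OF that] D_commute_real[OF assms(1) smooth_on_bounded_linear[OF assms(1) that assms(2)] assms(3)]
    by metis
  from this[OF bounded_linear_Re] this[OF bounded_linear_Im] show ?thesis by (simp add: complex_eq_iff)
qed

text \<open>The functions p(1/t) exp(-1/t), extended by 0 to t \<le> 0. Carrying the polynomial as a
  parameter makes the family closed under differentiation, as \<open>smooth_on_compose_real\<close>
  requires.\<close>

definition flat :: "real poly \<Rightarrow> real \<Rightarrow> real" where
  "flat p t = (if t > 0 then poly p (1 / t) * exp (- (1 / t)) else 0)"

lemma poly_div_exp_tendsto_0: "((\<lambda>u. poly p u * exp (- u)) \<longlongrightarrow> (0::real)) at_top"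
proof -
  have "((\<lambda>u. \<Sum>i\<le>degree p. coeff p i * (u ^ i / exp u)) \<longlongrightarrow> (\<Sum>i\<le>degree p. coeff p i * 0)) at_top"
    by (intro tendsto_intros tendsto_power_div_exp_0)
  then show ?thesis
    by (simp add: poly_altdef exp_minus sum_distrib_right divide_inverse mult.assoc)
qed

text \<open>With u = 1/t, the derivative of p(u) exp(-u) in t is u^2 (p(u) - p'(u)) exp(-u), and
  \<open>[:0, 0, 1:]\<close> is the polynomial X^2. Only t = 0 needs an argument, where the
  exponential beats every power of 1/t.\<close>

lemma flat_has_derivative:
  "(flat p has_real_derivative flat ([:0, 0, 1:] * (p - pderiv p)) t) (at t)"
proof -
  consider "t > 0" | "t < 0" | "t = 0" by linarith
  then show ?thesis
  proof cases
    case 1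
    have "((\<lambda>t. poly p (1 / t) * exp (- (1 / t))) has_real_derivative
        flat ([:0, 0, 1:] * (p - pderiv p)) t) (at t)"
      using 1 by (auto intro!: derivative_eq_intros DERIV_chain2[OF poly_DERIV]
        simp: flat_def field_simps power2_eq_square)
    then show ?thesis
      by (rule has_field_derivative_transform_within_open[of _ _ _ "{0<..}"]) (use 1 in \<open>auto simp: flat_def\<close>)
  next
    case 2
    have "((\<lambda>t. 0) has_real_derivative flat ([:0, 0, 1:] * (p - pderiv p)) t) (at t)"
      using 2 by (simp add: flat_def)
    then show ?thesis
      by (rule has_field_derivative_transform_within_open[of _ _ _ "{..<0}"]) (use 2 in \<open>auto simp: flat_def\<close>)
  next
    case 3
    have "((\<lambda>y. flat p y / y) \<longlongrightarrow> 0) (at_right 0)"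
    proof -
      \<comment> \<open>\<open>pCons 0 p\<close> is X p; the extra factor 1/y is the denominator of
        the difference quotient at 0.\<close>
      have "((\<lambda>y. poly (pCons 0 p) (inverse y) * exp (- inverse y)) \<longlongrightarrow> 0) (at_right (0::real))"
        using poly_div_exp_tendsto_0 filterlim_inverse_at_top_right by (rule filterlim_compose)
      then show ?thesis
        by (rule Lim_transform_eventually)
           (auto simp: eventually_at_right_field flat_def field_simps intro!: exI[of _ 1])
    qed
    moreover have "((\<lambda>y. flat p y / y) \<longlongrightarrow> 0) (at_left 0)"
      by (rule Lim_transform_eventually[of "\<lambda>_. 0"])
         (auto simp: eventually_at_left_field flat_def intro!: exI[of _ "-1"])
    ultimately have "((\<lambda>y. flat p y / y) \<longlongrightarrow> 0) (at 0)"
      using filterlim_split_at by blast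
    then show ?thesis using 3 by (simp add: has_field_derivative_iff flat_def)
  qed
qed

lemma smooth_on_flat:
  assumes "open U" "smooth_on U f"
  shows "smooth_on U (\<lambda>x. flat p (f x))"
  by (rule smooth_on_compose_real[where H = "range flat" and T = UNIV])
     (use assms flat_has_derivative in blast)+

section \<open>Bumps on balls, cutoffs and extension by zero\<close>

definition bump :: "real \<Rightarrow> real" where "bump t = flat 1 t"

lemma bump_nonneg [simp]: "0 \<le> bump t" and bump_pos_iff [simp]: "0 < bump t \<longleftrightarrow> 0 < t"
  and bump_eq_0_iff [simp]: "bump t = 0 \<longleftrightarrow> t \<le> 0"
  by (auto simp: bump_def flat_def)

lemma smooth_on_bump: "open U \<Longrightarrow> smooth_on U f \<Longrightarrow> smooth_on U (\<lambda>x. bump (f x))"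
  unfolding bump_def by (rule smooth_on_flat)

lemma smooth_on_dist_sq: "smooth_on UNIV (\<lambda>x :: 'n::finite cspace. (dist c x)\<^sup>2)"
proof -
  have "(\<lambda>x. (dist c x)\<^sup>2) = (\<lambda>x. \<Sum>k\<in>UNIV. (x \<bullet> unit_vec k - c \<bullet> unit_vec k) * (x \<bullet> unit_vec k - c \<bullet> unit_vec k))"
  proof
    fix x
    show "(dist c x)\<^sup>2 = (\<Sum>k\<in>UNIV. (x \<bullet> unit_vec k - c \<bullet> unit_vec k) * (x \<bullet> unit_vec k - c \<bullet> unit_vec k))"
      using inner_expansion[of "x - c" "x - c"] power2_norm_eq_inner[of "x - c"] dist_commute[of c x]
      by (simp only: dist_norm inner_diff_left)
  qed
  moreover have "smooth_on UNIV (\<lambda>x. \<Sum>k\<in>UNIV. (x \<bullet> unit_vec k - c \<bullet> unit_vec k) * (x \<bullet> unit_vec k - c \<bullet> unit_vec k))"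
    by (intro smooth_on_sum smooth_on_mult smooth_on_diff smooth_on_const smooth_on_linear
        bounded_linear_inner_left open_UNIV)
  ultimately show ?thesis by simp
qed

text \<open>Squares are taken because the distance itself is not differentiable at the centre
  \<open>c\<close>.\<close>

definition ball_bump :: "'n::finite cspace \<Rightarrow> real \<Rightarrow> 'n cspace \<Rightarrow> real" where
  "ball_bump c R x = bump (R\<^sup>2 - (dist c x)\<^sup>2)"

lemma ball_bump_pos_iff: "R > 0 \<Longrightarrow> 0 < ball_bump c R x \<longleftrightarrow> x \<in> ball c R"
  and ball_bump_eq_0_iff: "R > 0 \<Longrightarrow> ball_bump c R x = 0 \<longleftrightarrow> x \<notin> ball c R"
  and ball_bump_nonneg [simp]: "0 \<le> ball_bump c R x"
  using power_strict_mono[of "dist c x" R 2] power_mono[of R "dist c x" 2]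
  by (auto simp: ball_bump_def not_less dest: power2_less_imp_less)

lemma smooth_on_ball_bump: "smooth_on UNIV (ball_bump c R)"
  unfolding ball_bump_def
  by (intro smooth_on_bump smooth_on_diff smooth_on_const smooth_on_dist_sq open_UNIV)

text \<open>The quotient a / (a + b), where a is positive exactly inside radius \<open>R2\<close>
  and b exactly outside radius \<open>R1\<close>. As \<open>R1 < R2\<close>, at least one of them is
  positive at every point, so the denominator never vanishes.\<close>

lemma smooth_cutoff_exists:
  fixes c :: "'n::finite cspace"
  assumes "0 < R1" "R1 < R2"
  obtains \<kappa> :: "'n cspace \<Rightarrow> real" where "smooth_on UNIV \<kappa>" "\<And>x. x \<in> ball c R1 \<Longrightarrow> \<kappa> x = 1"
    "\<And>x. x \<notin> ball c R2 \<Longrightarrow> \<kappa> x = 0"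
proof
  let ?a = "\<lambda>x. bump (R2\<^sup>2 - (dist c x)\<^sup>2)" and ?b = "\<lambda>x. bump ((dist c x)\<^sup>2 - R1\<^sup>2)"
  have R: "R1\<^sup>2 < R2\<^sup>2" using assms by (intro power_strict_mono) auto
  have pos: "?a x + ?b x \<noteq> 0" for x
    using R bump_nonneg[of "R2\<^sup>2 - (dist c x)\<^sup>2"] bump_nonneg[of "(dist c x)\<^sup>2 - R1\<^sup>2"]
      add_nonneg_eq_0_iff[of "?a x" "?b x"] by auto
  show "smooth_on UNIV (\<lambda>x. ?a x * inverse (?a x + ?b x))"
    by (intro smooth_on_mult smooth_on_inverse smooth_on_add smooth_on_bump smooth_on_diff smooth_on_const
        smooth_on_dist_sq open_UNIV pos)
  show "?a x * inverse (?a x + ?b x) = 1" if "x \<in> ball c R1" for x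
  proof -
    have "(dist c x)\<^sup>2 \<le> R1\<^sup>2" using that by (intro power_mono) auto
    then have b0: "?b x = 0" by simp
    show ?thesis using pos[of x] unfolding b0 by simp
  qed
  show "?a x * inverse (?a x + ?b x) = 0" if "x \<notin> ball c R2" for x
  proof -
    have "R2\<^sup>2 \<le> (dist c x)\<^sup>2" using that assms by (intro power_mono) auto
    then show ?thesis by simp
  qed
qed

lemma smooth_on_extend_by_0:
  assumes "open V" "smooth_on V f" "closed S" "S \<subseteq> V" "\<And>x. x \<notin> S \<Longrightarrow> f x = 0"
  shows "smooth_on UNIV f"
proof -
  have "smooth_on (- S) f"
    by (subst smooth_on_cong[of "- S" f "\<lambda>x. 0"]) (use assms in auto)
  then have "smooth_on (V \<union> - S) f" using assms smooth_on_Un by blast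
  then show ?thesis by (rule smooth_on_subset) (use assms in auto)
qed

section \<open>Local defining functions and integrals of derivatives\<close>

text \<open>A cutoff makes the local defining function smooth on the whole space, so that later
  integrands need no local domains. Near \<open>p\<close> one fixed partial derivative keeps its
  sign \<open>\<sigma>\<close>; by this strict monotonicity every zero of \<open>r\<close> is a
  limit of points with \<open>r < 0\<close>, so the frontier is exactly the zero set.\<close>

lemma frontier_local_defining:
  fixes \<Omega> :: "'n::finite cspace set"
  assumes "smoothly_bounded_domain \<Omega>" "p \<in> frontier \<Omega>"
  obtains \<delta> \<sigma> :: real and r :: "'n cspace \<Rightarrow> real" and k
  where "\<delta> > 0" "\<bar>\<sigma>\<bar> = 1" "smooth_on UNIV r"
    "\<And>x. x \<in> ball p \<delta> \<Longrightarrow> x \<in> \<Omega> \<longleftrightarrow> r x < 0"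
    "\<And>x. x \<in> ball p \<delta> \<Longrightarrow> x \<in> frontier \<Omega> \<longleftrightarrow> r x = 0"
    "\<And>x. x \<in> ball p \<delta> \<Longrightarrow> \<sigma> * D k r x > 0"
proof -
  have "open \<Omega>" using assms by (simp add: smoothly_bounded_domain_def)
  obtain V r0 where V: "open V" "p \<in> V" "smooth_on V (r0 :: 'n cspace \<Rightarrow> real)"
    "\<forall>x\<in>V. \<exists>k. D k r0 x \<noteq> 0" "\<Omega> \<inter> V = {x \<in> V. r0 x < 0}"
    using assms unfolding smoothly_bounded_domain_def by blast
  obtain e where e: "e > 0" "cball p e \<subseteq> V" using V open_contains_cball by blast
  obtain \<kappa> :: "'n cspace \<Rightarrow> real" where \<kappa>: "smooth_on UNIV \<kappa>" "\<And>x. x \<in> ball p (e/2) \<Longrightarrow> \<kappa> x = 1"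
    "\<And>x. x \<notin> ball p e \<Longrightarrow> \<kappa> x = 0"
    using smooth_cutoff_exists[of "e/2" e p] e by auto
  define r where "r = (\<lambda>x. \<kappa> x * r0 x)"
  have smooth: "smooth_on UNIV r"
    unfolding r_def
    by (rule smooth_on_extend_by_0[OF \<open>open V\<close> smooth_on_mult[OF \<open>open V\<close> smooth_on_subset[OF \<kappa>(1)] V(3)], of "cball p e"])
       (use e \<kappa>(3) in \<open>auto simp: subset_iff\<close>)
  have r_eq: "r x = r0 x" if "x \<in> ball p (e/2)" for x using \<kappa>(2)[OF that] by (simp add: r_def)
  have pe: "p \<in> ball p (e/2)" using e by simp
  obtain k where k: "D k r0 p \<noteq> 0" using V by blast
  have "D k r p = D k r0 p" by (rule D_cong_open[OF open_ball pe r_eq])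
  define \<sigma> where "\<sigma> = sgn (D k r p)"
  have \<sigma>: "\<bar>\<sigma>\<bar> = 1" "\<sigma> * D k r p > 0" using k \<open>D k r p = D k r0 p\<close> by (auto simp: \<sigma>_def sgn_mult_self_eq abs_sgn_eq sgn_real_def)
  have cont: "continuous_on UNIV (\<lambda>x. \<sigma> * D k r x)"
    using smooth_on_continuous_on[OF smooth_on_D[OF smooth]] by (intro continuous_intros)
  have "open {x. \<sigma> * D k r x > 0}"
    using open_Collect_less[of "\<lambda>x. 0" "\<lambda>x. \<sigma> * D k r x"] cont by (simp add: continuous_on_const)
  then obtain d where d: "d > 0" "ball p d \<subseteq> {x. \<sigma> * D k r x > 0}"
    using \<sigma>(2) open_contains_ball by blast
  define \<delta> where "\<delta> = min d (e/2)"
  have \<delta>: "\<delta> > 0" "\<delta> \<le> d" "\<delta> \<le> e/2" using d e by (auto simp: \<delta>_def)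
  have pos: "\<sigma> * D k r x > 0" if "x \<in> ball p \<delta>" for x
    using subsetD[OF d(2), of x] that \<delta>(2) by simp
  have inO: "x \<in> \<Omega> \<longleftrightarrow> r x < 0" if "x \<in> ball p \<delta>" for x
  proof -
    have "x \<in> V" "r x = r0 x" using that \<delta> e r_eq by (auto simp: subset_iff)
    then show ?thesis using V(5) by auto
  qed
  have rcont: "continuous_on UNIV r" using smooth by (rule smooth_on_continuous_on)
  have fr: "x \<in> frontier \<Omega> \<longleftrightarrow> r x = 0" if x: "x \<in> ball p \<delta>" for x
  proof
    assume F: "x \<in> frontier \<Omega>"
    then have "x \<notin> \<Omega>" using \<open>open \<Omega>\<close> by (simp add: frontier_def interior_open)
    then have "r x \<ge> 0" using inO[OF x] by simp
    moreover have "\<not> r x > 0"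
    proof
      assume "r x > 0"
      have "open ({y. r y > 0} \<inter> ball p \<delta>)"
        using open_Collect_less[of "\<lambda>x. 0" r] rcont by (simp add: continuous_on_const open_Int)
      moreover have "x \<in> {y. r y > 0} \<inter> ball p \<delta>" using x \<open>r x > 0\<close> by simp
      moreover have "{y. r y > 0} \<inter> ball p \<delta> \<inter> \<Omega> = {}" using inO by force
      ultimately have "x \<notin> closure \<Omega>" using open_Int_closure_eq_empty by blast
      then show False using F by (simp add: frontier_def)
    qed
    ultimately show "r x = 0" by simp
  next
    assume r0: "r x = 0"
    have "x \<in> closure \<Omega>"
    proof (subst closure_approachable, intro allI impI)
      fix \<epsilon> :: real assume "\<epsilon> > 0"
      obtain d' where d': "d' > 0" "ball x d' \<subseteq> ball p \<delta>" using x open_contains_ball open_ball by blast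
      define t where "t = min \<epsilon> d' / 2"
      have t: "0 < t" "t < \<epsilon>" "t < d'" using \<open>\<epsilon> > 0\<close> d' by (auto simp: t_def)
      \<comment> \<open>Moving against the sign \<open>\<sigma>\<close> of the derivative makes
        \<open>r\<close> decrease from its value 0, which leads into
        \<open>\<Omega>\<close>.\<close>
      define y where "y = x + (- \<sigma> * t) *\<^sub>R unit_vec k"
      have seg: "x + s *\<^sub>R unit_vec k \<in> ball p \<delta>" if "\<bar>s\<bar> \<le> t" for s
        using d'(2) that t by (auto simp: dist_norm subset_iff)
      have \<sigma>t: "\<bar>\<sigma> * t\<bar> = t" using \<sigma> t by (simp add: abs_mult)
      have diff: "r differentiable (at z)" for z using smooth_on_differentiable[OF smooth] by blast
      have "r y < 0"
      proof (cases "\<sigma> = 1")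
        case True
        obtain s where s: "- t < s" "s < 0" "r (x + 0 *\<^sub>R unit_vec k) - r (x + (- t) *\<^sub>R unit_vec k) = (0 - (- t)) * D k r (x + s *\<^sub>R unit_vec k)"
          using D_mean_value[of "-t" 0 r x k] t diff by auto
        have "D k r (x + s *\<^sub>R unit_vec k) > 0" using pos[OF seg, of s] s True by simp
        then have "t * D k r (x + s *\<^sub>R unit_vec k) > 0" using t by simp
        then show ?thesis using s(3) r0 True by (simp add: y_def)
      next
        case False
        then have m: "\<sigma> = -1" using \<sigma> by linarith
        obtain s where s: "0 < s" "s < t" "r (x + t *\<^sub>R unit_vec k) - r (x + 0 *\<^sub>R unit_vec k) = (t - 0) * D k r (x + s *\<^sub>R unit_vec k)"
          using D_mean_value[of 0 t r x k] t diff by auto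
        have "D k r (x + s *\<^sub>R unit_vec k) < 0" using pos[OF seg, of s] s m by simp
        then have "t * D k r (x + s *\<^sub>R unit_vec k) < 0" using t by (simp add: mult_pos_neg)
        then show ?thesis using s(3) r0 m by (simp add: y_def)
      qed
      moreover have "y \<in> ball p \<delta>" unfolding y_def by (rule seg) (use \<sigma>t in simp)
      ultimately have "y \<in> \<Omega>" using inO by blast
      moreover have "dist y x < \<epsilon>" using \<sigma>t t by (simp add: y_def dist_norm)
      ultimately show "\<exists>y\<in>\<Omega>. dist y x < \<epsilon>" by blast
    qed
    then show "x \<in> frontier \<Omega>" using inO[OF x] r0 \<open>open \<Omega>\<close> by (simp add: frontier_def interior_open)
  qed
  show thesis by (rule that[OF \<delta>(1) \<sigma>(1) smooth inO fr pos])
qed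

text \<open>The translates by v/(i+1) are pairwise disjoint, have equal measure and lie in one ball;
  infinitely many of them leave room only for measure zero.\<close>

lemma negligible_if_disjoint_translates:
  fixes S :: "'a::euclidean_space set"
  assumes "compact S" "\<And>t x. t \<noteq> 0 \<Longrightarrow> x \<in> S \<Longrightarrow> x + t *\<^sub>R v \<notin> S"
  shows "negligible S"
proof -
  have S: "S \<in> lmeasurable" using assms(1) by (rule lmeasurable_compact)
  obtain B where B: "\<And>x. x \<in> S \<Longrightarrow> norm x \<le> B" using compact_imp_bounded[OF assms(1)] by (auto simp: bounded_iff)
  let ?T = "\<lambda>i::nat. (+) ((1 / real (Suc i)) *\<^sub>R v) ` S"
  have disj: "disjoint_family ?T"
    unfolding disjoint_family_on_def
  proof (intro ballI impI)
    fix i j :: nat assume "i \<noteq> j"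
    show "?T i \<inter> ?T j = {}"
    proof (rule ccontr)
      assume "?T i \<inter> ?T j \<noteq> {}"
      then obtain x y where xy: "x \<in> S" "y \<in> S" "(1 / real (Suc i)) *\<^sub>R v + x = (1 / real (Suc j)) *\<^sub>R v + y" by auto
      then have "x + (1 / real (Suc i) - 1 / real (Suc j)) *\<^sub>R v = y" by (simp add: algebra_simps)
      moreover have "1 / real (Suc i) - 1 / real (Suc j) \<noteq> 0" using \<open>i \<noteq> j\<close> by simp
      ultimately show False using assms(2) xy by blast
    qed
  qed
  have T: "?T i \<in> lmeasurable" for i using measurable_translation[OF S] .
  have sub: "?T i \<subseteq> cball 0 (norm v + B)" for i
  proof -
    have "norm ((1 / real (Suc i)) *\<^sub>R v) \<le> norm v"
      using mult_right_mono[of "1 / real (Suc i)" 1 "norm v"] by simp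
    then show ?thesis using norm_triangle_mono[OF _ B] by (fastforce simp del: of_nat_Suc norm_scaleR)
  qed
  have "real m * measure lebesgue S \<le> measure lebesgue (cball (0::'a) (norm v + B))" for m
  proof -
    have "measure lebesgue (\<Union>i<m. ?T i) = (\<Sum>i<m. measure lebesgue (?T i))"
    proof (rule measure_finite_Union)
      show "?T ` {..<m} \<subseteq> sets lebesgue" using fmeasurableD[OF T] by blast
      show "disjoint_family_on ?T {..<m}" using disj unfolding disjoint_family_on_def by blast
      show "emeasure lebesgue (?T i) \<noteq> \<infinity>" for i unfolding infinity_ennreal_def by (rule fmeasurableD2[OF T])
    qed simp
    also have "\<dots> = real m * measure lebesgue S" by (simp add: measure_translation)
    finally show ?thesis
      using measure_mono_fmeasurable[of "\<Union>i<m. ?T i" "cball (0::'a) (norm v + B)" lebesgue] sub T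
      by (simp add: UN_subset_iff sets.finite_UN fmeasurableD)
  qed
  then have "measure lebesgue S \<le> 0"
    using reals_Archimedean3 by (metis less_le_not_le not_le)
  then have "measure lebesgue S = 0" using measure_nonneg[of lebesgue S] by linarith
  then show ?thesis using S by (simp add: negligible_iff_measure)
qed

text \<open>Near a frontier point \<open>r\<close> is strictly monotone in one coordinate direction,
  so a line in that direction meets the zero set at most once inside the ball. Hence small pieces of
  the frontier are disjoint from all their translates in this direction.\<close>

lemma negligible_frontier:
  fixes \<Omega> :: "'n::finite cspace set"
  assumes "smoothly_bounded_domain \<Omega>"
  shows "negligible (frontier \<Omega>)"
proof (subst locally_negligible_alt, rule ballI)
  fix p assume p: "p \<in> frontier \<Omega>"
  obtain \<delta> \<sigma> :: real and r :: "'n cspace \<Rightarrow> real" and k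
    where r: "\<delta> > 0" "\<bar>\<sigma>\<bar> = 1" "smooth_on UNIV r"
    "\<And>x. x \<in> ball p \<delta> \<Longrightarrow> x \<in> frontier \<Omega> \<longleftrightarrow> r x = 0"
    "\<And>x. x \<in> ball p \<delta> \<Longrightarrow> \<sigma> * D k r x > 0"
    using frontier_local_defining[OF assms p] by metis
  let ?S = "frontier \<Omega> \<inter> cball p (\<delta>/2)"
  have "negligible ?S"
  proof (rule negligible_if_disjoint_translates[where v = "unit_vec k"])
    show "compact ?S" using closed_Int_compact[OF frontier_closed compact_cball] .
    have *: False if "x \<in> ?S" "x + t *\<^sub>R unit_vec k \<in> ?S" "t > 0" for x t
    proof -
      have seg: "x + s *\<^sub>R unit_vec k \<in> ball p \<delta>" if "0 \<le> s" "s \<le> t" for s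
      proof -
        have "x + s *\<^sub>R unit_vec k = (1 - s / t) *\<^sub>R x + (s / t) *\<^sub>R (x + t *\<^sub>R unit_vec k)"
          using \<open>t > 0\<close> by (simp add: algebra_simps)
        moreover have "x \<in> ball p \<delta>" "x + t *\<^sub>R unit_vec k \<in> ball p \<delta>" using \<open>x \<in> ?S\<close> \<open>x + t *\<^sub>R unit_vec k \<in> ?S\<close> r(1) by auto
        ultimately show ?thesis using that \<open>t > 0\<close> convex_ball[of p \<delta>, unfolded convex_alt] by simp
      qed
      obtain s where s: "0 < s" "s < t" "r (x + t *\<^sub>R unit_vec k) - r (x + 0 *\<^sub>R unit_vec k) = (t - 0) * D k r (x + s *\<^sub>R unit_vec k)"
        using D_mean_value[of 0 t r x k] smooth_on_differentiable[OF r(3)] \<open>t > 0\<close> by blast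
      have "r x = 0" "r (x + t *\<^sub>R unit_vec k) = 0"
        using r(4)[OF seg[of 0]] r(4)[OF seg[of t]] that by auto
      then have "D k r (x + s *\<^sub>R unit_vec k) = 0" using s(3) \<open>t > 0\<close> by simp
      then show False using r(5)[OF seg[of s]] s by simp
    qed
    show "x + t *\<^sub>R unit_vec k \<notin> ?S" if "t \<noteq> 0" "x \<in> ?S" for t x
      using *[of x t] *[of "x + t *\<^sub>R unit_vec k" "- t"] that by (cases "t > 0") auto
  qed
  then have "negligible (frontier \<Omega> \<inter> ball p (\<delta>/2))" by (rule negligible_subset) auto
  then show "\<exists>U. openin (top_of_set (frontier \<Omega>)) U \<and> p \<in> U \<and> negligible U"
    using p r(1) by (intro exI[of _ "frontier \<Omega> \<inter> ball p (\<delta>/2)"]) (auto simp: openin_open)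
qed

section \<open>Integrals of derivatives of functions that vanish on the frontier\<close>

lemma integral_lebesgue_on_eq_lborel:
  fixes f :: "'a::euclidean_space \<Rightarrow> 'b::{banach,second_countable_topology}"
  assumes "open \<Omega>" "continuous_on \<Omega> f"
  shows "(LINT x|lebesgue_on \<Omega>. f x) = (LINT x|lborel. indicator \<Omega> x *\<^sub>R f x)"
proof -
  have "\<Omega> \<in> sets borel" using assms by simp
  then have "(\<lambda>x. indicator \<Omega> x *\<^sub>R f x) \<in> borel_measurable lborel"
    using borel_measurable_continuous_on_indicator[OF _ assms(2)] by simp
  then show ?thesis using assms by (subst integral_restrict_space) (simp_all add: integral_completion)
qed

lemma integrable_on_closure:
  fixes f :: "'a::euclidean_space \<Rightarrow> 'b::euclidean_space"
  assumes "open \<Omega>" "bounded \<Omega>" "continuous_on (closure \<Omega>) f"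
  shows "integrable (lebesgue_on \<Omega>) f"
proof -
  have "\<Omega> \<in> lmeasurable" using assms by (simp add: lmeasurable_open)
  then interpret finite_measure "lebesgue_on \<Omega>" by (rule finite_measure_lebesgue_on)
  have "compact (f ` closure \<Omega>)" using assms compact_continuous_image compact_closure by blast
  from compact_imp_bounded[OF this] obtain B where B: "\<And>x. x \<in> closure \<Omega> \<Longrightarrow> norm (f x) \<le> B"
    by (auto simp: bounded_iff)
  show ?thesis
  proof (rule integrable_const_bound[of _ B])
    show "AE x in lebesgue_on \<Omega>. norm (f x) \<le> B"
      using B closure_subset by (intro AE_I2) auto
    show "f \<in> borel_measurable (lebesgue_on \<Omega>)"
      using assms continuous_on_subset[OF assms(3) closure_subset] by (intro continuous_imp_measurable_on_sets_lebesgue) auto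
  qed
qed

lemma integral_translation:
  fixes f :: "'a::euclidean_space \<Rightarrow> 'b::{banach,second_countable_topology}"
  assumes "f \<in> borel_measurable borel"
  shows "(LINT x|lborel. f (v + x)) = (LINT x|lborel. f x)" and
    "integrable lborel f \<Longrightarrow> integrable lborel (\<lambda>x. f (v + x))"
proof -
  have m: "(+) v \<in> measurable lborel borel" by simp
  show "(LINT x|lborel. f (v + x)) = (LINT x|lborel. f x)"
    using integral_distr[OF m assms] by (simp add: lborel_distr_plus)
  show "integrable lborel f \<Longrightarrow> integrable lborel (\<lambda>x. f (v + x))"
    using integrable_distr_eq[OF m assms] by (simp add: lborel_distr_plus)
qed

text \<open>Cut off sharply at the frontier, \<open>h\<close> stays Lipschitz because it vanishes there; so the
  difference quotients of the cut-off function, whose integrals are zero, converge dominatedly.\<close>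

lemma integral_D_eq_0:
  fixes h :: "'n::finite cspace \<Rightarrow> complex"
  assumes "open \<Omega>" "bounded \<Omega>" "negligible (frontier \<Omega>)" "open U" "closure \<Omega> \<subseteq> U" "smooth_on U h"
    and vanish: "\<And>x. x \<in> frontier \<Omega> \<Longrightarrow> h x = 0"
  shows "(LINT x|lebesgue_on \<Omega>. D k h x) = 0"
proof -
  let ?e = "unit_vec k :: 'n cspace"
  define H where "H = (\<lambda>x. indicator \<Omega> x *\<^sub>R h x)"
  have contU: "continuous_on U h" "continuous_on U (D k h)"
    using smooth_on_continuous_on smooth_on_D assms(6) by blast+
  have cD: "continuous_on (closure \<Omega>) (D k h)" using contU assms continuous_on_subset by blast
  have "compact (D k h ` closure \<Omega>)" using cD assms compact_continuous_image compact_closure by blast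
  from compact_imp_bounded[OF this] obtain M0 where "\<And>x. x \<in> closure \<Omega> \<Longrightarrow> norm (D k h x) \<le> M0"
    by (auto simp: bounded_iff)
  then obtain M where M: "M \<ge> 0" "\<And>x. x \<in> closure \<Omega> \<Longrightarrow> norm (D k h x) \<le> M"
    by (metis max.cobounded1 max.cobounded2 order_trans)
  have diff: "h differentiable (at x)" if "x \<in> closure \<Omega>" for x
    using smooth_on_differentiable[OF assms(6)] that assms(5) by blast
  have line: "norm (h (x + b *\<^sub>R ?e) - h (x + a *\<^sub>R ?e)) \<le> M * (b - a)"
    if "a \<le> b" "\<And>t. a \<le> t \<Longrightarrow> t \<le> b \<Longrightarrow> x + t *\<^sub>R ?e \<in> closure \<Omega>" for x a b
  proof (cases "a = b")
    case False
    then have "a < b" using that by simp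
    have "norm (h (x + b *\<^sub>R ?e) - h (x + a *\<^sub>R ?e)) \<le> M * b - M * a"
    proof (rule differentiable_bound_general[OF \<open>a < b\<close>, of _ "\<lambda>t. M * t"])
      show "((\<lambda>t. h (x + t *\<^sub>R ?e)) has_vector_derivative D k h (x + t *\<^sub>R ?e)) (at t)" if "a < t" "t < b" for t
        using has_vector_derivative_along_unit_vec[OF diff] that \<open>\<And>t. a \<le> t \<Longrightarrow> t \<le> b \<Longrightarrow> x + t *\<^sub>R ?e \<in> closure \<Omega>\<close> by simp
      show "((\<lambda>t. M * t) has_vector_derivative M) (at t)" for t
        by (auto intro!: derivative_eq_intros simp: has_real_derivative_iff_has_vector_derivative[symmetric])
      show "continuous_on {a..b} (\<lambda>t. h (x + t *\<^sub>R ?e))"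
        by (rule continuous_on_compose2[OF contU(1)])
           (use that(2) assms(5) in \<open>auto intro!: continuous_intros\<close>)
    qed (use M that(2) in \<open>auto intro!: continuous_intros\<close>)
    then show ?thesis by (simp add: algebra_simps)
  qed simp
  have Lip: "norm (H (x + t *\<^sub>R ?e) - H x) \<le> 2 * M * t" if "t > 0" for x t
  proof -
    \<comment> \<open>The parameters at which the segment is outside \<open>\<Omega>\<close>. If
      there are any, the least and the greatest one are the first exit and the last entry; an
      endpoint inside \<open>\<Omega>\<close> is joined to a frontier point within
      \<open>\<Omega>\<close>, where \<open>h\<close> is 0, and each of these two pieces costs at
      most \<open>M * t\<close>.\<close>
    define A where "A = {s \<in> {0..t}. x + s *\<^sub>R ?e \<notin> \<Omega>}"
    have "A = {0..t} \<inter> (\<lambda>s. x + s *\<^sub>R ?e) -` (- \<Omega>)" by (auto simp: A_def)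
    moreover have "closed ((\<lambda>s. x + s *\<^sub>R ?e) -` (- \<Omega>))"
      using assms(1) by (intro closed_vimage) (auto intro!: continuous_intros)
    ultimately have cA: "compact A" by (simp add: compact_Int_closed)
    show ?thesis
    proof (cases "A = {}")
      case True
      then have "x + s *\<^sub>R ?e \<in> \<Omega>" if "0 \<le> s" "s \<le> t" for s using that by (auto simp: A_def)
      then have "norm (H (x + t *\<^sub>R ?e) - H x) \<le> M * t"
        using that line[of 0 t x] closure_subset[of \<Omega>] \<open>\<And>s. 0 \<le> s \<Longrightarrow> s \<le> t \<Longrightarrow> x + s *\<^sub>R ?e \<in> \<Omega>\<close>[of 0]
        by (auto simp: H_def subset_iff)
      also have "\<dots> \<le> 2 * M * t" using M(1) that by simp
      finally show ?thesis .
    next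
      case False
      obtain a where a: "a \<in> A" "\<And>s. s \<in> A \<Longrightarrow> a \<le> s" using compact_attains_inf[OF cA False] by blast
      obtain b where b: "b \<in> A" "\<And>s. s \<in> A \<Longrightarrow> s \<le> b" using compact_attains_sup[OF cA False] by blast
      have ab: "0 \<le> a" "a \<le> b" "b \<le> t" using a b by (auto simp: A_def)
      have h1: "norm (H x) \<le> M * a"
      proof (cases "x \<in> \<Omega>")
        case True
        then have "a \<noteq> 0" using a(1) by (intro notI) (simp add: A_def)
        then have a0: "a > 0" using ab by simp
        have seg: "x + s *\<^sub>R ?e \<in> \<Omega>" if "0 \<le> s" "s < a" for s 
        proof (rule ccontr)
          assume "x + s *\<^sub>R ?e \<notin> \<Omega>"
          then have "s \<in> A" using that ab by (simp add: A_def)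
          then show False using a(2) that by force
        qed
        have lim: "x + a *\<^sub>R ?e \<in> closure \<Omega>"
        proof (rule Lim_in_closed_set[OF closed_closure])
          show "eventually (\<lambda>s. x + s *\<^sub>R ?e \<in> closure \<Omega>) (at_left a)"
            using seg a0 closure_subset by (auto simp: eventually_at_left_field intro!: exI[of _ 0] subsetD[OF closure_subset])
          show "((\<lambda>s. x + s *\<^sub>R ?e) \<longlongrightarrow> x + a *\<^sub>R ?e) (at_left a)" by (intro tendsto_intros)
        qed simp
        have "x + a *\<^sub>R ?e \<in> frontier \<Omega>" using lim a(1) assms(1) by (simp add: frontier_def interior_open A_def)
        then have "h (x + a *\<^sub>R ?e) = 0" by (rule vanish)
        moreover have "x + s *\<^sub>R ?e \<in> closure \<Omega>" if "0 \<le> s" "s \<le> a" for s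
          using that lim seg[of s] closure_subset by (cases "s = a") auto
        ultimately show ?thesis using line[of 0 a x] ab True by (simp add: H_def)
      qed (use M ab in \<open>simp add: H_def\<close>)
      have h2: "norm (H (x + t *\<^sub>R ?e)) \<le> M * (t - b)"
      proof (cases "x + t *\<^sub>R ?e \<in> \<Omega>")
        case True
        then have "b \<noteq> t" using b(1) by (intro notI) (simp add: A_def)
        then have b0: "b < t" using ab by simp
        have seg: "x + s *\<^sub>R ?e \<in> \<Omega>" if "b < s" "s \<le> t" for s 
        proof (rule ccontr)
          assume "x + s *\<^sub>R ?e \<notin> \<Omega>"
          then have "s \<in> A" using that ab by (simp add: A_def)
          then show False using b(2) that by force
        qed
        have lim: "x + b *\<^sub>R ?e \<in> closure \<Omega>"
        proof (rule Lim_in_closed_set[OF closed_closure])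
          show "eventually (\<lambda>s. x + s *\<^sub>R ?e \<in> closure \<Omega>) (at_right b)"
            using seg b0 closure_subset by (auto simp: eventually_at_right_field intro!: exI[of _ t] subsetD[OF closure_subset])
          show "((\<lambda>s. x + s *\<^sub>R ?e) \<longlongrightarrow> x + b *\<^sub>R ?e) (at_right b)" by (intro tendsto_intros)
        qed simp
        have "x + b *\<^sub>R ?e \<in> frontier \<Omega>" using lim b(1) assms(1) by (simp add: frontier_def interior_open A_def)
        then have "h (x + b *\<^sub>R ?e) = 0" by (rule vanish)
        moreover have "x + s *\<^sub>R ?e \<in> closure \<Omega>" if "b \<le> s" "s \<le> t" for s
          using that lim seg[of s] closure_subset by (cases "s = b") auto
        ultimately show ?thesis using line[of b t x] ab True by (simp add: H_def)
      qed (use M ab in \<open>simp add: H_def\<close>)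
      have "norm (H (x + t *\<^sub>R ?e) - H x) \<le> M * (t - b) + M * a"
        using norm_triangle_ineq4[of "H (x + t *\<^sub>R ?e)" "H x"] h1 h2 by linarith
      also have "\<dots> \<le> M * t + M * t" using ab M by (intro add_mono mult_left_mono) auto
      finally show ?thesis by simp
    qed
  qed
  have Hm: "H \<in> borel_measurable borel"
    unfolding H_def using assms(1,5) closure_subset
    by (intro borel_measurable_continuous_on_indicator continuous_on_subset[OF contU(1)]) auto
  have Hint: "integrable lborel H"
  proof -
    have "integrable (lebesgue_on \<Omega>) h"
      using integrable_on_closure assms continuous_on_subset[OF contU(1)] by blast
    then have "integrable lebesgue H" unfolding H_def using assms(1) by (subst (asm) integrable_restrict_space) auto
    then show ?thesis using Hm by (simp add: integrable_completion)
  qed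
  obtain B where B: "\<And>x. x \<in> \<Omega> \<Longrightarrow> norm x \<le> B" using assms(2) by (auto simp: bounded_iff)
  define s where "s = (\<lambda>n::nat. \<lambda>x. real (Suc n) *\<^sub>R (H ((1 / real (Suc n)) *\<^sub>R ?e + x) - H x))"
  have s0: "(LINT x|lborel. s n x) = 0" for n
    unfolding s_def using integral_translation[OF Hm] Hint by simp
  \<comment> \<open>The shift has length at most 1, so the quotient vanishes outside the ball of
    radius \<open>B + 1\<close>; inside, the Lipschitz bound is a constant, which is integrable on
    the ball.\<close>
  have bound: "norm (s n x) \<le> indicator (cball 0 (B + 1)) x *\<^sub>R (2 * M)" for n x
  proof (cases "x \<in> cball 0 (B + 1)")
    case True
    have "norm (H (x + (1 / real (Suc n)) *\<^sub>R ?e) - H x) \<le> 2 * M * (1 / real (Suc n))" by (rule Lip) simp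
    then have "real (Suc n) * norm (H (x + (1 / real (Suc n)) *\<^sub>R ?e) - H x) \<le> 2 * M"
      by (simp add: field_simps)
    then show ?thesis using True by (simp add: s_def add.commute)
  next
    case False
    then have "norm x > B + 1" by simp
    moreover have "norm ((1 / real (Suc n)) *\<^sub>R ?e + x) \<ge> norm x - 1"
    proof -
      have "norm ((1 / real (Suc n)) *\<^sub>R ?e) \<le> 1" by simp
      then show ?thesis
        using norm_diff_ineq[of x "(1 / real (Suc n)) *\<^sub>R ?e"] by (subst add.commute) linarith
    qed
    ultimately have "x \<notin> \<Omega>" "(1 / real (Suc n)) *\<^sub>R ?e + x \<notin> \<Omega>" using B by fastforce+
    then show ?thesis using False by (simp add: s_def H_def)
  qed
  have lim: "(\<lambda>n. s n x) \<longlonglongrightarrow> indicator \<Omega> x *\<^sub>R D k h x" if "x \<notin> frontier \<Omega>" for x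
  proof -
    have ev: "(\<lambda>n. x + (1 / real (Suc n)) *\<^sub>R ?e) \<longlonglongrightarrow> x + 0 *\<^sub>R ?e"
      by (intro tendsto_intros LIMSEQ_Suc lim_1_over_n)
    show ?thesis
    proof (cases "x \<in> \<Omega>")
      case True
      then have "x \<in> closure \<Omega>" using closure_subset by auto
      have "((\<lambda>t. h (x + t *\<^sub>R ?e)) has_vector_derivative D k h x) (at 0)"
        using has_vector_derivative_along_unit_vec[of h x 0 k] diff[OF \<open>x \<in> closure \<Omega>\<close>] by simp
      then have "((\<lambda>t. norm (h (x + t *\<^sub>R ?e) - h x - t *\<^sub>R D k h x) / norm t) \<longlongrightarrow> 0) (at 0)"
        by (simp add: has_vector_derivative_def has_derivative_at)
      then have "((\<lambda>t. norm ((1 / t) *\<^sub>R (h (x + t *\<^sub>R ?e) - h x) - D k h x)) \<longlongrightarrow> 0) (at 0)"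
      proof (rule Lim_transform_eventually)
        have *: "norm (v - t *\<^sub>R w) / norm t = norm ((1 / t) *\<^sub>R v - w)" if "t \<noteq> 0" for t :: real and v w :: complex
        proof -
          have "norm ((1 / t) *\<^sub>R (v - t *\<^sub>R w)) = norm (v - t *\<^sub>R w) / norm t" by simp
          moreover have "(1 / t) *\<^sub>R (v - t *\<^sub>R w) = (1 / t) *\<^sub>R v - w" using that by (simp add: scaleR_diff_right)
          ultimately show ?thesis by simp
        qed
        show "\<forall>\<^sub>F t in at 0. norm (h (x + t *\<^sub>R ?e) - h x - t *\<^sub>R D k h x) / norm t
            = norm ((1 / t) *\<^sub>R (h (x + t *\<^sub>R ?e) - h x) - D k h x)"
          unfolding eventually_at_filter by (intro always_eventually allI impI *)
      qed
      then have "((\<lambda>t. (1 / t) *\<^sub>R (h (x + t *\<^sub>R ?e) - h x)) \<longlongrightarrow> D k h x) (at 0)"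
        unfolding tendsto_norm_zero_iff by (rule LIM_zero_cancel)
      moreover have "filterlim (\<lambda>n. 1 / real (Suc n)) (at 0) sequentially"
        unfolding filterlim_at using LIMSEQ_Suc[OF lim_1_over_n[where 'a = real]] by (simp del: of_nat_Suc)
      ultimately have "(\<lambda>n. (1 / (1 / real (Suc n))) *\<^sub>R (h (x + (1 / real (Suc n)) *\<^sub>R ?e) - h x)) \<longlonglongrightarrow> D k h x"
        by (rule filterlim_compose)
      moreover have "eventually (\<lambda>n. x + (1 / real (Suc n)) *\<^sub>R ?e \<in> \<Omega>) sequentially"
        using topological_tendstoD[OF ev assms(1)] True by simp
      then have "eventually (\<lambda>n. (1 / (1 / real (Suc n))) *\<^sub>R (h (x + (1 / real (Suc n)) *\<^sub>R ?e) - h x) = s n x) sequentially"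
        by eventually_elim (use True in \<open>simp add: s_def H_def add.commute\<close>)
      ultimately have "(\<lambda>n. s n x) \<longlonglongrightarrow> D k h x" by (rule Lim_transform_eventually)
      then show ?thesis using True by simp
    next
      case False
      then have "x \<in> - closure \<Omega>" using that assms(1) by (simp add: frontier_def interior_open)
      then have "eventually (\<lambda>n. x + (1 / real (Suc n)) *\<^sub>R ?e \<in> - closure \<Omega>) sequentially"
        using topological_tendstoD[OF ev, of "- closure \<Omega>"] by (simp add: open_Compl)
      then have "eventually (\<lambda>n. s n x = 0) sequentially"
        by eventually_elim (use False closure_subset[of \<Omega>] in \<open>auto simp: s_def H_def add.commute indicator_def\<close>)
      then show ?thesis using False by (simp add: tendsto_eventually)
    qed
  qed
  have Dm: "(\<lambda>x. indicator \<Omega> x *\<^sub>R D k h x) \<in> borel_measurable borel"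
    using assms(1) closure_subset
    by (intro borel_measurable_continuous_on_indicator continuous_on_subset[OF cD]) auto
  have AE: "AE x in lborel. x \<notin> frontier \<Omega>"
    using assms(3) by (auto simp: negligible_iff_null_sets null_sets_completion_iff intro!: AE_not_in)
  have "(\<lambda>n. LINT x|lborel. s n x) \<longlonglongrightarrow> (LINT x|lborel. indicator \<Omega> x *\<^sub>R D k h x)"
  proof (rule integral_dominated_convergence)
    show "(\<lambda>x. indicator \<Omega> x *\<^sub>R D k h x) \<in> borel_measurable lborel" using Dm by simp
    show "s n \<in> borel_measurable lborel" for n
      unfolding s_def using Hm by measurable
    show "integrable lborel (\<lambda>x. indicator (cball 0 (B + 1)) x *\<^sub>R (2 * M))"
      by (intro integrable_real_indicator[THEN integrable_scaleR_left])
         (use emeasure_bounded_finite[of "cball 0 (B + 1)"] in auto)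
    show "AE x in lborel. (\<lambda>n. s n x) \<longlonglongrightarrow> indicator \<Omega> x *\<^sub>R D k h x"
      using AE by eventually_elim (rule lim)
  qed (use bound in auto)
  then have "(LINT x|lborel. indicator \<Omega> x *\<^sub>R D k h x) = 0" by (simp add: s0 LIMSEQ_const_iff)
  then show ?thesis
    using integral_lebesgue_on_eq_lborel[OF assms(1) continuous_on_subset[OF cD closure_subset]] by simp
qed

section \<open>Semi-inner products and square-integrable functions\<close>

text \<open>The elements will be functions rather than classes modulo null sets, so
  \<open>ip x x = 0\<close> must not force \<open>x\<close> to be zero. Carrier and operations are
  parameters because the same results serve single functions and families of derivatives.\<close>

locale semi_inner_space =
  fixes V :: "'v set" and add :: "'v \<Rightarrow> 'v \<Rightarrow> 'v" and scale :: "complex \<Rightarrow> 'v \<Rightarrow> 'v"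
    and ip :: "'v \<Rightarrow> 'v \<Rightarrow> complex"
  assumes add_closed: "x \<in> V \<Longrightarrow> y \<in> V \<Longrightarrow> add x y \<in> V"
    and scale_closed: "x \<in> V \<Longrightarrow> scale c x \<in> V"
    and ip_add_left: "x \<in> V \<Longrightarrow> y \<in> V \<Longrightarrow> z \<in> V \<Longrightarrow> ip (add x y) z = ip x z + ip y z"
    and ip_scale_left: "x \<in> V \<Longrightarrow> z \<in> V \<Longrightarrow> ip (scale c x) z = c * ip x z"
    and ip_cnj: "x \<in> V \<Longrightarrow> y \<in> V \<Longrightarrow> cnj (ip x y) = ip y x"
    and ip_nonneg: "x \<in> V \<Longrightarrow> 0 \<le> Re (ip x x)"
begin

lemma ip_add_right: "x \<in> V \<Longrightarrow> y \<in> V \<Longrightarrow> z \<in> V \<Longrightarrow> ip z (add x y) = ip z x + ip z y"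
  using ip_cnj[of "add x y" z] ip_cnj[of x z] ip_cnj[of y z] add_closed ip_add_left
  by (metis complex_cnj_add)

lemma ip_scale_right: "x \<in> V \<Longrightarrow> z \<in> V \<Longrightarrow> ip z (scale c x) = cnj c * ip z x"
  using ip_cnj[of "scale c x" z] ip_cnj[of x z] scale_closed ip_scale_left
  by (metis complex_cnj_mult)

definition nsq :: "'v \<Rightarrow> real" where "nsq x = Re (ip x x)"

lemma nsq_nonneg: "x \<in> V \<Longrightarrow> 0 \<le> nsq x"
  by (simp add: nsq_def ip_nonneg)

lemma ip_self: "x \<in> V \<Longrightarrow> ip x x = of_real (nsq x)"
  using ip_cnj[of x x] by (auto simp: nsq_def complex_eq_iff)

lemma nsq_add_scale:
  assumes "x \<in> V" "y \<in> V"
  shows "nsq (add x (scale t y)) = nsq x + 2 * Re (cnj t * ip x y) + (cmod t)\<^sup>2 * nsq y"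
proof -
  have s: "scale t y \<in> V" using assms scale_closed by simp
  have "ip (add x (scale t y)) (add x (scale t y)) = ip x x + cnj t * ip x y + (t * ip y x + t * (cnj t * ip y y))"
    using assms s by (simp add: ip_add_left ip_add_right ip_scale_left ip_scale_right add_closed algebra_simps)
  also have "t * ip y x = cnj (cnj t * ip x y)" using ip_cnj assms by simp
  also have "t * (cnj t * ip y y) = of_real ((cmod t)\<^sup>2 * nsq y)"
    by (simp only: ip_self[OF assms(2)] of_real_mult complex_norm_square mult.assoc)
  finally show ?thesis by (simp add: nsq_def)
qed

lemma Re_cnj_mult_self: "Re (cnj (of_real c * w) * w) = c * (cmod w)\<^sup>2"
  unfolding cmod_power2 by (simp add: power2_eq_square algebra_simps)

lemma cauchy_schwarz:
  assumes "x \<in> V" "y \<in> V"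
  shows "(cmod (ip x y))\<^sup>2 \<le> nsq x * nsq y"
proof -
  let ?w = "ip x y"
  have *: "0 \<le> nsq x - 2 * c * (cmod ?w)\<^sup>2 + c\<^sup>2 * (cmod ?w)\<^sup>2 * nsq y" for c :: real
  proof -
    have "0 \<le> nsq (add x (scale (of_real (- c) * ?w) y))" using nsq_nonneg add_closed scale_closed assms by blast
    then show ?thesis unfolding nsq_add_scale[OF assms] Re_cnj_mult_self
      by (simp add: norm_mult power_mult_distrib)
  qed
  show ?thesis
  proof (cases "nsq y = 0")
    case True
    have "?w = 0"
    proof (rule ccontr)
      assume "?w \<noteq> 0"
      then have p: "(cmod ?w)\<^sup>2 > 0" by simp
      \<comment> \<open>If \<open>nsq y = 0\<close>, the quadratic expression in \<open>c\<close>
        becomes affine; this \<open>c\<close> drives it below zero unless the product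
        vanishes.\<close>
      have "0 \<le> nsq x - 2 * ((nsq x + 1) / (cmod ?w)\<^sup>2) * (cmod ?w)\<^sup>2"
        using *[of "(nsq x + 1) / (cmod ?w)\<^sup>2"] True by simp
      also have "\<dots> = nsq x - 2 * (nsq x + 1)" using p by simp
      finally show False using nsq_nonneg[OF assms(1)] by simp
    qed
    then show ?thesis using True by simp
  next
    case False
    then have p: "nsq y > 0" using nsq_nonneg[OF assms(2)] by simp
    have "(1 / nsq y)\<^sup>2 * (cmod ?w)\<^sup>2 * nsq y = (cmod ?w)\<^sup>2 / nsq y" using p by (simp add: power2_eq_square)
    then have "(cmod ?w)\<^sup>2 / nsq y \<le> nsq x" using *[of "1 / nsq y"] by (simp add: field_simps)
    then show ?thesis using p by (simp add: field_simps)
  qed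
qed

lemma cauchy_schwarz_sqrt:
  assumes "x \<in> V" "y \<in> V"
  shows "cmod (ip x y) \<le> sqrt (nsq x) * sqrt (nsq y)"
  using real_le_rsqrt[OF cauchy_schwarz[OF assms]] by (simp add: real_sqrt_mult)

text \<open>A minimising sequence of \<open>nsq x - 2 * Re (l x)\<close> represents the functional \<open>l\<close> in the limit.\<close>

lemma riesz_sequence:
  fixes l :: "'v \<Rightarrow> complex"
  assumes "V \<noteq> {}"
    and l_add: "\<And>x y. x \<in> V \<Longrightarrow> y \<in> V \<Longrightarrow> l (add x y) = l x + l y"
    and l_scale: "\<And>c x. x \<in> V \<Longrightarrow> l (scale c x) = c * l x"
    and l_bound: "\<And>x. x \<in> V \<Longrightarrow> cmod (l x) \<le> C * sqrt (nsq x)"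
  obtains u :: "nat \<Rightarrow> 'v" where "\<And>m. u m \<in> V"
    "\<And>x. x \<in> V \<Longrightarrow> (\<lambda>m. ip x (u m)) \<longlonglongrightarrow> l x"
    "\<And>\<epsilon>. \<epsilon> > 0 \<Longrightarrow> \<exists>M. \<forall>m\<ge>M. \<forall>n\<ge>M. nsq (add (u m) (scale (-1) (u n))) < \<epsilon>"
proof -
  define J where "J = (\<lambda>x. nsq x - 2 * Re (l x))"
  have J_lower: "- C\<^sup>2 \<le> J x" if "x \<in> V" for x
  proof -
    have "Re (l x) \<le> C * sqrt (nsq x)" using l_bound[OF that] complex_Re_le_cmod order_trans by blast
    moreover have "0 \<le> (sqrt (nsq x) - C)\<^sup>2" by simp
    moreover have "(sqrt (nsq x))\<^sup>2 = nsq x" using nsq_nonneg[OF that] by simp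
    ultimately show ?thesis unfolding J_def by (simp add: power2_diff algebra_simps)
  qed
  have bdd: "bdd_below (J ` V)" using J_lower by (auto simp: bdd_below_def)
  define I where "I = Inf (J ` V)"
  have I_le: "I \<le> J x" if "x \<in> V" for x unfolding I_def using bdd that by (simp add: cInf_lower)
  have "\<exists>x\<in>V. J x < I + 1 / real (Suc m)" for m
  proof -
    have "Inf (J ` V) < I + 1 / real (Suc m)" by (simp add: I_def)
    then show ?thesis using cInf_lessD[of "J ` V"] assms(1) by blast
  qed
  then obtain u where u: "\<And>m. u m \<in> V" "\<And>m. J (u m) < I + 1 / real (Suc m)" by metis
  \<comment> \<open>A quantitative Euler-Lagrange condition: a vector \<open>v\<close> that is
    minimal up to \<open>\<delta>\<close> is compared with its variation along \<open>x\<close> by -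
    c w, where w is the defect of the representation. The choice c = 1 / \<open>nsq x\<close> is
    optimal.\<close>
  have key: "(cmod (ip x v - l x))\<^sup>2 \<le> \<delta> * nsq x" if "x \<in> V" "v \<in> V" "J v < I + \<delta>" for x v \<delta>
  proof -
    let ?w = "ip v x - cnj (l x)"
    have cw: "cmod ?w = cmod (ip x v - l x)"
      using ip_cnj[OF that(1,2)] by (metis complex_cnj_diff complex_mod_cnj)
    have J_var: "J (add v (scale t x)) = J v + 2 * Re (cnj t * ?w) + (cmod t)\<^sup>2 * nsq x" for t
    proof -
      have "l (add v (scale t x)) = l v + t * l x" using that l_add l_scale scale_closed by simp
      then show ?thesis unfolding J_def nsq_add_scale[OF that(2,1)] by (simp add: algebra_simps)
    qed
    have *: "2 * c * (cmod ?w)\<^sup>2 - c\<^sup>2 * (cmod ?w)\<^sup>2 * nsq x < \<delta>" for c :: real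
    proof -
      have "I \<le> J (add v (scale (of_real (- c) * ?w) x))"
        using I_le add_closed scale_closed that by blast
      then show ?thesis using that(3) unfolding J_var Re_cnj_mult_self
        by (simp add: norm_mult power_mult_distrib)
    qed
    show ?thesis
    proof (cases "nsq x = 0")
      case True
      have "l x = 0" using l_bound[OF that(1)] True by simp
      moreover have "ip x v = 0" using cauchy_schwarz[OF that(1,2)] True by simp
      ultimately show ?thesis using True by simp
    next
      case False
      then have p: "nsq x > 0" using nsq_nonneg[OF that(1)] by simp
      have "(1 / nsq x)\<^sup>2 * (cmod ?w)\<^sup>2 * nsq x = (cmod ?w)\<^sup>2 / nsq x" using p by (simp add: power2_eq_square)
      then have "(cmod ?w)\<^sup>2 / nsq x < \<delta>" using *[of "1 / nsq x"] by (simp add: field_simps)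
      then show ?thesis using p cw by (simp add: field_simps)
    qed
  qed
  have key': "cmod (ip x (u m) - l x) \<le> sqrt (1 / real (Suc m)) * sqrt (nsq x)" if "x \<in> V" for x m
    using real_le_rsqrt[OF key[OF that u(1,2)]] unfolding real_sqrt_mult .
  have lim0: "(\<lambda>m. sqrt (1 / real (Suc m))) \<longlonglongrightarrow> 0"
    using tendsto_real_sqrt[OF LIMSEQ_Suc[OF lim_1_over_n[where 'a = real]]] by simp
  have lim: "(\<lambda>m. ip x (u m)) \<longlonglongrightarrow> l x" if "x \<in> V" for x
  proof -
    have "(\<lambda>m. sqrt (1 / real (Suc m)) * sqrt (nsq x)) \<longlonglongrightarrow> 0 * sqrt (nsq x)"
      by (intro tendsto_mult lim0 tendsto_const)
    then have "(\<lambda>m. sqrt (1 / real (Suc m)) * sqrt (nsq x)) \<longlonglongrightarrow> 0" by simp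
    then have "(\<lambda>m. ip x (u m) - l x) \<longlonglongrightarrow> 0"
      by (rule Lim_null_comparison[rotated]) (rule always_eventually, rule allI, rule key'[OF that])
    then show ?thesis by (rule LIM_zero_cancel)
  qed
  have "\<exists>M. \<forall>m\<ge>M. \<forall>n\<ge>M. nsq (add (u m) (scale (-1) (u n))) < \<epsilon>" if "\<epsilon> > 0" for \<epsilon>
  proof -
    have "eventually (\<lambda>m. sqrt (1 / real (Suc m)) < sqrt \<epsilon> / 2) sequentially"
      using order_tendstoD(2)[OF lim0, of "sqrt \<epsilon> / 2"] that by simp
    then obtain M where M: "\<And>m. m \<ge> M \<Longrightarrow> sqrt (1 / real (Suc m)) < sqrt \<epsilon> / 2"
      unfolding eventually_sequentially by blast
    have "nsq (add (u m) (scale (-1) (u n))) < \<epsilon>" if mn: "m \<ge> M" "n \<ge> M" for m n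
    proof -
      \<comment> \<open>The approximate representation is tested with the difference of two members
        itself: both terms approximate \<open>l d\<close>, so \<open>ip d d\<close> is small
        compared with the norm of \<open>d\<close>.\<close>
      define d where "d = add (u m) (scale (-1) (u n))"
      have d: "d \<in> V" unfolding d_def using u add_closed scale_closed by blast
      have "ip d d = (ip d (u m) - l d) - (ip d (u n) - l d)"
        by (subst (2) d_def) (use d u scale_closed in \<open>simp add: ip_add_right ip_scale_right\<close>)
      then have "cmod (ip d d) \<le> cmod (ip d (u m) - l d) + cmod (ip d (u n) - l d)"
        using norm_triangle_ineq4 by metis
      also have "\<dots> \<le> sqrt (1 / real (Suc m)) * sqrt (nsq d) + sqrt (1 / real (Suc n)) * sqrt (nsq d)"
        using key'[OF d] by (intro add_mono) auto
      finally have le: "nsq d \<le> (sqrt (1 / real (Suc m)) + sqrt (1 / real (Suc n))) * sqrt (nsq d)"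
        using ip_self[OF d] nsq_nonneg[OF d] by (simp add: algebra_simps)
      have "sqrt (nsq d) < sqrt \<epsilon>"
      proof (cases "nsq d = 0")
        case False
        then have p: "sqrt (nsq d) > 0" using nsq_nonneg[OF d] by simp
        have "sqrt (nsq d) * sqrt (nsq d) \<le> (sqrt (1 / real (Suc m)) + sqrt (1 / real (Suc n))) * sqrt (nsq d)"
          using le nsq_nonneg[OF d] by simp
        then have "sqrt (nsq d) \<le> sqrt (1 / real (Suc m)) + sqrt (1 / real (Suc n))"
          using p mult_right_le_imp_le by blast
        then show ?thesis using M[OF mn(1)] M[OF mn(2)] by linarith
      qed (use \<open>\<epsilon> > 0\<close> in simp)
      then show ?thesis by (simp add: d_def)
    qed
    then show ?thesis by blast
  qed
  then show thesis using that u(1) lim by blast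
qed

end

section \<open>Square-integrable functions and weighted families of them\<close>

lemma L2_D:
  assumes "f \<in> L2 \<Omega>"
  shows "f \<in> borel_measurable (lebesgue_on \<Omega>)" "integrable (lebesgue_on \<Omega>) (\<lambda>x. (cmod (f x))\<^sup>2)"
  using assms by (auto simp: L2_def)

lemma L2_mult_integrable:
  assumes "f \<in> L2 \<Omega>" "g \<in> L2 \<Omega>"
  shows "integrable (lebesgue_on \<Omega>) (\<lambda>x. f x * g x)"
proof (rule Bochner_Integration.integrable_bound)
  show "integrable (lebesgue_on \<Omega>) (\<lambda>x. (cmod (f x))\<^sup>2 + (cmod (g x))\<^sup>2)"
    by (intro Bochner_Integration.integrable_add L2_D(2) assms)
  show "(\<lambda>x. f x * g x) \<in> borel_measurable (lebesgue_on \<Omega>)" using assms L2_D by measurable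
  have "cmod a * cmod b \<le> (cmod a)\<^sup>2 + (cmod b)\<^sup>2" for a b
  proof -
    have "0 \<le> cmod a * cmod b" by simp
    then show ?thesis using sum_squares_bound[of "cmod a" "cmod b"] by linarith
  qed
  then show "AE x in lebesgue_on \<Omega>. norm (f x * g x) \<le> norm ((cmod (f x))\<^sup>2 + (cmod (g x))\<^sup>2)"
    by (intro AE_I2) (simp add: norm_mult)
qed

lemma L2_cnj: "f \<in> L2 \<Omega> \<Longrightarrow> (\<lambda>x. cnj (f x)) \<in> L2 \<Omega>"
proof -
  have "cnj \<in> borel_measurable borel" by (intro borel_measurable_continuous_onI continuous_intros)
  then show "f \<in> L2 \<Omega> \<Longrightarrow> (\<lambda>x. cnj (f x)) \<in> L2 \<Omega>"
    by (auto simp: L2_def intro: measurable_compose)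
qed

lemma L2_add: assumes "f \<in> L2 \<Omega>" "g \<in> L2 \<Omega>" shows "(\<lambda>x. f x + g x) \<in> L2 \<Omega>"
proof -
  have "integrable (lebesgue_on \<Omega>) (\<lambda>x. (cmod (f x + g x))\<^sup>2)"
  proof (rule Bochner_Integration.integrable_bound)
    show "integrable (lebesgue_on \<Omega>) (\<lambda>x. 2 * (cmod (f x))\<^sup>2 + 2 * (cmod (g x))\<^sup>2)"
      by (intro Bochner_Integration.integrable_add integrable_mult_right L2_D(2) assms)
    show "(\<lambda>x. (cmod (f x + g x))\<^sup>2) \<in> borel_measurable (lebesgue_on \<Omega>)" using assms L2_D by measurable
    have "(cmod (a + b))\<^sup>2 \<le> 2 * (cmod a)\<^sup>2 + 2 * (cmod b)\<^sup>2" for a b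
    proof -
      have "(cmod (a + b))\<^sup>2 \<le> (cmod a + cmod b)\<^sup>2" by (intro power_mono norm_triangle_ineq) simp
      also have "\<dots> \<le> 2 * (cmod a)\<^sup>2 + 2 * (cmod b)\<^sup>2"
        using sum_squares_bound[of "cmod a" "cmod b"] by (simp add: power2_sum)
      finally show ?thesis .
    qed
    then show "AE x in lebesgue_on \<Omega>. norm ((cmod (f x + g x))\<^sup>2) \<le> norm (2 * (cmod (f x))\<^sup>2 + 2 * (cmod (g x))\<^sup>2)"
      by (intro AE_I2) simp
  qed
  then show ?thesis using assms L2_D by (auto simp: L2_def)
qed

lemma L2_cmult: "f \<in> L2 \<Omega> \<Longrightarrow> (\<lambda>x. c * f x) \<in> L2 \<Omega>"
  by (auto simp: L2_def norm_mult power_mult_distrib)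

lemma L2_diff: "f \<in> L2 \<Omega> \<Longrightarrow> g \<in> L2 \<Omega> \<Longrightarrow> (\<lambda>x. f x - g x) \<in> L2 \<Omega>"
  using L2_add[of f \<Omega> "\<lambda>x. -1 * g x"] L2_cmult[of g \<Omega> "-1"] by simp

text \<open>With multi-indices as index set and \<open>mcoeff\<close> as weight this is the Sobolev
  product seen on families of derivatives; with a one-point index set it is the product of
  \<open>L2\<close>.\<close>

definition family_ip :: "'n::finite cspace set \<Rightarrow> 'i set \<Rightarrow> ('i \<Rightarrow> real) \<Rightarrow> ('i \<Rightarrow> 'n cspace \<Rightarrow> complex)
    \<Rightarrow> ('i \<Rightarrow> 'n cspace \<Rightarrow> complex) \<Rightarrow> complex" where
  "family_ip \<Omega> A \<gamma> F G = (\<Sum>\<alpha>\<in>A. of_real (\<gamma> \<alpha>) * (LINT x|lebesgue_on \<Omega>. F \<alpha> x * cnj (G \<alpha> x)))"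

lemma semi_inner_space_family:
  assumes "\<And>\<alpha>. \<alpha> \<in> A \<Longrightarrow> \<gamma> \<alpha> \<ge> 0"
  shows "semi_inner_space {F. \<forall>\<alpha>\<in>A. F \<alpha> \<in> L2 \<Omega>} (\<lambda>F G \<alpha> x. F \<alpha> x + G \<alpha> x) (\<lambda>c F \<alpha> x. c * F \<alpha> x) (family_ip \<Omega> A \<gamma>)"
proof
  fix F G H :: "'a \<Rightarrow> 'b cspace \<Rightarrow> complex" and c
  assume F: "F \<in> {F. \<forall>\<alpha>\<in>A. F \<alpha> \<in> L2 \<Omega>}" and H: "H \<in> {F. \<forall>\<alpha>\<in>A. F \<alpha> \<in> L2 \<Omega>}"
  have int: "integrable (lebesgue_on \<Omega>) (\<lambda>x. F \<alpha> x * cnj (H \<alpha> x))" if "\<alpha> \<in> A" for \<alpha>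
    using F H that by (intro L2_mult_integrable L2_cnj) auto
  show "(\<lambda>\<alpha> x. c * F \<alpha> x) \<in> {F. \<forall>\<alpha>\<in>A. F \<alpha> \<in> L2 \<Omega>}" using F L2_cmult by auto
  show "family_ip \<Omega> A \<gamma> (\<lambda>\<alpha> x. c * F \<alpha> x) H = c * family_ip \<Omega> A \<gamma> F H"
    by (simp add: family_ip_def sum_distrib_left mult_ac)
  show "cnj (family_ip \<Omega> A \<gamma> F H) = family_ip \<Omega> A \<gamma> H F"
  proof -
    have "cnj (LINT x|lebesgue_on \<Omega>. F \<alpha> x * cnj (H \<alpha> x)) = (LINT x|lebesgue_on \<Omega>. H \<alpha> x * cnj (F \<alpha> x))"
      if "\<alpha> \<in> A" for \<alpha>
      using integral_bounded_linear[OF bounded_linear_cnj int[OF that]] by (simp add: mult.commute)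
    then show ?thesis by (simp add: family_ip_def)
  qed
  have "0 \<le> Re (LINT x|lebesgue_on \<Omega>. F \<alpha> x * cnj (F \<alpha> x))" for \<alpha>
    by (simp flip: complex_norm_square of_real_power)
  then show "0 \<le> Re (family_ip \<Omega> A \<gamma> F F)"
    unfolding family_ip_def by (simp add: sum_nonneg assms)
  assume G: "G \<in> {F. \<forall>\<alpha>\<in>A. F \<alpha> \<in> L2 \<Omega>}"
  show "(\<lambda>\<alpha> x. F \<alpha> x + G \<alpha> x) \<in> {F. \<forall>\<alpha>\<in>A. F \<alpha> \<in> L2 \<Omega>}" using F G by (simp add: L2_add)
  have intG: "integrable (lebesgue_on \<Omega>) (\<lambda>x. G \<alpha> x * cnj (H \<alpha> x))" if "\<alpha> \<in> A" for \<alpha>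
    using G H that by (intro L2_mult_integrable L2_cnj) auto
  show "family_ip \<Omega> A \<gamma> (\<lambda>\<alpha> x. F \<alpha> x + G \<alpha> x) H = family_ip \<Omega> A \<gamma> F H + family_ip \<Omega> A \<gamma> G H"
    unfolding family_ip_def sum.distrib[symmetric]
    by (intro sum.cong refl) (simp add: int intG algebra_simps)
qed

lemma family_ip_self:
  "family_ip \<Omega> A \<gamma> F F = of_real (\<Sum>\<alpha>\<in>A. \<gamma> \<alpha> * (LINT x|lebesgue_on \<Omega>. (cmod (F \<alpha> x))\<^sup>2))"
  by (simp only: family_ip_def complex_norm_square[symmetric] integral_complex_of_real of_real_sum of_real_mult)

lemma L2_cauchy_schwarz:
  assumes "f \<in> L2 \<Omega>" "g \<in> L2 \<Omega>"
  shows "cmod (LINT x|lebesgue_on \<Omega>. f x * g x)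
    \<le> sqrt (LINT x|lebesgue_on \<Omega>. (cmod (f x))\<^sup>2) * sqrt (LINT x|lebesgue_on \<Omega>. (cmod (g x))\<^sup>2)"
proof -
  interpret one: semi_inner_space "{F :: unit \<Rightarrow> _. \<forall>\<alpha>\<in>UNIV. F \<alpha> \<in> L2 \<Omega>}" "\<lambda>F G \<alpha> x. F \<alpha> x + G \<alpha> x"
    "\<lambda>c F \<alpha> x. c * F \<alpha> x" "family_ip \<Omega> UNIV (\<lambda>_. 1)"
    by (rule semi_inner_space_family) simp
  have "one.nsq (\<lambda>_. f) = (LINT x|lebesgue_on \<Omega>. (cmod (f x))\<^sup>2)" for f
    by (simp add: one.nsq_def family_ip_self)
  then show ?thesis
    using one.cauchy_schwarz_sqrt[of "\<lambda>_. f" "\<lambda>_ x. cnj (g x)"] assms L2_cnj[OF assms(2)]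
    by (simp add: family_ip_def UNIV_unit)
qed

section \<open>Iterated derivatives along words\<close>

text \<open>The canonical word of a multi-index, spelled in the order in which \<open>mD\<close>
  composes its derivatives. By \<open>foldr_D_perm\<close> every other word with the same letters
  yields the same derivative of a smooth function.\<close>

definition word :: "'n::{finite,linorder} multiindex \<Rightarrow> ('n + 'n) list" where
  "word \<alpha> = concat (map (\<lambda>k. replicate (\<alpha> k) k) coords)"

lemma foldr_D_replicate: "foldr D (replicate m k) f = (D k ^^ m) f"
  by (induction m) simp_all

lemma mD_eq_foldr_word: "mD \<alpha> f = foldr D (word \<alpha>) f"
proof -
  have "foldr (\<lambda>k. D k ^^ \<alpha> k) cs f = foldr D (concat (map (\<lambda>k. replicate (\<alpha> k) k) cs)) f" for cs
    by (induction cs) (simp_all add: foldr_D_replicate)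
  then show ?thesis by (simp add: mD_def word_def)
qed

lemma coords_distinct: "distinct coords" and coords_set: "set coords = UNIV"
  by (auto simp: coords_def distinct_map UNIV_sum)

lemma count_word: "count (mset (word \<alpha>)) k = \<alpha> k"
proof -
  have "distinct cs \<Longrightarrow> count (mset (concat (map (\<lambda>k. replicate (\<alpha> k) k) cs))) k = (if k \<in> set cs then \<alpha> k else 0)" for cs
    by (induction cs) auto
  then show ?thesis by (simp add: word_def coords_distinct coords_set)
qed

lemma length_word: "length (word \<alpha>) = msize \<alpha>"
proof -
  have "length (word \<alpha>) = sum_list (map \<alpha> coords)" by (simp add: word_def length_concat comp_def)
  then show ?thesis by (simp add: msize_def sum_list_distinct_conv_sum_set coords_distinct coords_set)
qed

lemma foldr_D_move:
  fixes f :: "'n::finite cspace \<Rightarrow> complex"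
  assumes "open U" "smooth_on U f" "x \<in> U"
  shows "foldr D (v @ a # w) f x = foldr D (a # v @ w) f x"
  using assms(3)
proof (induction v arbitrary: x)
  case (Cons b v)
  have "D b (foldr D (v @ a # w) f) x = D b (D a (foldr D (v @ w) f)) x"
    by (rule D_cong_open[OF assms(1) Cons.prems]) (use Cons.IH in simp)
  also have "\<dots> = D a (D b (foldr D (v @ w) f)) x"
    by (rule D_commute[OF assms(1) smooth_on_foldr_D[OF assms(2)] Cons.prems])
  finally show ?case by simp
qed simp

lemma foldr_D_perm:
  fixes f :: "'n::finite cspace \<Rightarrow> complex"
  assumes "open U" "smooth_on U f" "x \<in> U" "mset u = mset v"
  shows "foldr D u f x = foldr D v f x"
  using assms(3,4)
proof (induction u arbitrary: x v)
  case (Cons a u)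
  then obtain v1 v2 where v: "v = v1 @ a # v2"
    by (metis list.set_intros(1) set_mset_mset split_list)
  then have "mset u = mset (v1 @ v2)" using Cons.prems by simp
  then have "D a (foldr D u f) x = D a (foldr D (v1 @ v2) f) x"
    by (intro D_cong_open[OF assms(1) Cons.prems(1)] Cons.IH)
  then show ?case using foldr_D_move[OF assms(1,2) Cons.prems(1), of v1 a v2] v by simp
qed simp

lemma foldr_D_0 [simp]: "foldr D w (\<lambda>x. 0) = (\<lambda>x. 0)"
  by (induction w) simp_all

text \<open>The Riesz-Fischer theorem: a subsequence with rapidly decreasing increments converges
  almost everywhere, and Fatou's lemma carries the Cauchy estimate over to its limit.\<close>

lemma L2_complete:
  fixes u :: "nat \<Rightarrow> 'n::finite cspace \<Rightarrow> complex"
  assumes "\<Omega> \<in> lmeasurable" and u: "\<And>m. u m \<in> L2 \<Omega>"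
    and Cauchy: "\<And>\<epsilon>. \<epsilon> > 0 \<Longrightarrow> \<exists>M. \<forall>m\<ge>M. \<forall>n\<ge>M. (LINT x|lebesgue_on \<Omega>. (cmod (u m x - u n x))\<^sup>2) < \<epsilon>"
  obtains g where "g \<in> L2 \<Omega>" "(\<lambda>m. LINT x|lebesgue_on \<Omega>. (cmod (u m x - g x))\<^sup>2) \<longlonglongrightarrow> 0"
proof -
  let ?M = "lebesgue_on \<Omega>"
  interpret finite_measure ?M using assms(1) by (rule finite_measure_lebesgue_on)
  define \<mu> where "\<mu> = measure ?M (space ?M)"
  have um[measurable]: "u m \<in> borel_measurable ?M" for m using u L2_D by blast
  have sq: "integrable ?M (\<lambda>x. (cmod (u m x - u n x))\<^sup>2)" for m n using L2_diff[OF u u] L2_D(2) by blast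
  have "\<forall>j. \<exists>M. \<forall>m\<ge>M. \<forall>n\<ge>M. (LINT x|?M. (cmod (u m x - u n x))\<^sup>2) < (1/4) ^ j"
    using Cauchy by simp
  then obtain Q where Q: "\<And>j m n. m \<ge> Q j \<Longrightarrow> n \<ge> Q j \<Longrightarrow> (LINT x|?M. (cmod (u m x - u n x))\<^sup>2) < (1/4) ^ j"
    by metis
  \<comment> \<open>Summing the thresholds makes \<open>k j\<close> and \<open>k (Suc j)\<close>
    both exceed \<open>Q j\<close>; the added \<open>j\<close> makes the indices tend to
    infinity.\<close>
  define k where "k = (\<lambda>j. (\<Sum>i\<le>j. Q i) + j)"
  have kQ: "k j \<ge> Q j" "k (Suc j) \<ge> Q j" "k j \<ge> j" for j
    unfolding k_def using member_le_sum[of j "{..j}" Q] by (auto simp: trans_le_add1)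
  define d where "d = (\<lambda>j x. cmod (u (k (Suc j)) x - u (k j) x))"
  have dm[measurable]: "d j \<in> borel_measurable ?M" for j unfolding d_def by measurable
  have bound_int: "integrable ?M (\<lambda>x. 2 ^ j * (d j x)\<^sup>2 + (1/2) ^ j)" for j
    unfolding d_def by (intro Bochner_Integration.integrable_add integrable_mult_right sq integrable_const)
  \<comment> \<open>Either the increment is below 2^(-j), or 2^j times it is at least 1. This turns
    the L2 bound 4^(-j) into the summable L1 bound (1 + \<mu>) 2^(-j) on the finite measure
    space.\<close>
  have d_le: "d j x \<le> 2 ^ j * (d j x)\<^sup>2 + (1/2) ^ j" for j x
  proof (cases "d j x \<le> (1/2) ^ j")
    case True then show ?thesis by (simp add: add_increasing)
  next
    case False
    then have "1 \<le> 2 ^ j * d j x" by (simp add: power_one_over field_simps)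
    then have "d j x \<le> (2 ^ j * d j x) * d j x"
      using mult_right_mono[of 1 "2 ^ j * d j x" "d j x"] by (simp add: d_def)
    then show ?thesis by (simp add: power2_eq_square add_increasing2 mult.assoc)
  qed
  have nn: "(\<integral>\<^sup>+x. ennreal (d j x) \<partial>?M) \<le> ennreal ((1/2) ^ j * (1 + \<mu>))" for j
  proof -
    have "(\<integral>\<^sup>+x. ennreal (d j x) \<partial>?M) \<le> (\<integral>\<^sup>+x. ennreal (2 ^ j * (d j x)\<^sup>2 + (1/2) ^ j) \<partial>?M)"
      by (intro nn_integral_mono ennreal_leI d_le)
    also have "\<dots> = ennreal (LINT x|?M. 2 ^ j * (d j x)\<^sup>2 + (1/2) ^ j)"
      by (rule nn_integral_eq_integral[OF bound_int]) simp
    also have "(LINT x|?M. 2 ^ j * (d j x)\<^sup>2 + (1/2) ^ j) = 2 ^ j * (LINT x|?M. (d j x)\<^sup>2) + (1/2) ^ j * \<mu>"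
      unfolding d_def by (subst Bochner_Integration.integral_add) (auto intro!: sq integrable_mult_right simp: \<mu>_def)
    also have "\<dots> \<le> 2 ^ j * (1/4) ^ j + (1/2) ^ j * \<mu>"
      using Q[OF kQ(2,1), of j] by (intro add_mono mult_left_mono) (auto simp: d_def)
    also have "2 ^ j * (1/4) ^ j = (1/2 :: real) ^ j" by (simp flip: power_mult_distrib)
    finally show ?thesis by (simp add: algebra_simps ennreal_leI)
  qed
  have "(\<integral>\<^sup>+x. (\<Sum>j. ennreal (d j x)) \<partial>?M) = (\<Sum>j. \<integral>\<^sup>+x. ennreal (d j x) \<partial>?M)"
    by (rule nn_integral_suminf) measurable
  also have "\<dots> \<le> (\<Sum>j. ennreal ((1/2) ^ j * (1 + \<mu>)))" by (intro suminf_le nn) auto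
  also have "\<dots> = ennreal (\<Sum>j. (1/2) ^ j * (1 + \<mu>))"
    by (rule suminf_ennreal2) (auto simp: \<mu>_def intro!: summable_mult2 summable_geometric)
  finally have "(\<integral>\<^sup>+x. (\<Sum>j. ennreal (d j x)) \<partial>?M) \<noteq> \<infinity>" by (metis ennreal_less_top infinity_ennreal_def leD)
  then have AEfin: "AE x in ?M. (\<Sum>j. ennreal (d j x)) \<noteq> \<infinity>"
    by (rule nn_integral_noteq_infinite[rotated]) measurable
  define g where "g = (\<lambda>x. lim (\<lambda>j. u (k j) x))"
  have gm[measurable]: "g \<in> borel_measurable ?M" unfolding g_def by measurable
  have AElim: "AE x in ?M. (\<lambda>j. u (k j) x) \<longlonglongrightarrow> g x"
    using AEfin
  proof eventually_elim
    case (elim x)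
    have "summable (\<lambda>j. d j x)"
      by (rule summable_suminf_not_top) (use elim in \<open>auto simp: d_def\<close>)
    then have "summable (\<lambda>j. u (k (Suc j)) x - u (k j) x)"
      unfolding d_def by (rule summable_norm_cancel)
    then have "convergent (\<lambda>n. \<Sum>j<n. u (k (Suc j)) x - u (k j) x)" by (simp add: summable_iff_convergent)
    then have "convergent (\<lambda>n. u (k n) x - u (k 0) x)"
      using sum_lessThan_telescope[of "\<lambda>j. u (k j) x"] by simp
    then have "convergent (\<lambda>n. (u (k n) x - u (k 0) x) + u (k 0) x)"
      by (intro convergent_add convergent_const)
    then have "convergent (\<lambda>n. u (k n) x)" by simp
    then show ?case by (simp add: g_def convergent_LIMSEQ_iff)
  qed
  have Fatou: "(\<integral>\<^sup>+x. ennreal ((cmod (u m x - g x))\<^sup>2) \<partial>?M) \<le> ennreal \<epsilon>"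
    if M: "\<And>m n. m \<ge> M \<Longrightarrow> n \<ge> M \<Longrightarrow> (LINT x|?M. (cmod (u m x - u n x))\<^sup>2) < \<epsilon>" "m \<ge> M" for m M \<epsilon>
  proof -
    have "(\<integral>\<^sup>+x. ennreal ((cmod (u m x - g x))\<^sup>2) \<partial>?M) = (\<integral>\<^sup>+x. liminf (\<lambda>j. ennreal ((cmod (u m x - u (k j) x))\<^sup>2)) \<partial>?M)"
    proof (rule nn_integral_cong_AE, use AElim in eventually_elim)
      case (elim x)
      have "(\<lambda>j. ennreal ((cmod (u m x - u (k j) x))\<^sup>2)) \<longlonglongrightarrow> ennreal ((cmod (u m x - g x))\<^sup>2)"
        by (intro tendsto_intros elim)
      then show ?case by (rule lim_imp_Liminf[symmetric, rotated]) simp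
    qed
    also have "\<dots> \<le> liminf (\<lambda>j. \<integral>\<^sup>+x. ennreal ((cmod (u m x - u (k j) x))\<^sup>2) \<partial>?M)"
      by (rule nn_integral_liminf) measurable
    also have "\<dots> \<le> liminf (\<lambda>j. ennreal \<epsilon>)"
    proof (rule Liminf_mono)
      show "\<forall>\<^sub>F j in sequentially. (\<integral>\<^sup>+x. ennreal ((cmod (u m x - u (k j) x))\<^sup>2) \<partial>?M) \<le> ennreal \<epsilon>"
        unfolding eventually_sequentially
      proof (intro exI[of _ M] allI impI)
        fix j assume "M \<le> j"
        then have "k j \<ge> M" using kQ(3)[of j] by linarith
        then have "(LINT x|?M. (cmod (u m x - u (k j) x))\<^sup>2) \<le> \<epsilon>" using M by (intro less_imp_le) auto
        then show "(\<integral>\<^sup>+x. ennreal ((cmod (u m x - u (k j) x))\<^sup>2) \<partial>?M) \<le> ennreal \<epsilon>"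
          by (subst nn_integral_eq_integral[OF sq]) (auto intro: ennreal_leI)
      qed
    qed
    finally show ?thesis by (simp add: Liminf_const)
  qed
  have diff_L2: "(\<lambda>x. u m x - g x) \<in> L2 \<Omega>" if M: "\<And>m n. m \<ge> M \<Longrightarrow> n \<ge> M \<Longrightarrow> (LINT x|?M. (cmod (u m x - u n x))\<^sup>2) < \<epsilon>" "m \<ge> M" for m M \<epsilon>
  proof -
    have "integrable ?M (\<lambda>x. (cmod (u m x - g x))\<^sup>2)"
      using Fatou[OF that] by (intro integrableI_bounded) (auto intro: le_less_trans)
    then show ?thesis by (simp add: L2_def)
  qed
  obtain M1 where M1: "\<And>m n. m \<ge> M1 \<Longrightarrow> n \<ge> M1 \<Longrightarrow> (LINT x|?M. (cmod (u m x - u n x))\<^sup>2) < 1"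
    using Cauchy[of 1] by auto
  have "(\<lambda>x. u M1 x - (u M1 x - g x)) \<in> L2 \<Omega>" using L2_diff[OF u diff_L2[OF M1]] by blast
  then have gL2: "g \<in> L2 \<Omega>" by simp
  have "(\<lambda>m. LINT x|?M. (cmod (u m x - g x))\<^sup>2) \<longlonglongrightarrow> 0"
  proof (rule LIMSEQ_I)
    fix r :: real assume "r > 0"
    obtain M where M: "\<And>m n. m \<ge> M \<Longrightarrow> n \<ge> M \<Longrightarrow> (LINT x|?M. (cmod (u m x - u n x))\<^sup>2) < r / 2"
      using Cauchy[of "r / 2"] \<open>r > 0\<close> by auto
    have "norm ((LINT x|?M. (cmod (u m x - g x))\<^sup>2) - 0) < r" if "m \<ge> M" for m
    proof -
      have "ennreal (LINT x|?M. (cmod (u m x - g x))\<^sup>2) = (\<integral>\<^sup>+x. ennreal ((cmod (u m x - g x))\<^sup>2) \<partial>?M)"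
        by (rule nn_integral_eq_integral[symmetric]) (use L2_diff[OF u gL2] L2_D(2) in auto)
      then have "ennreal (LINT x|?M. (cmod (u m x - g x))\<^sup>2) \<le> ennreal (r / 2)"
        using Fatou[OF M that] by simp
      then have "(LINT x|?M. (cmod (u m x - g x))\<^sup>2) \<le> r / 2" using \<open>r > 0\<close> by (simp add: ennreal_le_iff)
      moreover have "0 \<le> (LINT x|?M. (cmod (u m x - g x))\<^sup>2)" by (intro integral_nonneg_AE) simp
      ultimately show ?thesis using \<open>r > 0\<close> by simp
    qed
    then show "\<exists>M. \<forall>m\<ge>M. norm ((LINT x|?M. (cmod (u m x - g x))\<^sup>2) - 0) < r" by blast
  qed
  then show thesis using that gL2 by blast
qed

section \<open>Functions smooth up to the frontier\<close>

lemma Cinf_E: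
  assumes "f \<in> Cinf \<Omega>" obtains U where "open U" "closure \<Omega> \<subseteq> U" "smooth_on U f"
  using assms by (auto simp: Cinf_def)

lemma Cinf_I: "smooth_on UNIV f \<Longrightarrow> f \<in> Cinf \<Omega>"
  by (auto simp: Cinf_def)

lemma Cinf_I2: "open U \<Longrightarrow> closure \<Omega> \<subseteq> U \<Longrightarrow> smooth_on U f \<Longrightarrow> f \<in> Cinf \<Omega>"
  by (auto simp: Cinf_def)

lemma Cinf_E2:
  assumes "f \<in> Cinf \<Omega>" "g \<in> Cinf \<Omega>" obtains U where "open U" "closure \<Omega> \<subseteq> U" "smooth_on U f" "smooth_on U g"
proof -
  obtain U where U: "open U" "closure \<Omega> \<subseteq> U" "smooth_on U f" using Cinf_E[OF assms(1)] .
  obtain V where V: "open V" "closure \<Omega> \<subseteq> V" "smooth_on V g" using Cinf_E[OF assms(2)] .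
  show thesis
    by (rule that[of "U \<inter> V"])
       (use U V smooth_on_subset[OF U(3), of "U \<inter> V"] smooth_on_subset[OF V(3), of "U \<inter> V"] in auto)
qed

lemma Cinf_const [simp]: "(\<lambda>x. c) \<in> Cinf \<Omega>"
  by (simp add: Cinf_I)

lemma Cinf_add: "f \<in> Cinf \<Omega> \<Longrightarrow> g \<in> Cinf \<Omega> \<Longrightarrow> (\<lambda>x. f x + g x) \<in> Cinf \<Omega>"
  by (erule (1) Cinf_E2, rule Cinf_I2, assumption+) (simp_all add: smooth_on_add)

lemma Cinf_mult: "f \<in> Cinf \<Omega> \<Longrightarrow> g \<in> Cinf \<Omega> \<Longrightarrow> (\<lambda>x. f x * g x) \<in> Cinf \<Omega>"
  by (erule (1) Cinf_E2, rule Cinf_I2, assumption+) (simp_all add: smooth_on_mult)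

lemma Cinf_cmult: "f \<in> Cinf \<Omega> \<Longrightarrow> (\<lambda>x. c * f x) \<in> Cinf \<Omega>"
  by (simp add: Cinf_mult)

lemma Cinf_diff: "f \<in> Cinf \<Omega> \<Longrightarrow> g \<in> Cinf \<Omega> \<Longrightarrow> (\<lambda>x. f x - g x) \<in> Cinf \<Omega>"
  by (erule (1) Cinf_E2, rule Cinf_I2, assumption+) (simp_all add: smooth_on_diff)

lemma Cinf_cnj: "f \<in> Cinf \<Omega> \<Longrightarrow> (\<lambda>x. cnj (f x)) \<in> Cinf \<Omega>"
  by (erule Cinf_E, rule Cinf_I2, assumption+) (simp_all add: smooth_on_cnj)

lemma Cinf_sum: "(\<And>i. i \<in> I \<Longrightarrow> f i \<in> Cinf \<Omega>) \<Longrightarrow> (\<lambda>x. \<Sum>i\<in>I. f i x) \<in> Cinf \<Omega>"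
  by (induction I rule: infinite_finite_induct) (simp_all add: Cinf_add)

lemma Cinf_D: "f \<in> Cinf \<Omega> \<Longrightarrow> D k f \<in> Cinf \<Omega>"
  by (erule Cinf_E, rule Cinf_I2, assumption+) (simp_all add: smooth_on_D)

lemma Cinf_foldr_D: "f \<in> Cinf \<Omega> \<Longrightarrow> foldr D w f \<in> Cinf \<Omega>"
  by (induction w) (simp_all add: Cinf_D)

lemma Cinf_continuous_on: "f \<in> Cinf \<Omega> \<Longrightarrow> continuous_on (closure \<Omega>) f"
  by (erule Cinf_E) (rule continuous_on_subset[OF smooth_on_continuous_on])

lemma Cinf_differentiable: "f \<in> Cinf \<Omega> \<Longrightarrow> x \<in> closure \<Omega> \<Longrightarrow> f differentiable (at x)"
  by (erule Cinf_E) (blast intro: smooth_on_differentiable)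

lemma Cinf_foldr_D_perm:
  assumes "f \<in> Cinf \<Omega>" "x \<in> closure \<Omega>" "mset u = mset v"
  shows "foldr D u f x = foldr D v f x"
  by (rule Cinf_E[OF assms(1)], rule foldr_D_perm, assumption+) (use assms(2,3) in auto)

lemma foldr_D_add:
  assumes "open U" "smooth_on U f" "smooth_on U g" "x \<in> U"
  shows "foldr D w (\<lambda>x. f x + g x) x = foldr D w f x + foldr D w g x"
  using assms(4)
proof (induction w arbitrary: x)
  case (Cons k w)
  have "D k (foldr D w (\<lambda>x. f x + g x)) x = D k (\<lambda>x. foldr D w f x + foldr D w g x) x"
    using Cons by (intro D_cong_open[OF assms(1)]) auto
  then show ?case
    using D_add[OF smooth_on_differentiable[OF smooth_on_foldr_D[OF assms(2)] Cons.prems]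
        smooth_on_differentiable[OF smooth_on_foldr_D[OF assms(3)] Cons.prems]] by simp
qed simp

lemma foldr_D_cmult:
  fixes f :: "'n::finite cspace \<Rightarrow> complex"
  assumes "open U" "smooth_on U f" "x \<in> U"
  shows "foldr D w (\<lambda>x. c * f x) x = c * foldr D w f x"
  using assms(3)
proof (induction w arbitrary: x)
  case (Cons k w)
  have "D k (foldr D w (\<lambda>x. c * f x)) x = D k (\<lambda>x. c * foldr D w f x) x"
    using Cons by (intro D_cong_open[OF assms(1)]) auto
  then show ?case
    using D_bounded_linear[OF bounded_linear_mult_right, of "foldr D w f" x k c] smooth_on_differentiable[OF smooth_on_foldr_D[OF assms(2)] Cons.prems]
    by simp
qed simp

lemma Cinf_foldr_D_add:
  assumes "f \<in> Cinf \<Omega>" "g \<in> Cinf \<Omega>" "x \<in> closure \<Omega>"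
  shows "foldr D w (\<lambda>x. f x + g x) x = foldr D w f x + foldr D w g x"
  by (rule Cinf_E2[OF assms(1,2)], rule foldr_D_add, assumption+) (use assms(3) in auto)

lemma Cinf_foldr_D_cmult:
  assumes "f \<in> Cinf \<Omega>" "x \<in> closure \<Omega>"
  shows "foldr D w (\<lambda>x. c * f x) x = c * foldr D w f x"
  by (rule Cinf_E[OF assms(1)], rule foldr_D_cmult, assumption+) (use assms(2) in auto)

lemma Cinf_foldr_D_sum:
  assumes "\<And>i. i \<in> I \<Longrightarrow> f i \<in> Cinf \<Omega>" "x \<in> closure \<Omega>"
  shows "foldr D w (\<lambda>x. \<Sum>i\<in>I. f i x) x = (\<Sum>i\<in>I. foldr D w (f i) x)"
  using assms(1)
proof (induction I rule: infinite_finite_induct)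
  case (insert i I)
  then have "foldr D w (\<lambda>x. f i x + (\<Sum>i\<in>I. f i x)) x = foldr D w (f i) x + foldr D w (\<lambda>x. \<Sum>i\<in>I. f i x) x"
    by (intro Cinf_foldr_D_add Cinf_sum) (auto simp: assms(2))
  then show ?case using insert by simp
qed simp_all

section \<open>Weak derivatives\<close>

locale smooth_domain =
  fixes \<Omega> :: "'n::{finite,linorder} cspace set"
  assumes smooth_domain: "smoothly_bounded_domain \<Omega>"
begin

lemma open_domain: "open \<Omega>" and bounded_domain: "bounded \<Omega>"
  using smooth_domain by (auto simp: smoothly_bounded_domain_def)

lemma lmeasurable_domain: "\<Omega> \<in> lmeasurable"
  using open_domain bounded_domain by (simp add: lmeasurable_open)

lemma domain_subset_closure: "x \<in> \<Omega> \<Longrightarrow> x \<in> closure \<Omega>"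
  using closure_subset by auto

sublocale finite_measure "lebesgue_on \<Omega>"
  using lmeasurable_domain by (rule finite_measure_lebesgue_on)

lemma Cinf_integrable: "f \<in> Cinf \<Omega> \<Longrightarrow> integrable (lebesgue_on \<Omega>) f"
  by (intro integrable_on_closure open_domain bounded_domain Cinf_continuous_on)

lemma Cinf_measurable: "f \<in> Cinf \<Omega> \<Longrightarrow> f \<in> borel_measurable (lebesgue_on \<Omega>)"
  using Cinf_integrable by (rule borel_measurable_integrable)

lemma Cinf_L2: "f \<in> Cinf \<Omega> \<Longrightarrow> f \<in> L2 \<Omega>"
  using Cinf_measurable integrable_on_closure[OF open_domain bounded_domain, of "\<lambda>x. (cmod (f x))\<^sup>2"]
  by (simp add: L2_def Cinf_continuous_on continuous_on_norm continuous_on_power)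

lemma Cinf_bounded:
  assumes "f \<in> Cinf \<Omega>"
  obtains B where "B \<ge> 0" "\<And>x. x \<in> \<Omega> \<Longrightarrow> cmod (f x) \<le> B"
proof -
  have "compact (f ` closure \<Omega>)"
    using Cinf_continuous_on[OF assms] bounded_domain by (intro compact_continuous_image) auto
  from compact_imp_bounded[OF this] obtain B where B: "\<And>x. x \<in> closure \<Omega> \<Longrightarrow> cmod (f x) \<le> B"
    by (auto simp: bounded_iff)
  show thesis by (rule that[of "max B 0"]) (use B domain_subset_closure in fastforce)+
qed

lemma integral_D_Cinf_eq_0:
  assumes "h \<in> Cinf \<Omega>" "\<And>x. x \<in> frontier \<Omega> \<Longrightarrow> h x = 0"
  shows "(LINT x|lebesgue_on \<Omega>. D k h x) = 0"
proof -
  obtain U where "open U" "closure \<Omega> \<subseteq> U" "smooth_on U h" using Cinf_E[OF assms(1)] .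
  then show ?thesis
    using integral_D_eq_0[OF open_domain bounded_domain negligible_frontier[OF smooth_domain]] assms(2) by blast
qed

lemma integral_by_parts:
  assumes f: "f \<in> Cinf \<Omega>" and g: "g \<in> Cinf \<Omega>" and "\<And>x. x \<in> frontier \<Omega> \<Longrightarrow> f x * g x = 0"
  shows "(LINT x|lebesgue_on \<Omega>. f x * D k g x) = - (LINT x|lebesgue_on \<Omega>. D k f x * g x)"
proof -
  have "D k (\<lambda>x. f x * g x) x = D k f x * g x + f x * D k g x" if "x \<in> \<Omega>" for x
    using that domain_subset_closure by (intro D_mult Cinf_differentiable[OF f] Cinf_differentiable[OF g]) auto
  then have "(LINT x|lebesgue_on \<Omega>. D k (\<lambda>x. f x * g x) x) = (LINT x|lebesgue_on \<Omega>. D k f x * g x + f x * D k g x)"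
    by (intro Bochner_Integration.integral_cong) auto
  also have "\<dots> = (LINT x|lebesgue_on \<Omega>. D k f x * g x) + (LINT x|lebesgue_on \<Omega>. f x * D k g x)"
    by (intro Bochner_Integration.integral_add Cinf_integrable Cinf_mult Cinf_D f g)
  finally show ?thesis
    using integral_D_Cinf_eq_0[OF Cinf_mult[OF f g] assms(3), of k] by (simp add: eq_neg_iff_add_eq_0 add.commute)
qed

lemma test_function_Cinf: "\<phi> \<in> test_functions \<Omega> \<Longrightarrow> \<phi> \<in> Cinf \<Omega>"
  by (simp add: test_functions_def Cinf_I)

lemma test_function_vanish:
  assumes "\<phi> \<in> test_functions \<Omega>" "x \<in> frontier \<Omega>"
  shows "foldr D w \<phi> x = 0"
proof -
  let ?S = "closure {x. \<phi> x \<noteq> 0}"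
  have "x \<notin> ?S" using assms open_domain by (auto simp: test_functions_def frontier_def interior_open)
  then have "foldr D w \<phi> x = foldr D w (\<lambda>x. 0) x"
    by (intro foldr_D_cong[of "- ?S"]) (use closure_subset[of "{x. \<phi> x \<noteq> 0}"] in auto)
  then show ?thesis by simp
qed

text \<open>The letters are moved over one by one from the front of \<open>w\<close>, hence they
  arrive on \<open>f\<close> in reverse order. All derivatives of a test function vanish on the
  frontier, so no boundary terms arise.\<close>

lemma integral_by_parts_word:
  assumes "\<phi> \<in> test_functions \<Omega>"
  shows "f \<in> Cinf \<Omega> \<Longrightarrow>
    (LINT x|lebesgue_on \<Omega>. f x * foldr D w \<phi> x) = (-1) ^ length w * (LINT x|lebesgue_on \<Omega>. foldr D (rev w) f x * \<phi> x)"
proof (induction w arbitrary: f)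
  case (Cons k w)
  have "(LINT x|lebesgue_on \<Omega>. f x * D k (foldr D w \<phi>) x) = - (LINT x|lebesgue_on \<Omega>. D k f x * foldr D w \<phi> x)"
    using test_function_vanish[OF assms] by (intro integral_by_parts Cons.prems Cinf_foldr_D test_function_Cinf assms) simp
  then show ?case using Cons.IH[OF Cinf_D[OF Cons.prems], of k] by simp
qed simp

lemma has_weak_deriv_Cinf:
  assumes "f \<in> Cinf \<Omega>"
  shows "has_weak_deriv \<Omega> \<alpha> f (foldr D (word \<alpha>) f)"
  unfolding has_weak_deriv_def
proof (intro conjI ballI)
  show "foldr D (word \<alpha>) f \<in> L2 \<Omega>" by (intro Cinf_L2 Cinf_foldr_D assms)
  fix \<phi> assume \<phi>: "\<phi> \<in> test_functions \<Omega>"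
  have "(LINT x|lebesgue_on \<Omega>. foldr D (rev (word \<alpha>)) f x * \<phi> x) = (LINT x|lebesgue_on \<Omega>. foldr D (word \<alpha>) f x * \<phi> x)"
    using Cinf_foldr_D_perm[OF assms domain_subset_closure, of _ "rev (word \<alpha>)" "word \<alpha>"]
    by (intro Bochner_Integration.integral_cong) auto
  then show "(LINT x|lebesgue_on \<Omega>. f x * mD \<alpha> \<phi> x) = (-1) ^ msize \<alpha> * (LINT x|lebesgue_on \<Omega>. foldr D (word \<alpha>) f x * \<phi> x)"
    using integral_by_parts_word[OF \<phi> assms, of "word \<alpha>"] by (simp add: mD_eq_foldr_word length_word)
qed

lemma L2_integrable: "f \<in> L2 \<Omega> \<Longrightarrow> integrable (lebesgue_on \<Omega>) f"
  using L2_mult_integrable[of f \<Omega> "\<lambda>x. 1"] Cinf_L2[of "\<lambda>x. 1"] by simp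

section \<open>The fundamental lemma of the calculus of variations and uniqueness of weak
  derivatives\<close>

lemma test_function_I:
  assumes "smooth_on UNIV \<phi>" "compact K" "K \<subseteq> \<Omega>" "\<And>x. x \<notin> K \<Longrightarrow> \<phi> x = 0"
  shows "\<phi> \<in> test_functions \<Omega>"
proof -
  have "closure {x. \<phi> x \<noteq> 0} \<subseteq> K"
    using assms by (intro closure_minimal compact_imp_closed) auto
  moreover then have "compact (closure {x. \<phi> x \<noteq> 0})"
    using assms(2) compact_Int_closed[of K "closure {x. \<phi> x \<noteq> 0}"] by (simp add: Int_absorb1)
  ultimately show ?thesis using assms by (auto simp: test_functions_def)
qed

text \<open>The indicator of an open set is a bounded pointwise limit of test functions. The set is
  a countable union of balls whose closures it contains; with S_n the sum of the first n bumps, 1 -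
  exp(- n S_n) tends to 1 on the set and is 0 off it, and it has compact support because only
  finitely many balls are involved at each stage.\<close>

lemma integral_open_eq_0_if_test:
  assumes g: "g \<in> L2 \<Omega>" and test: "\<And>\<phi>. \<phi> \<in> test_functions \<Omega> \<Longrightarrow> (LINT x|lebesgue_on \<Omega>. g x * \<phi> x) = 0"
    and "open O'" "O' \<subseteq> \<Omega>"
  shows "(LINT x|lebesgue_on \<Omega>. indicator O' x *\<^sub>R g x) = 0"
proof (cases "O' = {}")
  case False
  define \<F> where "\<F> = {ball x r |x r. r > 0 \<and> cball x r \<subseteq> O'}"
  have U: "\<Union>\<F> = O'"
  proof
    show "\<Union>\<F> \<subseteq> O'" by (force simp: \<F>_def)
    show "O' \<subseteq> \<Union>\<F>"
    proof
      fix x assume "x \<in> O'"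
      then obtain e where "e > 0" "cball x e \<subseteq> O'" using assms(3) open_contains_cball by blast
      then have "ball x e \<in> \<F>" "x \<in> ball x e" by (auto simp: \<F>_def)
      then show "x \<in> \<Union>\<F>" by blast
    qed
  qed
  obtain \<F>' where F': "\<F>' \<subseteq> \<F>" "countable \<F>'" "\<Union>\<F>' = \<Union>\<F>"
    by (rule Lindelof[of \<F>]) (auto simp: \<F>_def)
  have ne: "\<F>' \<noteq> {}" using F' U False by auto
  have "\<forall>i. \<exists>c r. from_nat_into \<F>' i = ball c r \<and> r > 0 \<and> cball c r \<subseteq> O'"
    using from_nat_into[OF ne] F'(1) by (fastforce simp: \<F>_def)
  then obtain c r where cr: "\<And>i. from_nat_into \<F>' i = ball (c i) (r i)" "\<And>i. r i > 0" "\<And>i. cball (c i) (r i) \<subseteq> O'"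
    by metis
  have cover: "O' = (\<Union>i. ball (c i) (r i))"
    using range_from_nat_into[OF ne F'(2)] F'(3) U cr(1) by (metis (no_types, lifting) SUP_cong)
  define S where "S = (\<lambda>n x. \<Sum>i<n. ball_bump (c i) (r i) x)"
  define \<phi> where "\<phi> = (\<lambda>(n::nat) x. complex_of_real (1 - exp (- (real n * S n x))))"
  have S0: "S n x \<ge> 0" for n x by (simp add: S_def sum_nonneg)
  have smooth: "smooth_on UNIV (\<phi> n)" for n
    unfolding \<phi>_def S_def
    by (intro smooth_on_of_real smooth_on_diff smooth_on_const smooth_on_exp smooth_on_minus smooth_on_cmult
        smooth_on_sum smooth_on_ball_bump open_UNIV)
  have outside: "S n x = 0" if "x \<notin> (\<Union>i<n. cball (c i) (r i))" for n x
    unfolding S_def using that cr(2) ball_subset_cball by (intro sum.neutral) (force simp: ball_bump_eq_0_iff)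
  have testf: "\<phi> n \<in> test_functions \<Omega>" for n
  proof (rule test_function_I[OF smooth, of "\<Union>i<n. cball (c i) (r i)"])
    show "(\<Union>i<n. cball (c i) (r i)) \<subseteq> \<Omega>" using cr(3) assms(4) by blast
    show "\<phi> n x = 0" if "x \<notin> (\<Union>i<n. cball (c i) (r i))" for x using outside[OF that] by (simp add: \<phi>_def)
  qed auto
  have lim: "(\<lambda>n. \<phi> n x) \<longlonglongrightarrow> indicator O' x" for x
  proof (cases "x \<in> O'")
    case True
    then obtain i where i: "x \<in> ball (c i) (r i)" using cover by blast
    define b where "b = ball_bump (c i) (r i) x"
    have b: "b > 0" using i cr(2) by (simp add: b_def ball_bump_pos_iff)
    have Sb: "S n x \<ge> b" if "n > i" for n
      unfolding S_def b_def using that by (intro member_le_sum) auto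
    have "(\<lambda>n. exp (- (real n * S n x))) \<longlonglongrightarrow> 0"
    proof (rule tendsto_sandwich[of "\<lambda>n. 0" _ _ "\<lambda>n. exp (- (real n * b))"])
      show "\<forall>\<^sub>F n in sequentially. exp (- (real n * S n x)) \<le> exp (- (real n * b))"
        using Sb by (intro eventually_sequentiallyI[of "Suc i"]) (auto intro: mult_left_mono)
      have "filterlim (\<lambda>n. real n * b) at_top sequentially"
        using b filterlim_real_sequentially by (intro filterlim_at_top_mult_tendsto_pos[OF tendsto_const]) (simp_all add: mult.commute)
      then show "(\<lambda>n. exp (- (real n * b))) \<longlonglongrightarrow> 0"
        by (intro filterlim_compose[OF exp_at_bot] filterlim_compose[OF filterlim_uminus_at_bot_at_top])
    qed auto
    then have "(\<lambda>n. complex_of_real (1 - exp (- (real n * S n x)))) \<longlonglongrightarrow> complex_of_real (1 - 0)"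
      by (intro tendsto_intros)
    then show ?thesis using True by (simp add: \<phi>_def)
  next
    case False
    then have "S n x = 0" for n using outside[of x n] cr(3) by blast
    then show ?thesis using False by (simp add: \<phi>_def)
  qed
  have bound: "cmod (\<phi> n x) \<le> 1" for n x
  proof -
    have "real n * S n x \<ge> 0" using S0 by simp
    then have "0 \<le> 1 - exp (- (real n * S n x))" "1 - exp (- (real n * S n x)) \<le> 1" by auto
    then show ?thesis unfolding \<phi>_def norm_of_real by linarith
  qed
  have "(\<lambda>n. LINT x|lebesgue_on \<Omega>. g x * \<phi> n x) \<longlonglongrightarrow> (LINT x|lebesgue_on \<Omega>. indicator O' x *\<^sub>R g x)"
  proof (rule integral_dominated_convergence)
    have "O' \<inter> \<Omega> \<in> sets (lebesgue_on \<Omega>)" using assms(3,4) open_domain by (auto simp: sets_restrict_space)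
    then have "O' \<in> sets (lebesgue_on \<Omega>)" using assms(4) by (simp add: Int_absorb2)
    then show "(\<lambda>x. indicator O' x *\<^sub>R g x) \<in> borel_measurable (lebesgue_on \<Omega>)"
      using L2_D(1)[OF g] by measurable
    show "(\<lambda>x. g x * \<phi> n x) \<in> borel_measurable (lebesgue_on \<Omega>)" for n
      using L2_D(1)[OF g] Cinf_measurable[OF Cinf_I[OF smooth]] by measurable
    show "integrable (lebesgue_on \<Omega>) (\<lambda>x. cmod (g x))" using L2_integrable[OF g] by simp
    show "AE x in lebesgue_on \<Omega>. (\<lambda>n. g x * \<phi> n x) \<longlonglongrightarrow> indicator O' x *\<^sub>R g x"
    proof (intro AE_I2)
      fix x
      have "(\<lambda>n. g x * \<phi> n x) \<longlonglongrightarrow> g x * indicator O' x" by (intro tendsto_mult tendsto_const lim)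
      then show "(\<lambda>n. g x * \<phi> n x) \<longlonglongrightarrow> indicator O' x *\<^sub>R g x"
        by (cases "x \<in> O'") simp_all
    qed
    show "AE x in lebesgue_on \<Omega>. norm (g x * \<phi> n x) \<le> cmod (g x)" for n
      using bound[of n] by (intro AE_I2) (simp add: norm_mult mult_left_le)
  qed
  then show ?thesis using test[OF testf] by (simp add: LIMSEQ_const_iff)
qed simp

text \<open>Outer regularity extends the vanishing of the integrals from open to measurable sets: up
  to a null set, a measurable subset of \<open>\<Omega>\<close> is the intersection of a decreasing
  sequence of open subsets of \<open>\<Omega>\<close>. A function whose integrals over all
  measurable sets vanish is zero almost everywhere.\<close>

lemma AE_eq_0_if_test:
  assumes g: "g \<in> L2 \<Omega>" and test: "\<And>\<phi>. \<phi> \<in> test_functions \<Omega> \<Longrightarrow> (LINT x|lebesgue_on \<Omega>. g x * \<phi> x) = 0"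
  shows "AE x in lebesgue_on \<Omega>. g x = 0"
proof (rule density_unique_banach[where f' = "\<lambda>x. 0"])
  show "integrable (lebesgue_on \<Omega>) g" using L2_integrable[OF g] .
  fix A assume "A \<in> sets (lebesgue_on \<Omega>)"
  then have A: "A \<in> sets lebesgue" "A \<subseteq> \<Omega>"
    using open_domain by (auto simp: sets_restrict_space)
  have "\<forall>n. \<exists>T. open T \<and> A \<subseteq> T \<and> T - A \<in> lmeasurable \<and> emeasure lebesgue (T - A) < ennreal (1 / real (Suc n))"
    using sets_lebesgue_outer_open[OF A(1)] by (metis zero_less_divide_1_iff of_nat_0_less_iff zero_less_Suc)
  then obtain T where T: "\<And>n. open (T n)" "\<And>n. A \<subseteq> T n" "\<And>n. T n - A \<in> lmeasurable"
    "\<And>n. emeasure lebesgue (T n - A) < ennreal (1 / real (Suc n))"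
    by metis
  define U where "U = (\<lambda>n. \<Omega> \<inter> (\<Inter>i\<le>n. T i))"
  define G where "G = (\<Inter>n. U n)"
  have oU: "open (U n)" "U n \<subseteq> \<Omega>" for n unfolding U_def using T(1) open_domain by (auto intro: open_INT)
  have AG: "A \<subseteq> G" using T(2) A(2) by (auto simp: G_def U_def)
  have meas: "G - A \<in> sets lebesgue" unfolding G_def using oU A by auto
  have "emeasure lebesgue (G - A) \<le> ennreal (1 / real (Suc n))" for n
  proof -
    have "emeasure lebesgue (G - A) \<le> emeasure lebesgue (T n - A)"
      using T(3)[of n] by (intro emeasure_mono) (auto simp: G_def U_def)
    then show ?thesis using T(4)[of n] by simp
  qed
  then have le: "emeasure lebesgue (G - A) \<le> ennreal (1 / real (Suc n))" for n .
  have "(\<lambda>n. ennreal (1 / real (Suc n))) \<longlonglongrightarrow> ennreal 0"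
    by (intro tendsto_ennrealI LIMSEQ_Suc lim_1_over_n)
  then have "emeasure lebesgue (G - A) \<le> ennreal 0"
    using le by (intro LIMSEQ_le_const) auto
  then have "G - A \<in> null_sets lebesgue" using meas by auto
  then have "AE x in lebesgue. x \<notin> G - A" by (rule AE_not_in)
  then have AE: "AE x in lebesgue_on \<Omega>. x \<notin> G - A"
    using open_domain by (subst AE_restrict_space_iff) auto
  have int: "(\<lambda>n. LINT x|lebesgue_on \<Omega>. indicator (U n) x *\<^sub>R g x) \<longlonglongrightarrow> (LINT x|lebesgue_on \<Omega>. indicator A x *\<^sub>R g x)"
  proof (rule integral_dominated_convergence)
    have m: "B \<in> sets (lebesgue_on \<Omega>)" if "B \<in> sets lebesgue" "B \<subseteq> \<Omega>" for B
      using that open_domain by (auto simp: sets_restrict_space Int_absorb2 intro!: image_eqI[of _ _ B])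
    show "(\<lambda>x. indicator A x *\<^sub>R g x) \<in> borel_measurable (lebesgue_on \<Omega>)"
      using L2_D(1)[OF g] m[OF A] by measurable
    show "(\<lambda>x. indicator (U n) x *\<^sub>R g x) \<in> borel_measurable (lebesgue_on \<Omega>)" for n
    proof -
      have "U n \<in> sets (lebesgue_on \<Omega>)" by (rule m) (use oU[of n] in auto)
      then show ?thesis using L2_D(1)[OF g] by measurable
    qed
    show "integrable (lebesgue_on \<Omega>) (\<lambda>x. cmod (g x))" using L2_integrable[OF g] by simp
    show "AE x in lebesgue_on \<Omega>. (\<lambda>n. indicator (U n) x *\<^sub>R g x) \<longlonglongrightarrow> indicator A x *\<^sub>R g x"
      using AE
    proof eventually_elim
      case (elim x)
      have "\<forall>\<^sub>F n in sequentially. indicator (U n) x = (indicator A x :: real)"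
      proof (cases "x \<in> A")
        case True
        then show ?thesis using AG by (auto simp: G_def)
      next
        case False
        then obtain n where "x \<notin> U n" using elim by (auto simp: G_def)
        then have "x \<notin> U m" if "m \<ge> n" for m using that by (fastforce simp: U_def)
        then show ?thesis using False by (intro eventually_sequentiallyI[of n]) simp
      qed
      then show ?case by (intro tendsto_eventually) (auto elim: eventually_mono)
    qed
    show "AE x in lebesgue_on \<Omega>. norm (indicator (U n) x *\<^sub>R g x) \<le> cmod (g x)" for n
      by (intro AE_I2) (simp add: indicator_def)
  qed
  have "(LINT x|lebesgue_on \<Omega>. indicator (U n) x *\<^sub>R g x) = 0" for n
    by (rule integral_open_eq_0_if_test[OF g test oU])
  then have "(LINT x|lebesgue_on \<Omega>. indicator A x *\<^sub>R g x) = 0" using int by (simp add: LIMSEQ_const_iff)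
  then show "set_lebesgue_integral (lebesgue_on \<Omega>) A g = set_lebesgue_integral (lebesgue_on \<Omega>) A (\<lambda>x. 0)"
    by (simp add: set_lebesgue_integral_def)
qed simp

lemma has_weak_deriv_unique:
  assumes "has_weak_deriv \<Omega> \<alpha> f g1" "has_weak_deriv \<Omega> \<alpha> f g2"
  shows "AE x in lebesgue_on \<Omega>. g1 x = g2 x"
proof -
  have "AE x in lebesgue_on \<Omega>. g1 x - g2 x = 0"
  proof (rule AE_eq_0_if_test)
    show "(\<lambda>x. g1 x - g2 x) \<in> L2 \<Omega>" using assms by (auto simp: has_weak_deriv_def intro: L2_diff)
    fix \<phi> assume \<phi>: "\<phi> \<in> test_functions \<Omega>"
    have "integrable (lebesgue_on \<Omega>) (\<lambda>x. g x * \<phi> x)" if "g \<in> L2 \<Omega>" for g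
      by (intro L2_mult_integrable that Cinf_L2 test_function_Cinf \<phi>)
    then show "(LINT x|lebesgue_on \<Omega>. (g1 x - g2 x) * \<phi> x) = 0"
      using assms \<phi> by (simp add: has_weak_deriv_def left_diff_distrib)
  qed
  then show ?thesis by eventually_elim simp
qed

lemma has_weak_deriv_weak_deriv: "has_weak_deriv \<Omega> \<alpha> f g \<Longrightarrow> has_weak_deriv \<Omega> \<alpha> f (weak_deriv \<Omega> \<alpha> f)"
  unfolding weak_deriv_def by (rule someI[of "has_weak_deriv \<Omega> \<alpha> f"])

lemma weak_deriv_AE_eq:
  assumes "has_weak_deriv \<Omega> \<alpha> f g"
  shows "AE x in lebesgue_on \<Omega>. weak_deriv \<Omega> \<alpha> f x = g x"
  using has_weak_deriv_unique[OF has_weak_deriv_weak_deriv[OF assms] assms] .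

lemma has_weak_deriv_diff:
  assumes "f1 \<in> L2 \<Omega>" "f2 \<in> L2 \<Omega>" "has_weak_deriv \<Omega> \<alpha> f1 g1" "has_weak_deriv \<Omega> \<alpha> f2 g2"
  shows "has_weak_deriv \<Omega> \<alpha> (\<lambda>x. f1 x - f2 x) (\<lambda>x. g1 x - g2 x)"
  unfolding has_weak_deriv_def
proof (intro conjI ballI)
  show "(\<lambda>x. g1 x - g2 x) \<in> L2 \<Omega>" using assms by (auto simp: has_weak_deriv_def intro: L2_diff)
  fix \<phi> assume \<phi>: "\<phi> \<in> test_functions \<Omega>"
  have "integrable (lebesgue_on \<Omega>) (\<lambda>x. g x * foldr D w \<phi> x)" if "g \<in> L2 \<Omega>" for g w
    by (intro L2_mult_integrable that Cinf_L2 Cinf_foldr_D test_function_Cinf \<phi>)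
  from this[of _ "[]"] this[of _ "word \<alpha>"]
  show "(LINT x|lebesgue_on \<Omega>. (f1 x - f2 x) * mD \<alpha> \<phi> x) = (-1) ^ msize \<alpha> * (LINT x|lebesgue_on \<Omega>. (g1 x - g2 x) * \<phi> x)"
    using assms \<phi> by (simp add: has_weak_deriv_def left_diff_distrib right_diff_distrib mD_eq_foldr_word)
qed

text \<open>\<open>weak_deriv\<close> is an arbitrary choice, but weak derivatives agree almost
  everywhere; hence the product may be computed from any representatives, in particular from
  classical derivatives.\<close>

lemma W_inner_eq:
  assumes "\<And>\<alpha>. msize \<alpha> \<le> s \<Longrightarrow> has_weak_deriv \<Omega> \<alpha> f (F \<alpha>)" "\<And>\<alpha>. msize \<alpha> \<le> s \<Longrightarrow> has_weak_deriv \<Omega> \<alpha> g (G \<alpha>)"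
  shows "W_inner \<Omega> s f g = family_ip \<Omega> {\<alpha>. msize \<alpha> \<le> s} mcoeff F G"
  unfolding W_inner_def family_ip_def
proof (intro sum.cong refl arg_cong2[where f = "(*)"])
  fix \<alpha> :: "'n multiindex" assume \<alpha>: "\<alpha> \<in> {\<alpha>. msize \<alpha> \<le> s}"
  have wf: "has_weak_deriv \<Omega> \<alpha> f (weak_deriv \<Omega> \<alpha> f)" "has_weak_deriv \<Omega> \<alpha> g (weak_deriv \<Omega> \<alpha> g)"
    using assms[of \<alpha>] \<alpha> by (auto intro: has_weak_deriv_weak_deriv)
  have m: "(\<lambda>x. a x * cnj (b x)) \<in> borel_measurable (lebesgue_on \<Omega>)" if "a \<in> L2 \<Omega>" "b \<in> L2 \<Omega>" for a b
    using L2_mult_integrable[OF that(1) L2_cnj[OF that(2)]] by (rule borel_measurable_integrable)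
  show "(LINT x|lebesgue_on \<Omega>. weak_deriv \<Omega> \<alpha> f x * cnj (weak_deriv \<Omega> \<alpha> g x)) = (LINT x|lebesgue_on \<Omega>. F \<alpha> x * cnj (G \<alpha> x))"
  proof (rule integral_cong_AE)
    show "AE x in lebesgue_on \<Omega>. weak_deriv \<Omega> \<alpha> f x * cnj (weak_deriv \<Omega> \<alpha> g x) = F \<alpha> x * cnj (G \<alpha> x)"
      using weak_deriv_AE_eq[of \<alpha> f "F \<alpha>"] weak_deriv_AE_eq[of \<alpha> g "G \<alpha>"] assms \<alpha>
      by (auto elim!: eventually_rev_mp)
  qed (use wf assms \<alpha> in \<open>auto simp: has_weak_deriv_def intro!: m\<close>)
qed

end

section \<open>The Sobolev space as a Hilbert space\<close>

lemma finite_words: "finite {w :: 'a::finite list. length w \<le> s}"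
  using finite_lists_length_le[of "UNIV :: 'a set" s] by simp

lemma finite_multiindices: "finite {\<alpha> :: 'n::{finite,linorder} multiindex. msize \<alpha> \<le> s}"
proof (rule finite_surj[OF finite_words])
  show "{\<alpha> :: 'n multiindex. msize \<alpha> \<le> s} \<subseteq> (\<lambda>w k. count (mset w) k) ` {w. length w \<le> s}"
  proof
    fix \<alpha> :: "'n multiindex" assume "\<alpha> \<in> {\<alpha>. msize \<alpha> \<le> s}"
    then show "\<alpha> \<in> (\<lambda>w k. count (mset w) k) ` {w. length w \<le> s}"
      by (intro image_eqI[of _ _ "word \<alpha>"]) (simp_all add: count_word length_word)
  qed
qed

lemma mset_eq_word_iff: "(\<lambda>k. count (mset w) k) = \<alpha> \<longleftrightarrow> mset w = mset (word \<alpha>)"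
  by (auto simp: multiset_eq_iff count_word fun_eq_iff)

text \<open>The words with the letters of \<open>\<alpha>\<close> are the permutations of a
  multiset, counted by the multinomial coefficient. The Sobolev weights are thus multiplicities of
  words.\<close>

lemma card_words_eq_mcoeff: "real (card {w. mset w = mset (word \<alpha>)}) = mcoeff \<alpha>"
proof -
  have "{w. mset w = mset (word \<alpha>)} = permutations_of_multiset (mset (word \<alpha>))"
    by (simp add: permutations_of_multiset_def)
  moreover have "card (permutations_of_multiset (mset (word \<alpha>))) * (\<Prod>x\<in>set_mset (mset (word \<alpha>)). fact (\<alpha> x)) = fact (msize \<alpha>)"
    using card_permutations_of_multiset_aux[of "mset (word \<alpha>)"] by (simp only: count_word size_mset length_word)
  moreover have "(\<Prod>x\<in>set_mset (mset (word \<alpha>)). fact (\<alpha> x)) = mfact \<alpha>"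
    unfolding mfact_def
  proof (rule prod.mono_neutral_left)
    show "\<forall>k\<in>UNIV - set_mset (mset (word \<alpha>)). fact (\<alpha> k) = (1::nat)"
    proof
      fix k assume "k \<in> UNIV - set_mset (mset (word \<alpha>))"
      then have "count (mset (word \<alpha>)) k = 0" by (simp add: count_eq_zero_iff)
      then show "fact (\<alpha> k) = (1::nat)" by (simp add: count_word)
    qed
  qed auto
  ultimately have "card {w. mset w = mset (word \<alpha>)} * mfact \<alpha> = fact (msize \<alpha>)" by simp
  then have "real (card {w. mset w = mset (word \<alpha>)}) * real (mfact \<alpha>) = fact (msize \<alpha>)"
    by (metis of_nat_fact of_nat_mult)
  moreover have "mfact \<alpha> \<noteq> 0" by (simp add: mfact_def)
  ultimately show ?thesis by (simp add: mcoeff_def field_simps)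
qed

lemma mcoeff_nonneg [simp]: "mcoeff \<alpha> \<ge> 0"
  by (simp add: mcoeff_def)

lemma mcoeff_pos: "mcoeff \<alpha> > 0"
  by (simp add: mcoeff_def mfact_def prod_pos)

text \<open>The words are grouped by their letter counts; each group is a single multi-index with
  multiplicity \<open>mcoeff\<close>.\<close>

lemma sum_multiindex_eq_sum_words:
  fixes X :: "('n::{finite,linorder} + 'n) list \<Rightarrow> complex"
  assumes "\<And>u v. mset u = mset v \<Longrightarrow> X u = X v"
  shows "(\<Sum>\<alpha> | msize \<alpha> \<le> s. of_real (mcoeff \<alpha>) * X (word \<alpha>)) = (\<Sum>w | length w \<le> s. X w)"
proof -
  let ?c = "\<lambda>w k. count (mset w) k"
  have "(\<Sum>w\<in>{w \<in> {w. length w \<le> s}. ?c w = \<alpha>}. X w) = of_real (mcoeff \<alpha>) * X (word \<alpha>)"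
    if "\<alpha> \<in> {\<alpha>. msize \<alpha> \<le> s}" for \<alpha> :: "'n multiindex"
  proof -
    have "length w = msize \<alpha>" if "mset w = mset (word \<alpha>)" for w
      using that by (metis length_word size_mset)
    then have "{w \<in> {w. length w \<le> s}. ?c w = \<alpha>} = {w. mset w = mset (word \<alpha>)}"
      using that by (auto simp: mset_eq_word_iff)
    moreover have "(\<Sum>w | mset w = mset (word \<alpha>). X w) = (\<Sum>w | mset w = mset (word \<alpha>). X (word \<alpha>))"
      by (intro sum.cong refl assms) simp
    ultimately show ?thesis by (simp add: card_words_eq_mcoeff[symmetric])
  qed
  then have "(\<Sum>\<alpha> | msize \<alpha> \<le> s. of_real (mcoeff \<alpha>) * X (word \<alpha>))
      = (\<Sum>\<alpha>\<in>{\<alpha>. msize \<alpha> \<le> s}. \<Sum>w\<in>{w \<in> {w. length w \<le> s}. ?c w = \<alpha>}. X w)"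
    by (intro sum.cong) auto
  also have "\<dots> = (\<Sum>w | length w \<le> s. X w)"
  proof (rule sum.group[OF finite_words finite_multiindices])
    have "msize (?c w) = length w" for w :: "('n + 'n) list"
      using mset_eq_word_iff[of w "?c w"] length_word[of "?c w"] by (metis size_mset)
    then show "?c ` {w. length w \<le> s} \<subseteq> {\<alpha> :: 'n multiindex. msize \<alpha> \<le> s}" by auto
  qed
  finally show ?thesis .
qed

context smooth_domain
begin

text \<open>The Sobolev space without the approximation clause of \<open>W\<close>. It contains both
  \<open>W\<close> and \<open>Cinf\<close> and is visibly closed under differences, which suffices
  for the algebra of \<open>W_inner\<close> and for Cauchy-Schwarz.\<close>

definition S_space :: "nat \<Rightarrow> ('n cspace \<Rightarrow> complex) set" where
  "S_space s = {f \<in> L2 \<Omega>. \<forall>\<alpha>. msize \<alpha> \<le> s \<longrightarrow> (\<exists>g. has_weak_deriv \<Omega> \<alpha> f g)}"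

lemma W_subset_S_space: "W \<Omega> s \<subseteq> S_space s"
  by (auto simp: W_def S_space_def)

lemma Cinf_subset_S_space: "Cinf \<Omega> \<subseteq> S_space s"
  using Cinf_L2 has_weak_deriv_Cinf by (auto simp: S_space_def)

lemma S_space_has_weak_deriv:
  "f \<in> S_space s \<Longrightarrow> msize \<alpha> \<le> s \<Longrightarrow> has_weak_deriv \<Omega> \<alpha> f (weak_deriv \<Omega> \<alpha> f)"
  using has_weak_deriv_weak_deriv by (auto simp: S_space_def)

lemma S_space_diff: "f \<in> S_space s \<Longrightarrow> g \<in> S_space s \<Longrightarrow> (\<lambda>x. f x - g x) \<in> S_space s"
  unfolding S_space_def using L2_diff has_weak_deriv_diff by blast

interpretation fam: semi_inner_space "{F. \<forall>\<alpha>\<in>{\<alpha>. msize \<alpha> \<le> s}. F \<alpha> \<in> L2 \<Omega>}" "\<lambda>F G \<alpha> x. F \<alpha> x + G \<alpha> x"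
    "\<lambda>c F \<alpha> x. c * F \<alpha> x" "family_ip \<Omega> {\<alpha>. msize \<alpha> \<le> s} (mcoeff :: 'n multiindex \<Rightarrow> real)" for s
  by (rule semi_inner_space_family) simp

lemma S_space_family:
  "f \<in> S_space s \<Longrightarrow> (\<lambda>\<alpha>. weak_deriv \<Omega> \<alpha> f) \<in> {F. \<forall>\<alpha>\<in>{\<alpha>. msize \<alpha> \<le> s}. F \<alpha> \<in> L2 \<Omega>}"
  using S_space_has_weak_deriv by (auto simp: has_weak_deriv_def)

lemma W_inner_family: "W_inner \<Omega> s f g = family_ip \<Omega> {\<alpha>. msize \<alpha> \<le> s} mcoeff (\<lambda>\<alpha>. weak_deriv \<Omega> \<alpha> f) (\<lambda>\<alpha>. weak_deriv \<Omega> \<alpha> g)"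
  by (simp add: W_inner_def family_ip_def)

lemma W_norm_family: "W_norm \<Omega> s f = sqrt (fam.nsq s (\<lambda>\<alpha>. weak_deriv \<Omega> \<alpha> f))"
  by (simp add: W_norm_def fam.nsq_def W_inner_family)

lemma W_cauchy_schwarz:
  assumes "f \<in> S_space s" "g \<in> S_space s"
  shows "cmod (W_inner \<Omega> s f g) \<le> W_norm \<Omega> s f * W_norm \<Omega> s g"
  unfolding W_inner_family W_norm_family
  by (rule fam.cauchy_schwarz_sqrt) (use assms S_space_family in blast)+

lemma W_inner_self_nonneg: "f \<in> S_space s \<Longrightarrow> 0 \<le> Re (W_inner \<Omega> s f f)"
  unfolding W_inner_family by (rule fam.ip_nonneg[OF S_space_family])

lemma W_inner_diff_left:
  assumes "f \<in> S_space s" "g \<in> S_space s" "h \<in> S_space s"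
  shows "W_inner \<Omega> s (\<lambda>x. f x - g x) h = W_inner \<Omega> s f h - W_inner \<Omega> s g h"
proof -
  have "W_inner \<Omega> s (\<lambda>x. f x - g x) h
      = family_ip \<Omega> {\<alpha>. msize \<alpha> \<le> s} mcoeff (\<lambda>\<alpha> x. weak_deriv \<Omega> \<alpha> f x - weak_deriv \<Omega> \<alpha> g x) (\<lambda>\<alpha>. weak_deriv \<Omega> \<alpha> h)"
    by (intro W_inner_eq has_weak_deriv_diff S_space_has_weak_deriv assms)
       (use assms in \<open>auto simp: S_space_def\<close>)
  also have "\<dots> = W_inner \<Omega> s f h + family_ip \<Omega> {\<alpha>. msize \<alpha> \<le> s} mcoeff (\<lambda>\<alpha> x. (-1) * weak_deriv \<Omega> \<alpha> g x) (\<lambda>\<alpha>. weak_deriv \<Omega> \<alpha> h)"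
    using fam.ip_add_left[OF S_space_family[OF assms(1)] fam.scale_closed[OF S_space_family[OF assms(2)], of "-1"] S_space_family[OF assms(3)]]
    by (simp add: W_inner_family)
  also have "\<dots> = W_inner \<Omega> s f h - W_inner \<Omega> s g h"
    unfolding fam.ip_scale_left[OF S_space_family[OF assms(2)] S_space_family[OF assms(3)]] W_inner_family by simp
  finally show ?thesis .
qed

lemma W_inner_cnj: "f \<in> S_space s \<Longrightarrow> g \<in> S_space s \<Longrightarrow> cnj (W_inner \<Omega> s f g) = W_inner \<Omega> s g f"
  unfolding W_inner_family by (intro fam.ip_cnj S_space_family)

lemma W_inner_Cinf:
  assumes "f \<in> Cinf \<Omega>" "g \<in> Cinf \<Omega>"
  shows "W_inner \<Omega> s f g = (\<Sum>w | length w \<le> s. LINT x|lebesgue_on \<Omega>. foldr D w f x * cnj (foldr D w g x))"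
proof -
  let ?X = "\<lambda>w. LINT x|lebesgue_on \<Omega>. foldr D w f x * cnj (foldr D w g x)"
  have "(LINT x|lebesgue_on \<Omega>. foldr D u f x * cnj (foldr D u g x)) = (LINT x|lebesgue_on \<Omega>. foldr D v f x * cnj (foldr D v g x))"
    if "mset u = mset v" for u v
    using Cinf_foldr_D_perm[OF assms(1) domain_subset_closure that] Cinf_foldr_D_perm[OF assms(2) domain_subset_closure that]
    by (intro Bochner_Integration.integral_cong) auto
  from sum_multiindex_eq_sum_words[of ?X, OF this, where s = s] show ?thesis
    unfolding W_inner_eq[OF has_weak_deriv_Cinf[OF assms(1)] has_weak_deriv_Cinf[OF assms(2)]] family_ip_def
    by simp
qed

lemma Cinf_ip_integrable:
  "f \<in> Cinf \<Omega> \<Longrightarrow> g \<in> Cinf \<Omega> \<Longrightarrow> integrable (lebesgue_on \<Omega>) (\<lambda>x. foldr D w f x * cnj (foldr D w g x))"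
  by (intro Cinf_integrable Cinf_mult Cinf_cnj Cinf_foldr_D)

lemma W_inner_Cinf_add_left:
  assumes "f \<in> Cinf \<Omega>" "g \<in> Cinf \<Omega>" "h \<in> Cinf \<Omega>"
  shows "W_inner \<Omega> s (\<lambda>x. f x + g x) h = W_inner \<Omega> s f h + W_inner \<Omega> s g h"
proof -
  have "(LINT x|lebesgue_on \<Omega>. foldr D w (\<lambda>x. f x + g x) x * cnj (foldr D w h x))
     = (LINT x|lebesgue_on \<Omega>. foldr D w f x * cnj (foldr D w h x) + foldr D w g x * cnj (foldr D w h x))" for w
    using Cinf_foldr_D_add[OF assms(1,2) domain_subset_closure]
    by (intro Bochner_Integration.integral_cong) (auto simp: distrib_right)
  then show ?thesis
    by (simp add: W_inner_Cinf Cinf_add assms Cinf_ip_integrable sum.distrib)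
qed

lemma W_inner_Cinf_cmult_left:
  assumes "f \<in> Cinf \<Omega>" "h \<in> Cinf \<Omega>"
  shows "W_inner \<Omega> s (\<lambda>x. c * f x) h = c * W_inner \<Omega> s f h"
proof -
  have "(LINT x|lebesgue_on \<Omega>. foldr D w (\<lambda>x. c * f x) x * cnj (foldr D w h x))
     = (LINT x|lebesgue_on \<Omega>. c * (foldr D w f x * cnj (foldr D w h x)))" for w
    using Cinf_foldr_D_cmult[OF assms(1) domain_subset_closure]
    by (intro Bochner_Integration.integral_cong) auto
  then show ?thesis
    by (simp add: W_inner_Cinf Cinf_cmult assms sum_distrib_left)
qed

text \<open>The Riesz argument runs on this dense subspace; \<open>W_complete\<close> then provides
  the limit of the minimising sequence in \<open>W\<close>.\<close>

interpretation cinf: semi_inner_space "Cinf \<Omega>" "\<lambda>f g x. f x + g x" "\<lambda>c f x. c * f x" "W_inner \<Omega> s" for s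
proof
  fix f g assume "f \<in> Cinf \<Omega>" "g \<in> Cinf \<Omega>"
  then show "cnj (W_inner \<Omega> s f g) = W_inner \<Omega> s g f" using W_inner_cnj Cinf_subset_S_space by blast
next
  fix f assume "f \<in> Cinf \<Omega>"
  then show "0 \<le> Re (W_inner \<Omega> s f f)" using W_inner_self_nonneg Cinf_subset_S_space by blast
qed (use Cinf_add Cinf_cmult W_inner_Cinf_add_left W_inner_Cinf_cmult_left in auto)

lemma cinf_nsq: "sqrt (cinf.nsq s f) = W_norm \<Omega> s f"
  by (simp add: cinf.nsq_def W_norm_def)

lemma Cinf_subset_W: "Cinf \<Omega> \<subseteq> W \<Omega> s"
proof
  fix f assume f: "f \<in> Cinf \<Omega>"
  have "W_inner \<Omega> s (\<lambda>x. f x - f x) (\<lambda>x. f x - f x) = 0"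
    using W_inner_Cinf_cmult_left[of "\<lambda>x. 0" "\<lambda>x. 0" s 0] by simp
  then have "(\<lambda>m::nat. W_norm \<Omega> s (\<lambda>x. f x - f x)) \<longlonglongrightarrow> 0" by (simp add: W_norm_def)
  moreover have "f \<in> S_space s" using f Cinf_subset_S_space by blast
  ultimately show "f \<in> W \<Omega> s" using f by (auto simp: W_def S_space_def)
qed

lemma nsq_Cinf_diff:
  assumes "f \<in> Cinf \<Omega>" "g \<in> Cinf \<Omega>"
  shows "cinf.nsq s (\<lambda>x. f x + (- 1) * g x) =
    (\<Sum>\<alpha> | msize \<alpha> \<le> s. mcoeff \<alpha> * (LINT x|lebesgue_on \<Omega>. (cmod (foldr D (word \<alpha>) f x - foldr D (word \<alpha>) g x))\<^sup>2))"
proof -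
  have "W_inner \<Omega> s (\<lambda>x. f x - g x) (\<lambda>x. f x - g x) = family_ip \<Omega> {\<alpha>. msize \<alpha> \<le> s} mcoeff
      (\<lambda>\<alpha> x. foldr D (word \<alpha>) f x - foldr D (word \<alpha>) g x) (\<lambda>\<alpha> x. foldr D (word \<alpha>) f x - foldr D (word \<alpha>) g x)"
    by (intro W_inner_eq has_weak_deriv_diff has_weak_deriv_Cinf Cinf_L2 assms)
  then show ?thesis by (simp add: cinf.nsq_def family_ip_self)
qed

lemma W_norm_sq_diff:
  assumes "f \<in> Cinf \<Omega>" "\<theta> \<in> L2 \<Omega>" "\<And>\<alpha>. msize \<alpha> \<le> s \<Longrightarrow> has_weak_deriv \<Omega> \<alpha> \<theta> (G \<alpha>)"
  shows "W_norm \<Omega> s (\<lambda>x. f x - \<theta> x) =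
    sqrt (\<Sum>\<alpha> | msize \<alpha> \<le> s. mcoeff \<alpha> * (LINT x|lebesgue_on \<Omega>. (cmod (foldr D (word \<alpha>) f x - G \<alpha> x))\<^sup>2))"
proof -
  have "W_inner \<Omega> s (\<lambda>x. f x - \<theta> x) (\<lambda>x. f x - \<theta> x) = family_ip \<Omega> {\<alpha>. msize \<alpha> \<le> s} mcoeff
      (\<lambda>\<alpha> x. foldr D (word \<alpha>) f x - G \<alpha> x) (\<lambda>\<alpha> x. foldr D (word \<alpha>) f x - G \<alpha> x)"
    by (intro W_inner_eq has_weak_deriv_diff has_weak_deriv_Cinf Cinf_L2 assms)
  then show ?thesis by (simp add: W_norm_def family_ip_self)
qed

lemma L2_integral_mult_tendsto:
  assumes u: "\<And>m. u m \<in> L2 \<Omega>" and g: "g \<in> L2 \<Omega>" and h: "h \<in> Cinf \<Omega>"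
    and lim: "(\<lambda>m. LINT x|lebesgue_on \<Omega>. (cmod (u m x - g x))\<^sup>2) \<longlonglongrightarrow> 0"
  shows "(\<lambda>m. LINT x|lebesgue_on \<Omega>. u m x * h x) \<longlonglongrightarrow> (LINT x|lebesgue_on \<Omega>. g x * h x)"
proof -
  have h2: "h \<in> L2 \<Omega>" using h by (rule Cinf_L2)
  define K where "K = sqrt (LINT x|lebesgue_on \<Omega>. (cmod (h x))\<^sup>2)"
  have bd: "cmod ((LINT x|lebesgue_on \<Omega>. u m x * h x) - (LINT x|lebesgue_on \<Omega>. g x * h x))
      \<le> sqrt (LINT x|lebesgue_on \<Omega>. (cmod (u m x - g x))\<^sup>2) * K" for m
    using L2_cauchy_schwarz[OF L2_diff[OF u g] h2] L2_mult_integrable[OF u h2] L2_mult_integrable[OF g h2]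
    by (simp add: K_def left_diff_distrib)
  have lim0: "(\<lambda>m. sqrt (LINT x|lebesgue_on \<Omega>. (cmod (u m x - g x))\<^sup>2) * K) \<longlonglongrightarrow> 0"
    using tendsto_mult[OF tendsto_real_sqrt[OF lim] tendsto_const[of K]] by simp
  have "(\<lambda>m. (LINT x|lebesgue_on \<Omega>. u m x * h x) - (LINT x|lebesgue_on \<Omega>. g x * h x)) \<longlonglongrightarrow> 0"
    by (rule Lim_null_comparison[OF always_eventually lim0], rule allI, rule bd)
  then show ?thesis by (rule LIM_zero_cancel)
qed

text \<open>Weak differentiation is a closed operator: both sides of the defining identity are
  continuous in \<open>L2\<close> for a fixed test function.\<close>

lemma has_weak_deriv_limit:
  assumes u: "\<And>m. u m \<in> Cinf \<Omega>" and "\<theta> \<in> L2 \<Omega>" "g \<in> L2 \<Omega>"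
    and lim: "(\<lambda>m. LINT x|lebesgue_on \<Omega>. (cmod (u m x - \<theta> x))\<^sup>2) \<longlonglongrightarrow> 0"
    and limD: "(\<lambda>m. LINT x|lebesgue_on \<Omega>. (cmod (foldr D (word \<alpha>) (u m) x - g x))\<^sup>2) \<longlonglongrightarrow> 0"
  shows "has_weak_deriv \<Omega> \<alpha> \<theta> g"
  unfolding has_weak_deriv_def
proof (intro conjI ballI assms)
  fix \<phi> assume \<phi>: "\<phi> \<in> test_functions \<Omega>"
  have "(\<lambda>m. LINT x|lebesgue_on \<Omega>. u m x * mD \<alpha> \<phi> x) \<longlonglongrightarrow> (LINT x|lebesgue_on \<Omega>. \<theta> x * mD \<alpha> \<phi> x)"
    unfolding mD_eq_foldr_word
    by (intro L2_integral_mult_tendsto Cinf_L2 u assms(2) lim Cinf_foldr_D test_function_Cinf \<phi>)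
  moreover have "(\<lambda>m. LINT x|lebesgue_on \<Omega>. u m x * mD \<alpha> \<phi> x)
      = (\<lambda>m. (-1) ^ msize \<alpha> * (LINT x|lebesgue_on \<Omega>. foldr D (word \<alpha>) (u m) x * \<phi> x))"
    using has_weak_deriv_Cinf[OF u] \<phi> by (auto simp: has_weak_deriv_def)
  moreover have "(\<lambda>m. (-1) ^ msize \<alpha> * (LINT x|lebesgue_on \<Omega>. foldr D (word \<alpha>) (u m) x * \<phi> x))
      \<longlonglongrightarrow> (-1) ^ msize \<alpha> * (LINT x|lebesgue_on \<Omega>. g x * \<phi> x)"
    by (intro tendsto_mult tendsto_const L2_integral_mult_tendsto Cinf_L2 Cinf_foldr_D u assms(3) limD test_function_Cinf \<phi>)
  ultimately show "(LINT x|lebesgue_on \<Omega>. \<theta> x * mD \<alpha> \<phi> x) = (-1) ^ msize \<alpha> * (LINT x|lebesgue_on \<Omega>. g x * \<phi> x)"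
    by (simp only: LIMSEQ_unique)
qed

text \<open>All weights are positive, so each derivative up to order \<open>s\<close> is Cauchy in
  \<open>L2\<close> separately. The limit of the functions themselves has the other limits as its
  weak derivatives.\<close>

lemma W_complete:
  assumes u: "\<And>m::nat. u m \<in> Cinf \<Omega>"
    and Cauchy: "\<And>\<epsilon>. \<epsilon> > 0 \<Longrightarrow> \<exists>M. \<forall>m\<ge>M. \<forall>n\<ge>M. cinf.nsq s (\<lambda>x. u m x + (- 1) * u n x) < \<epsilon>"
  obtains \<theta> where "\<theta> \<in> W \<Omega> s" "(\<lambda>m. W_norm \<Omega> s (\<lambda>x. u m x - \<theta> x)) \<longlonglongrightarrow> 0"
proof -
  have int0: "0 \<le> (LINT x|lebesgue_on \<Omega>. (cmod (f x))\<^sup>2)" for f :: "'n cspace \<Rightarrow> complex"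
    by (intro integral_nonneg_AE) simp
  have "\<exists>g\<in>L2 \<Omega>. (\<lambda>m. LINT x|lebesgue_on \<Omega>. (cmod (foldr D (word \<alpha>) (u m) x - g x))\<^sup>2) \<longlonglongrightarrow> 0"
    if \<alpha>: "msize \<alpha> \<le> s" for \<alpha>
  proof -
    have C: "\<exists>M. \<forall>m\<ge>M. \<forall>n\<ge>M. (LINT x|lebesgue_on \<Omega>. (cmod (foldr D (word \<alpha>) (u m) x - foldr D (word \<alpha>) (u n) x))\<^sup>2) < \<epsilon>"
      if e: "\<epsilon> > 0" for \<epsilon>
    proof -
      obtain M where M: "\<And>m n. m \<ge> M \<Longrightarrow> n \<ge> M \<Longrightarrow> cinf.nsq s (\<lambda>x. u m x + (- 1) * u n x) < mcoeff \<alpha> * \<epsilon>"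
        using Cauchy[OF mult_pos_pos[OF mcoeff_pos[of \<alpha>] e]] by auto
      have "(LINT x|lebesgue_on \<Omega>. (cmod (foldr D (word \<alpha>) (u m) x - foldr D (word \<alpha>) (u n) x))\<^sup>2) < \<epsilon>"
        if "m \<ge> M" "n \<ge> M" for m n
      proof -
        let ?I = "\<lambda>\<alpha>. LINT x|lebesgue_on \<Omega>. (cmod (foldr D (word \<alpha>) (u m) x - foldr D (word \<alpha>) (u n) x))\<^sup>2"
        have "mcoeff \<alpha> * ?I \<alpha> \<le> (\<Sum>\<alpha> | msize \<alpha> \<le> s. mcoeff \<alpha> * ?I \<alpha>)"
          using \<alpha> int0 by (intro member_le_sum finite_multiindices) (auto intro!: mult_nonneg_nonneg)
        also have "\<dots> < mcoeff \<alpha> * \<epsilon>" using M[OF that] unfolding nsq_Cinf_diff[OF u u] .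
        finally show ?thesis using mcoeff_pos[of \<alpha>] by simp
      qed
      then show ?thesis by blast
    qed
    obtain g where "g \<in> L2 \<Omega>" "(\<lambda>m. LINT x|lebesgue_on \<Omega>. (cmod (foldr D (word \<alpha>) (u m) x - g x))\<^sup>2) \<longlonglongrightarrow> 0"
      by (rule L2_complete[OF lmeasurable_domain Cinf_L2[OF Cinf_foldr_D[OF u]] C]; (assumption | rule that))
    then show ?thesis by blast
  qed
  then have "\<forall>\<alpha>\<in>{\<alpha>. msize \<alpha> \<le> s}. \<exists>g. g \<in> L2 \<Omega> \<and>
      (\<lambda>m. LINT x|lebesgue_on \<Omega>. (cmod (foldr D (word \<alpha>) (u m) x - g x))\<^sup>2) \<longlonglongrightarrow> 0" by blast
  from bchoice[OF this] obtain G where "\<forall>\<alpha>\<in>{\<alpha>. msize \<alpha> \<le> s}. G \<alpha> \<in> L2 \<Omega> \<and>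
      (\<lambda>m. LINT x|lebesgue_on \<Omega>. (cmod (foldr D (word \<alpha>) (u m) x - G \<alpha> x))\<^sup>2) \<longlonglongrightarrow> 0" ..
  then have G: "\<And>\<alpha>. msize \<alpha> \<le> s \<Longrightarrow> G \<alpha> \<in> L2 \<Omega>"
    "\<And>\<alpha>. msize \<alpha> \<le> s \<Longrightarrow> (\<lambda>m. LINT x|lebesgue_on \<Omega>. (cmod (foldr D (word \<alpha>) (u m) x - G \<alpha> x))\<^sup>2) \<longlonglongrightarrow> 0"
    by auto
  \<comment> \<open>The zero multi-index has the empty word, so its limit is the limit of the
    sequence \<open>u\<close> itself.\<close>
  define \<theta> where "\<theta> = G (\<lambda>_. 0)"
  have z: "msize (\<lambda>_::'n + 'n. 0) = 0" by (simp add: msize_def)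
  have w0: "word (\<lambda>_::'n + 'n. 0) = []" using length_word[of "\<lambda>_::'n + 'n. 0"] z by simp
  have \<theta>: "\<theta> \<in> L2 \<Omega>" "(\<lambda>m. LINT x|lebesgue_on \<Omega>. (cmod (u m x - \<theta> x))\<^sup>2) \<longlonglongrightarrow> 0"
    using G[of "\<lambda>_. 0"] z w0 by (auto simp: \<theta>_def)
  have wd: "has_weak_deriv \<Omega> \<alpha> \<theta> (G \<alpha>)" if "msize \<alpha> \<le> s" for \<alpha>
    by (rule has_weak_deriv_limit[OF u \<theta>(1) G(1)[OF that] \<theta>(2) G(2)[OF that]])
  have eq: "W_norm \<Omega> s (\<lambda>x. u m x - \<theta> x) =
    sqrt (\<Sum>\<alpha> | msize \<alpha> \<le> s. mcoeff \<alpha> * (LINT x|lebesgue_on \<Omega>. (cmod (foldr D (word \<alpha>) (u m) x - G \<alpha> x))\<^sup>2))" for m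
    by (rule W_norm_sq_diff[OF u \<theta>(1)]) (rule wd)
  have "(\<lambda>m. W_norm \<Omega> s (\<lambda>x. u m x - \<theta> x)) \<longlonglongrightarrow> sqrt (\<Sum>\<alpha>\<in>{\<alpha> :: 'n multiindex. msize \<alpha> \<le> s}. mcoeff \<alpha> * 0)"
    unfolding eq by (intro tendsto_real_sqrt tendsto_sum tendsto_mult tendsto_const G(2)) simp
  then have lim: "(\<lambda>m. W_norm \<Omega> s (\<lambda>x. u m x - \<theta> x)) \<longlonglongrightarrow> 0" by simp
  moreover have "\<theta> \<in> W \<Omega> s" using \<theta>(1) wd u lim by (auto simp: W_def)
  ultimately show thesis using that by blast
qed

lemma W_inner_tendsto:
  assumes "\<And>m. u m \<in> S_space s" "f \<in> S_space s" "g \<in> S_space s"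
    "(\<lambda>m. W_norm \<Omega> s (\<lambda>x. u m x - f x)) \<longlonglongrightarrow> 0"
  shows "(\<lambda>m. W_inner \<Omega> s (u m) g) \<longlonglongrightarrow> W_inner \<Omega> s f g"
proof -
  have bd: "cmod (W_inner \<Omega> s (u m) g - W_inner \<Omega> s f g) \<le> W_norm \<Omega> s (\<lambda>x. u m x - f x) * W_norm \<Omega> s g" for m
    using W_cauchy_schwarz[OF S_space_diff[OF assms(1,2)] assms(3)] W_inner_diff_left[OF assms(1,2,3)] by simp
  have lim0: "(\<lambda>m. W_norm \<Omega> s (\<lambda>x. u m x - f x) * W_norm \<Omega> s g) \<longlonglongrightarrow> 0"
    using tendsto_mult[OF assms(4) tendsto_const[of "W_norm \<Omega> s g"]] by simp
  have "(\<lambda>m. W_inner \<Omega> s (u m) g - W_inner \<Omega> s f g) \<longlonglongrightarrow> 0"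
    by (rule Lim_null_comparison[OF always_eventually lim0], rule allI, rule bd)
  then show ?thesis by (rule LIM_zero_cancel)
qed

text \<open>The sequence from \<open>riesz_sequence\<close> consists of smooth functions and is
  Cauchy; its limit in \<open>W\<close> represents \<open>l\<close> by continuity of the product.
  Values of \<open>l\<close> outside \<open>Cinf\<close> are arbitrary, so the representation is
  restricted to smooth functions.\<close>

lemma W_riesz:
  assumes "\<And>f g. f \<in> Cinf \<Omega> \<Longrightarrow> g \<in> Cinf \<Omega> \<Longrightarrow> l (\<lambda>x. f x + g x) = l f + l g"
    and "\<And>c f. f \<in> Cinf \<Omega> \<Longrightarrow> l (\<lambda>x. c * f x) = c * l f"
    and "\<And>f. f \<in> Cinf \<Omega> \<Longrightarrow> cmod (l f) \<le> C * W_norm \<Omega> s f"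
  obtains \<theta> where "\<theta> \<in> W \<Omega> s" "\<And>f. f \<in> Cinf \<Omega> \<Longrightarrow> l f = W_inner \<Omega> s f \<theta>"
proof -
  have ne: "Cinf \<Omega> \<noteq> {}" using Cinf_const by blast
  obtain u where u: "\<And>m::nat. u m \<in> Cinf \<Omega>" "\<And>f. f \<in> Cinf \<Omega> \<Longrightarrow> (\<lambda>m. W_inner \<Omega> s f (u m)) \<longlonglongrightarrow> l f"
    "\<And>\<epsilon>. \<epsilon> > 0 \<Longrightarrow> \<exists>M. \<forall>m\<ge>M. \<forall>n\<ge>M. cinf.nsq s (\<lambda>x. u m x + (- 1) * u n x) < \<epsilon>"
    by (rule cinf.riesz_sequence[OF ne assms(1,2) assms(3)[folded cinf_nsq]]; (assumption | rule that))
  obtain \<theta> where \<theta>: "\<theta> \<in> W \<Omega> s" "(\<lambda>m. W_norm \<Omega> s (\<lambda>x. u m x - \<theta> x)) \<longlonglongrightarrow> 0"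
    using W_complete[OF u(1,3)] by blast
  have S: "u m \<in> S_space s" "\<theta> \<in> S_space s" for m
    using u(1) Cinf_subset_S_space \<theta>(1) W_subset_S_space by blast+
  have "l f = W_inner \<Omega> s f \<theta>" if f: "f \<in> Cinf \<Omega>" for f
  proof -
    have fS: "f \<in> S_space s" using f Cinf_subset_S_space by blast
    have "(\<lambda>m. cnj (W_inner \<Omega> s (u m) f)) \<longlonglongrightarrow> cnj (W_inner \<Omega> s \<theta> f)"
      by (intro tendsto_cnj W_inner_tendsto S fS \<theta>(2))
    then have "(\<lambda>m. W_inner \<Omega> s f (u m)) \<longlonglongrightarrow> W_inner \<Omega> s f \<theta>"
      by (simp add: W_inner_cnj S fS)
    then show ?thesis using u(2)[OF f] LIMSEQ_unique by blast
  qed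
  then show thesis using that \<theta>(1) by blast
qed

end

section \<open>Functionals of order \<open>s + 1\<close>\<close>

text \<open>The symbol of the derivative along the word \<open>u\<close>, evaluated at the gradient
  of \<open>R\<close>.\<close>

definition grad_word :: "('n::finite cspace \<Rightarrow> complex) \<Rightarrow> ('n + 'n) list \<Rightarrow> 'n cspace \<Rightarrow> complex" where
  "grad_word R u x = (\<Prod>k\<leftarrow>u. D k R x)"

lemma grad_word_simps [simp]: "grad_word R [] x = 1" "grad_word R (k # u) x = D k R x * grad_word R u x"
  by (simp_all add: grad_word_def)

lemma smooth_on_grad_word: "open U \<Longrightarrow> smooth_on U R \<Longrightarrow> smooth_on U (grad_word R u)"
proof (induction u)
  case Nil
  then show ?case using smooth_on_const[of U 1] by (simp add: grad_word_def[abs_def])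
next
  case (Cons k u)
  have "smooth_on U (\<lambda>x. D k R x * grad_word R u x)"
    using Cons by (intro smooth_on_mult smooth_on_D) auto
  then show ?case by (simp add: grad_word_def[abs_def])
qed

lemma finite_words_eq: "finite {w :: 'a::finite list. length w = m}"
  by (rule finite_subset[OF _ finite_words[of m]]) auto

lemma sum_words_Suc:
  "(\<Sum>v | length v = Suc m. X v) = (\<Sum>k\<in>UNIV. \<Sum>v | length v = m. X ((k :: 'a::finite) # v))"
proof -
  have "{v :: 'a list. length v = Suc m} = (\<lambda>(k, v). k # v) ` (UNIV \<times> {v. length v = m})"
    by (auto simp: length_Suc_conv image_iff)
  moreover have "inj_on (\<lambda>(k, v). k # v) (UNIV \<times> {v :: 'a list. length v = m})" by (auto simp: inj_on_def)
  ultimately have "(\<Sum>v | length v = Suc m. X v) = (\<Sum>(k, v)\<in>UNIV \<times> {v. length v = m}. X (k # v))"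
    by (simp add: sum.reindex case_prod_unfold comp_def)
  then show ?thesis by (simp add: sum.cartesian_product)
qed

text \<open>Expanding |grad R|^(2m) over words supplies, for every word \<open>v\<close>, a factor
  \<open>grad_word R v\<close> that can be traded in the exchange of words.\<close>

lemma sum_grad_word_sq: "(\<Sum>k\<in>UNIV. (D k R x)\<^sup>2) ^ m = (\<Sum>v | length v = m. (grad_word R v x)\<^sup>2)"
proof (induction m)
  case (Suc m)
  then show ?case
    by (simp add: sum_words_Suc sum_distrib_right sum_distrib_left power_mult_distrib) (rule sum.swap)
qed simp

text \<open>Nonvanishing is assumed on the closure only; by continuity it persists on a smaller
  neighbourhood.\<close>

lemma Cinf_inverse:
  assumes "f \<in> Cinf \<Omega>" "\<And>x. x \<in> closure \<Omega> \<Longrightarrow> f x \<noteq> 0"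
  shows "(\<lambda>x. inverse (f x)) \<in> Cinf \<Omega>"
proof -
  obtain U where U: "open U" "closure \<Omega> \<subseteq> U" "smooth_on U f" using Cinf_E[OF assms(1)] .
  have "openin (top_of_set U) (U \<inter> f -` (- {0}))"
    using smooth_on_continuous_on[OF U(3)] by (intro continuous_openin_preimage_gen) auto
  then have "open (U \<inter> f -` (- {0}))" using U(1) openin_open_trans by blast
  then show ?thesis
    using U assms(2) by (intro Cinf_I2[of "U \<inter> f -` (- {0})"] smooth_on_inverse smooth_on_subset[OF U(3)]) auto
qed

lemma D_of_real:
  assumes "smooth_on UNIV r"
  shows "D k (\<lambda>x. complex_of_real (r x)) x = of_real (D k r x)"
  by (rule D_bounded_linear[OF bounded_linear_of_real]) (rule smooth_on_differentiable[OF assms UNIV_I])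

context smooth_domain
begin

section \<open>Bounded functionals: low order, exchange of derivatives, localisation\<close>

definition W_bounded :: "nat \<Rightarrow> (('n cspace \<Rightarrow> complex) \<Rightarrow> complex) \<Rightarrow> bool" where
  "W_bounded s l \<longleftrightarrow> (\<exists>C. \<forall>f\<in>Cinf \<Omega>. cmod (l f) \<le> C * W_norm \<Omega> s f)"

lemma W_bounded_cong: "(\<And>f. f \<in> Cinf \<Omega> \<Longrightarrow> l f = l' f) \<Longrightarrow> W_bounded s l \<longleftrightarrow> W_bounded s l'"
  by (simp add: W_bounded_def)

lemma W_bounded_0: "W_bounded s (\<lambda>f. 0)"
  unfolding W_bounded_def by (rule exI[of _ 0]) simp

lemma W_bounded_add:
  assumes "W_bounded s l" "W_bounded s l'" shows "W_bounded s (\<lambda>f. l f + l' f)"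
proof -
  obtain C C' where "\<forall>f\<in>Cinf \<Omega>. cmod (l f) \<le> C * W_norm \<Omega> s f" "\<forall>f\<in>Cinf \<Omega>. cmod (l' f) \<le> C' * W_norm \<Omega> s f"
    using assms by (auto simp: W_bounded_def)
  then have "\<forall>f\<in>Cinf \<Omega>. cmod (l f + l' f) \<le> (C + C') * W_norm \<Omega> s f"
    by (auto simp: distrib_right intro!: norm_triangle_mono)
  then show ?thesis by (auto simp: W_bounded_def)
qed

lemma W_bounded_cmult:
  assumes "W_bounded s l" shows "W_bounded s (\<lambda>f. c * l f)"
proof -
  obtain C where "\<forall>f\<in>Cinf \<Omega>. cmod (l f) \<le> C * W_norm \<Omega> s f" using assms by (auto simp: W_bounded_def)
  then have "\<forall>f\<in>Cinf \<Omega>. cmod (c * l f) \<le> (cmod c * C) * W_norm \<Omega> s f"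
    by (auto simp: norm_mult mult.assoc intro!: mult_left_mono)
  then show ?thesis by (auto simp: W_bounded_def)
qed

lemma W_bounded_diff:
  assumes "W_bounded s l" "W_bounded s l'" shows "W_bounded s (\<lambda>f. l f - l' f)"
  using W_bounded_add[OF assms(1) W_bounded_cmult[OF assms(2), of "-1"]] by simp

lemma W_bounded_sum: "(\<And>i. i \<in> I \<Longrightarrow> W_bounded s (l i)) \<Longrightarrow> W_bounded s (\<lambda>f. \<Sum>i\<in>I. l i f)"
  by (induction I rule: infinite_finite_induct) (simp_all add: W_bounded_0 W_bounded_add)

lemma W_norm_ge_L2_norm:
  assumes "f \<in> Cinf \<Omega>" "length w \<le> s"
  shows "sqrt (LINT x|lebesgue_on \<Omega>. (cmod (foldr D w f x))\<^sup>2) \<le> W_norm \<Omega> s f"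
proof -
  have eq: "Re (W_inner \<Omega> s f f) = (\<Sum>w | length w \<le> s. LINT x|lebesgue_on \<Omega>. (cmod (foldr D w f x))\<^sup>2)"
    unfolding W_inner_Cinf[OF assms(1,1)] complex_norm_square[symmetric] integral_complex_of_real by simp
  have "(LINT x|lebesgue_on \<Omega>. (cmod (foldr D w f x))\<^sup>2) \<le> (\<Sum>w | length w \<le> s. LINT x|lebesgue_on \<Omega>. (cmod (foldr D w f x))\<^sup>2)"
    by (rule member_le_sum) (use assms(2) finite_words in auto)
  then show ?thesis unfolding W_norm_def eq by (rule real_sqrt_le_mono)
qed

lemma W_bounded_low_order:
  assumes "a \<in> Cinf \<Omega>" "length w \<le> s"
  shows "W_bounded s (\<lambda>f. LINT x|lebesgue_on \<Omega>. a x * foldr D w f x)"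
  unfolding W_bounded_def
proof (intro exI[of _ "sqrt (LINT x|lebesgue_on \<Omega>. (cmod (a x))\<^sup>2)"] ballI)
  fix f assume f: "f \<in> Cinf \<Omega>"
  have "cmod (LINT x|lebesgue_on \<Omega>. a x * foldr D w f x)
    \<le> sqrt (LINT x|lebesgue_on \<Omega>. (cmod (a x))\<^sup>2) * sqrt (LINT x|lebesgue_on \<Omega>. (cmod (foldr D w f x))\<^sup>2)"
    by (intro L2_cauchy_schwarz Cinf_L2 assms(1) Cinf_foldr_D f)
  also have "\<dots> \<le> sqrt (LINT x|lebesgue_on \<Omega>. (cmod (a x))\<^sup>2) * W_norm \<Omega> s f"
    by (intro mult_left_mono W_norm_ge_L2_norm f assms(2)) simp
  finally show "cmod (LINT x|lebesgue_on \<Omega>. a x * foldr D w f x)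
    \<le> sqrt (LINT x|lebesgue_on \<Omega>. (cmod (a x))\<^sup>2) * W_norm \<Omega> s f" .
qed

text \<open>A coefficient that is zero on the frontier lets one derivative be moved off
  \<open>f\<close> without boundary term, which lowers the order from \<open>s + 1\<close> to
  \<open>s\<close>.\<close>

lemma W_bounded_if_vanish:
  assumes "b \<in> Cinf \<Omega>" "\<And>x. x \<in> frontier \<Omega> \<Longrightarrow> b x = 0" "length u \<le> Suc s"
  shows "W_bounded s (\<lambda>f. LINT x|lebesgue_on \<Omega>. b x * foldr D u f x)"
proof (cases u)
  case Nil
  then show ?thesis using W_bounded_low_order[OF assms(1), of "[]" s] by simp
next
  case (Cons k w)
  have "(LINT x|lebesgue_on \<Omega>. b x * foldr D u f x) = (-1) * (LINT x|lebesgue_on \<Omega>. D k b x * foldr D w f x)"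
    if f: "f \<in> Cinf \<Omega>" for f
    using integral_by_parts[OF assms(1) Cinf_foldr_D[OF f], of w k] assms(2) Cons by simp
  then show ?thesis
    using W_bounded_cmult[OF W_bounded_low_order[OF Cinf_D[OF assms(1)], of w s], of "-1" k] Cons assms(3)
    by (subst W_bounded_cong) auto
qed

text \<open>On the support of \<open>b\<close> the function \<open>R\<close> is a defining function, so \<open>D i R * D j - D j R * D i\<close> is
  tangential. It equals \<open>D i (R * D j) - D j (R * D i)\<close>, whence no boundary term arises.\<close>

lemma W_bounded_tangential:
  assumes R: "smooth_on UNIV R" and b: "b \<in> Cinf \<Omega>" and S: "closed S" "S \<subseteq> B"
    and bS: "\<And>x. x \<notin> S \<Longrightarrow> b x = 0" and RB: "\<And>x. x \<in> frontier \<Omega> \<Longrightarrow> x \<in> B \<Longrightarrow> R x = 0"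
    and w: "length w \<le> s"
  shows "W_bounded s (\<lambda>f. (LINT x|lebesgue_on \<Omega>. b x * D i R x * D j (foldr D w f) x)
     - (LINT x|lebesgue_on \<Omega>. b x * D j R x * D i (foldr D w f) x))"
proof -
  have RC: "R \<in> Cinf \<Omega>" using R by (rule Cinf_I)
  have dR: "D k R \<in> Cinf \<Omega>" for k using RC by (rule Cinf_D)
  \<comment> \<open>With G = b F, the second derivatives of G cancel by symmetry; \<open>c\<close>
    collects the terms in which \<open>b\<close> is differentiated, and these have order at most
    \<open>s\<close> in \<open>f\<close>.\<close>
  define c where "c = (\<lambda>x. D j R x * D i b x - D i R x * D j b x)"
  have c: "c \<in> Cinf \<Omega>" unfolding c_def by (intro Cinf_diff Cinf_mult dR Cinf_D b)
  have "(LINT x|lebesgue_on \<Omega>. b x * D i R x * D j (foldr D w f) x)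
     - (LINT x|lebesgue_on \<Omega>. b x * D j R x * D i (foldr D w f) x)
     = (LINT x|lebesgue_on \<Omega>. c x * foldr D w f x)" if f: "f \<in> Cinf \<Omega>" for f
  proof -
    let ?F = "foldr D w f"
    have F: "?F \<in> Cinf \<Omega>" using f by (rule Cinf_foldr_D)
    define G where "G = (\<lambda>x. b x * ?F x)"
    have G: "G \<in> Cinf \<Omega>" unfolding G_def by (intro Cinf_mult b F)
    have G0: "D k G x = 0" if "x \<notin> S" for k x
    proof -
      have "D k G x = D k (\<lambda>x. 0) x"
        by (rule D_cong_open[of "- S"]) (use S(1) that bS in \<open>auto simp: G_def\<close>)
      then show ?thesis by simp
    qed
    have van: "R x * D k G x = 0" if "x \<in> frontier \<Omega>" for k x
      using G0[of x k] RB[OF that] S(2) by (cases "x \<in> S") auto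
    have zero: "(LINT x|lebesgue_on \<Omega>. D l (\<lambda>x. R x * D k G x) x) = 0" for k l
      by (rule integral_D_Cinf_eq_0[OF Cinf_mult[OF RC Cinf_D[OF G]] van])
    have prod: "D l (\<lambda>x. R x * D k G x) x = D l R x * D k G x + R x * D l (D k G) x" if "x \<in> \<Omega>" for k l x
      using domain_subset_closure[OF that] by (intro D_mult Cinf_differentiable[OF RC] Cinf_differentiable[OF Cinf_D[OF G]])
    have comm: "D i (D j G) x = D j (D i G) x" if "x \<in> \<Omega>" for x
      using Cinf_foldr_D_perm[OF G domain_subset_closure[OF that], of "[i, j]" "[j, i]"] by simp
    have DG: "D k G x = D k b x * ?F x + b x * D k ?F x" if "x \<in> \<Omega>" for k x
      unfolding G_def using domain_subset_closure[OF that] by (intro D_mult Cinf_differentiable[OF b] Cinf_differentiable[OF F])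
    have "0 = (LINT x|lebesgue_on \<Omega>. D i (\<lambda>x. R x * D j G x) x) - (LINT x|lebesgue_on \<Omega>. D j (\<lambda>x. R x * D i G x) x)"
      by (simp add: zero)
    also have "\<dots> = (LINT x|lebesgue_on \<Omega>. D i (\<lambda>x. R x * D j G x) x - D j (\<lambda>x. R x * D i G x) x)"
      by (intro Bochner_Integration.integral_diff[symmetric] Cinf_integrable Cinf_D Cinf_mult RC G)
    also have "\<dots> = (LINT x|lebesgue_on \<Omega>. (b x * D i R x * D j ?F x - b x * D j R x * D i ?F x) - c x * ?F x)"
    proof (intro Bochner_Integration.integral_cong refl)
      fix x assume "x \<in> space (lebesgue_on \<Omega>)"
      then have x: "x \<in> \<Omega>" by simp
      show "D i (\<lambda>x. R x * D j G x) x - D j (\<lambda>x. R x * D i G x) x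
        = (b x * D i R x * D j ?F x - b x * D j R x * D i ?F x) - c x * ?F x"
        unfolding prod[OF x] comm[OF x] DG[OF x] c_def by (simp add: algebra_simps)
    qed
    also have "\<dots> = (LINT x|lebesgue_on \<Omega>. b x * D i R x * D j ?F x) - (LINT x|lebesgue_on \<Omega>. b x * D j R x * D i ?F x)
       - (LINT x|lebesgue_on \<Omega>. c x * ?F x)"
      by (subst Bochner_Integration.integral_diff, (intro Cinf_integrable Cinf_diff Cinf_mult b dR Cinf_D c F)+)
         (subst Bochner_Integration.integral_diff, (intro Cinf_integrable Cinf_diff Cinf_mult b dR Cinf_D c F)+, rule refl)
    finally show ?thesis by simp
  qed
  then show ?thesis using W_bounded_low_order[OF c w] by (subst W_bounded_cong) auto
qed

text \<open>Modulo bounded functionals, \<open>grad_word R v\<close> times the derivative along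
  \<open>u\<close> may be exchanged for \<open>grad_word R u\<close> times the derivative along
  \<open>v\<close>. One pair of letters is handled at a time: \<open>W_bounded_tangential\<close>
  replaces \<open>D j R * D i\<close> by \<open>D i R * D j\<close>, after which
  \<open>D i R\<close> joins the coefficient and \<open>j\<close> the passive word
  \<open>w\<close>.\<close>

lemma W_bounded_swap_words:
  assumes R: "smooth_on UNIV R" and S: "closed S" "S \<subseteq> B"
    and RB: "\<And>x. x \<in> frontier \<Omega> \<Longrightarrow> x \<in> B \<Longrightarrow> R x = 0"
    and "length u = length v"
  shows "b \<in> Cinf \<Omega> \<Longrightarrow> (\<And>x. x \<notin> S \<Longrightarrow> b x = 0) \<Longrightarrow> length u + length w \<le> Suc s \<Longrightarrow>
    W_bounded s (\<lambda>f. (LINT x|lebesgue_on \<Omega>. b x * grad_word R v x * foldr D (u @ w) f x)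
      - (LINT x|lebesgue_on \<Omega>. b x * grad_word R u x * foldr D (v @ w) f x))"
  using assms(5)
proof (induction u v arbitrary: w b rule: list_induct2)
  case Nil
  then show ?case by (simp add: W_bounded_0)
next
  case (Cons i u j v)
  have gC: "grad_word R z \<in> Cinf \<Omega>" for z by (intro Cinf_I smooth_on_grad_word R open_UNIV)
  have dC: "D k R \<in> Cinf \<Omega>" for k by (intro Cinf_D Cinf_I R)
  have perm: "foldr D (k # z @ w) f x = foldr D (z @ k # w) f x" if "f \<in> Cinf \<Omega>" "x \<in> \<Omega>" for f x k z
    by (rule Cinf_foldr_D_perm[OF that(1) domain_subset_closure[OF that(2)]]) simp
  let ?T1 = "\<lambda>f. LINT x|lebesgue_on \<Omega>. b x * grad_word R (j # v) x * foldr D ((i # u) @ w) f x"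
  let ?T2 = "\<lambda>f. LINT x|lebesgue_on \<Omega>. (b x * grad_word R v x) * D i R x * D j (foldr D (u @ w) f) x"
  let ?T3 = "\<lambda>f. LINT x|lebesgue_on \<Omega>. b x * grad_word R (i # u) x * foldr D ((j # v) @ w) f x"
  have A: "W_bounded s (\<lambda>f. (LINT x|lebesgue_on \<Omega>. (b x * grad_word R v x) * D j R x * D i (foldr D (u @ w) f) x) - ?T2 f)"
    by (rule W_bounded_tangential[OF R Cinf_mult[OF Cons.prems(1) gC] S _ RB]) (use Cons.prems in auto)
  have "W_bounded s (\<lambda>f. (LINT x|lebesgue_on \<Omega>. (b x * D i R x) * grad_word R v x * foldr D (u @ j # w) f x)
      - (LINT x|lebesgue_on \<Omega>. (b x * D i R x) * grad_word R u x * foldr D (v @ j # w) f x))"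
    by (rule Cons.IH[OF Cinf_mult[OF Cons.prems(1) dC]]) (use Cons.prems in auto)
  from W_bounded_add[OF A this]
  show ?case
  proof (rule W_bounded_cong[THEN iffD1, rotated])
    fix f assume f: "f \<in> Cinf \<Omega>"
    have e1: "(LINT x|lebesgue_on \<Omega>. (b x * grad_word R v x) * D j R x * D i (foldr D (u @ w) f) x) = ?T1 f"
      by (intro Bochner_Integration.integral_cong) auto
    have e2: "(LINT x|lebesgue_on \<Omega>. (b x * D i R x) * grad_word R v x * foldr D (u @ j # w) f x) = ?T2 f"
      using perm[OF f, of _ j u] by (intro Bochner_Integration.integral_cong) auto
    have e3: "(LINT x|lebesgue_on \<Omega>. (b x * D i R x) * grad_word R u x * foldr D (v @ j # w) f x) = ?T3 f"
      using perm[OF f, of _ j v] by (intro Bochner_Integration.integral_cong) auto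
    show "(LINT x|lebesgue_on \<Omega>. (b x * grad_word R v x) * D j R x * D i (foldr D (u @ w) f) x) - ?T2 f
      + ((LINT x|lebesgue_on \<Omega>. (b x * D i R x) * grad_word R v x * foldr D (u @ j # w) f x)
      - (LINT x|lebesgue_on \<Omega>. (b x * D i R x) * grad_word R u x * foldr D (v @ j # w) f x)) = ?T1 f - ?T3 f"
      unfolding e1 e2 e3 by simp
  qed
qed

text \<open>The factor |grad R|^(2s+2) is expanded over words \<open>v\<close>. Each term with
  coefficient a_u R_v R_v and derivative D_u is exchanged for a_u R_v R_u with derivative D_v, where
  R_v abbreviates \<open>grad_word R v\<close>. Summation over \<open>u\<close> then produces the
  symbol, which vanishes on the part of the frontier that the support of \<open>b\<close>
  meets.\<close>

lemma W_bounded_local: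
  assumes R: "smooth_on UNIV R" and S: "closed S" "S \<subseteq> B"
    and RB: "\<And>x. x \<in> frontier \<Omega> \<Longrightarrow> x \<in> B \<Longrightarrow> R x = 0"
    and b: "b \<in> Cinf \<Omega>" "\<And>x. x \<notin> S \<Longrightarrow> b x = 0" and a: "\<And>u. a u \<in> Cinf \<Omega>"
    and P: "\<And>x. x \<in> frontier \<Omega> \<Longrightarrow> x \<in> B \<Longrightarrow> (\<Sum>u | length u = Suc s. a u x * grad_word R u x) = 0"
  shows "W_bounded s (\<lambda>f. \<Sum>u | length u = Suc s.
     LINT x|lebesgue_on \<Omega>. (b x * (\<Sum>k\<in>UNIV. (D k R x)\<^sup>2) ^ Suc s) * a u x * foldr D u f x)"
proof -
  let ?N = "{u :: ('n + 'n) list. length u = Suc s}"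
  have gC: "grad_word R z \<in> Cinf \<Omega>" for z by (intro Cinf_I smooth_on_grad_word R open_UNIV)
  define P where "P = (\<lambda>x. \<Sum>u\<in>?N. a u x * grad_word R u x)"
  have PC: "P \<in> Cinf \<Omega>" unfolding P_def by (intro Cinf_sum Cinf_mult a gC)
  have "W_bounded s (\<lambda>f. LINT x|lebesgue_on \<Omega>. (b x * grad_word R v x * P x) * foldr D v f x)" if "v \<in> ?N" for v
  proof (rule W_bounded_if_vanish[OF Cinf_mult[OF Cinf_mult[OF b(1) gC] PC]])
    show "b x * grad_word R v x * P x = 0" if "x \<in> frontier \<Omega>" for x
      using assms(8)[OF that] b(2)[of x] S(2) by (cases "x \<in> S") (auto simp: P_def)
  qed (use that in simp)
  then have A: "W_bounded s (\<lambda>f. \<Sum>v\<in>?N. LINT x|lebesgue_on \<Omega>. (b x * grad_word R v x * P x) * foldr D v f x)"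
    by (rule W_bounded_sum)
  have B: "W_bounded s (\<lambda>f. \<Sum>u\<in>?N. \<Sum>v\<in>?N.
      (LINT x|lebesgue_on \<Omega>. (b x * a u x * grad_word R v x) * grad_word R v x * foldr D (u @ []) f x)
      - (LINT x|lebesgue_on \<Omega>. (b x * a u x * grad_word R v x) * grad_word R u x * foldr D (v @ []) f x))"
    by (intro W_bounded_sum W_bounded_swap_words[OF R S RB] Cinf_mult b(1) a gC) (auto simp: b(2))
  from W_bounded_add[OF A B] show ?thesis
  proof (rule W_bounded_cong[THEN iffD1, rotated])
    fix f assume f: "f \<in> Cinf \<Omega>"
    have fC: "foldr D v f \<in> Cinf \<Omega>" for v using f by (rule Cinf_foldr_D)
    have int: "integrable (lebesgue_on \<Omega>) (\<lambda>x. (b x * a u x * grad_word R v x) * grad_word R z x * foldr D y f x)" for u v z y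
      by (intro Cinf_integrable Cinf_mult b(1) a gC fC)
    have e1: "(LINT x|lebesgue_on \<Omega>. (b x * grad_word R v x * P x) * foldr D v f x)
      = (\<Sum>u\<in>?N. LINT x|lebesgue_on \<Omega>. (b x * a u x * grad_word R v x) * grad_word R u x * foldr D v f x)" for v
      unfolding Bochner_Integration.integral_sum[OF int, symmetric]
      by (intro Bochner_Integration.integral_cong) (auto simp: P_def sum_distrib_left sum_distrib_right mult_ac)
    have e2: "(LINT x|lebesgue_on \<Omega>. (b x * (\<Sum>k\<in>UNIV. (D k R x)\<^sup>2) ^ Suc s) * a u x * foldr D u f x)
      = (\<Sum>v\<in>?N. LINT x|lebesgue_on \<Omega>. (b x * a u x * grad_word R v x) * grad_word R v x * foldr D u f x)" for u
      unfolding Bochner_Integration.integral_sum[OF int, symmetric] sum_grad_word_sq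
      by (intro Bochner_Integration.integral_cong) (auto simp: sum_distrib_left sum_distrib_right power2_eq_square mult_ac)
    show "(\<Sum>v\<in>?N. LINT x|lebesgue_on \<Omega>. (b x * grad_word R v x * P x) * foldr D v f x) +
      (\<Sum>u\<in>?N. \<Sum>v\<in>?N.
      (LINT x|lebesgue_on \<Omega>. (b x * a u x * grad_word R v x) * grad_word R v x * foldr D (u @ []) f x)
      - (LINT x|lebesgue_on \<Omega>. (b x * a u x * grad_word R v x) * grad_word R u x * foldr D (v @ []) f x))
      = (\<Sum>u\<in>?N. LINT x|lebesgue_on \<Omega>. (b x * (\<Sum>k\<in>UNIV. (D k R x)\<^sup>2) ^ Suc s) * a u x * foldr D u f x)"
      unfolding e1 e2 append_Nil2 sum_subtractf by (subst (2) sum.swap) simp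
  qed
qed

text \<open>The field \<open>\<nu>\<close> plays the role of the normal: it is proportional to the gradient of every local
  defining function.\<close>

definition normal_like :: "('n + 'n \<Rightarrow> 'n cspace \<Rightarrow> real) \<Rightarrow> bool" where
  "normal_like \<nu> \<longleftrightarrow> (\<forall>(r :: 'n cspace \<Rightarrow> real) B x. open B \<longrightarrow> x \<in> B \<longrightarrow> x \<in> frontier \<Omega> \<longrightarrow> smooth_on UNIV r \<longrightarrow>
     (\<forall>y\<in>B. (y \<in> \<Omega> \<longleftrightarrow> r y < 0) \<and> (y \<in> frontier \<Omega> \<longleftrightarrow> r y = 0)) \<longrightarrow> (\<exists>k. D k r x \<noteq> 0) \<longrightarrow>
     (\<exists>c. c \<noteq> 0 \<and> (\<forall>k. D k r x = c * \<nu> k x)))"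

text \<open>The principal symbol of the operator of order \<open>m\<close> with coefficients
  \<open>a\<close>, evaluated at the covector \<open>\<nu>\<close>.\<close>

definition symbol :: "('n + 'n \<Rightarrow> 'n cspace \<Rightarrow> real) \<Rightarrow> nat \<Rightarrow> (('n + 'n) list \<Rightarrow> 'n cspace \<Rightarrow> complex) \<Rightarrow> 'n cspace \<Rightarrow> complex" where
  "symbol \<nu> m a x = (\<Sum>u | length u = m. a u x * (\<Prod>k\<leftarrow>u. of_real (\<nu> k x)))"

text \<open>The symbol is homogeneous of degree \<open>m\<close>, so passing from
  \<open>\<nu>\<close> to the gradient of a defining function multiplies it by the m-th power of a
  nonzero scalar.\<close>

lemma normal_like_symbol:
  assumes "normal_like \<nu>" "open B" "x \<in> B" "x \<in> frontier \<Omega>" "smooth_on UNIV r"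
    "\<And>y. y \<in> B \<Longrightarrow> y \<in> \<Omega> \<longleftrightarrow> r y < 0" "\<And>y. y \<in> B \<Longrightarrow> y \<in> frontier \<Omega> \<longleftrightarrow> r y = 0" "D k r x \<noteq> 0"
  shows "(\<Sum>u | length u = m. a u x * grad_word (\<lambda>x. complex_of_real (r x)) u x) = 0 \<longleftrightarrow> symbol \<nu> m a x = 0"
proof -
  obtain c where c: "c \<noteq> 0" "\<And>k. D k r x = c * \<nu> k x"
    using assms unfolding normal_like_def by blast
  have "grad_word (\<lambda>x. complex_of_real (r x)) u x = of_real c ^ length u * (\<Prod>k\<leftarrow>u. of_real (\<nu> k x))" for u
    by (induction u) (simp_all add: D_of_real[OF assms(5)] c(2) mult_ac)
  then have "(\<Sum>u | length u = m. a u x * grad_word (\<lambda>x. complex_of_real (r x)) u x) = of_real c ^ m * symbol \<nu> m a x"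
    unfolding symbol_def sum_distrib_left by (intro sum.cong) auto
  then show ?thesis using c(1) by simp
qed

text \<open>Every point of the compact closure has a smooth weight \<open>\<eta>\<close> \<ge> 0,
  positive at that point, such that multiplying the coefficients by \<open>\<eta>\<close> gives a
  bounded functional. At frontier points the weight contains the factor |grad r|^(2s+2) demanded by
  \<open>W_bounded_local\<close>; at interior points it vanishes on the frontier. Finitely many
  weights have a positive sum, and dividing the coefficients by it, which keeps the symbol zero,
  plays the part of a partition of unity.\<close>

lemma W_bounded_if_symbol_vanishes:
  assumes \<nu>: "normal_like \<nu>" and a: "\<And>u. a u \<in> Cinf \<Omega>"
    and sym: "\<And>x. x \<in> frontier \<Omega> \<Longrightarrow> symbol \<nu> (Suc s) a x = 0"
  shows "W_bounded s (\<lambda>f. \<Sum>u | length u = Suc s. LINT x|lebesgue_on \<Omega>. a u x * foldr D u f x)"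
proof -
  let ?N = "{u :: ('n + 'n) list. length u = Suc s}"
  let ?good = "\<lambda>\<eta> :: 'n cspace \<Rightarrow> real. smooth_on UNIV \<eta> \<and> (\<forall>x. \<eta> x \<ge> 0) \<and>
     (\<forall>a. (\<forall>u. a u \<in> Cinf \<Omega>) \<longrightarrow> (\<forall>x\<in>frontier \<Omega>. symbol \<nu> (Suc s) a x = 0) \<longrightarrow>
       W_bounded s (\<lambda>f. \<Sum>u\<in>?N. LINT x|lebesgue_on \<Omega>. (of_real (\<eta> x) * a u x) * foldr D u f x))"
  have "\<exists>\<eta>. ?good \<eta> \<and> \<eta> p > 0" if p: "p \<in> closure \<Omega>" for p
  proof (cases "p \<in> frontier \<Omega>")
    case False
    then have "p \<in> \<Omega>" using p open_domain by (simp add: frontier_def interior_open)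
    then obtain e where e: "e > 0" "cball p e \<subseteq> \<Omega>" using open_domain open_contains_cball by blast
    have "W_bounded s (\<lambda>f. \<Sum>u\<in>?N. LINT x|lebesgue_on \<Omega>. (of_real (ball_bump p e x) * a u x) * foldr D u f x)"
      if "\<And>u. a u \<in> Cinf \<Omega>" for a :: "('n + 'n) list \<Rightarrow> _"
    proof (intro W_bounded_sum W_bounded_if_vanish Cinf_mult that Cinf_I smooth_on_of_real smooth_on_ball_bump open_UNIV)
      fix x u assume "x \<in> frontier \<Omega>"
      then have "x \<notin> ball p e" using e(2) open_domain by (auto simp: frontier_def interior_open subset_iff)
      then show "of_real (ball_bump p e x) * a u x = 0" using e(1) by (simp add: ball_bump_eq_0_iff)
    qed simp
    then show ?thesis using e by (intro exI[of _ "ball_bump p e"]) (simp add: smooth_on_ball_bump ball_bump_pos_iff)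
  next
    case True
    obtain \<delta> \<sigma> :: real and r :: "'n cspace \<Rightarrow> real" and k
      where r: "\<delta> > 0" "\<bar>\<sigma>\<bar> = 1" "smooth_on UNIV r" "\<And>x. x \<in> ball p \<delta> \<Longrightarrow> x \<in> \<Omega> \<longleftrightarrow> r x < 0"
      "\<And>x. x \<in> ball p \<delta> \<Longrightarrow> x \<in> frontier \<Omega> \<longleftrightarrow> r x = 0" "\<And>x. x \<in> ball p \<delta> \<Longrightarrow> \<sigma> * D k r x > 0"
      using frontier_local_defining[OF smooth_domain True] by metis
    have Dk: "D k r x \<noteq> 0" if "x \<in> ball p \<delta>" for x using r(6)[OF that] by auto
    define R where "R = (\<lambda>x. complex_of_real (r x))"
    have R: "smooth_on UNIV R" unfolding R_def by (intro smooth_on_of_real r(3) open_UNIV)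
    define q where "q = (\<lambda>x. (\<Sum>k\<in>UNIV. (D k r x)\<^sup>2) ^ Suc s)"
    define \<eta> where "\<eta> = (\<lambda>x. ball_bump p (\<delta>/2) x * q x)"
    have q: "complex_of_real (q x) = (\<Sum>k\<in>UNIV. (D k R x)\<^sup>2) ^ Suc s" for x
      unfolding q_def R_def D_of_real[OF r(3)] by simp
    have "smooth_on UNIV (\<lambda>x. \<Sum>k\<in>UNIV. (D k r x)\<^sup>2)"
      unfolding power2_eq_square by (intro smooth_on_sum smooth_on_mult smooth_on_D r(3) open_UNIV)
    then have "smooth_on UNIV (\<lambda>x. (\<Sum>k\<in>UNIV. (D k r x)\<^sup>2) ^ m)" for m
      by (induction m) (simp_all add: smooth_on_mult)
    then have smooth: "smooth_on UNIV \<eta>"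
      unfolding \<eta>_def q_def by (intro smooth_on_mult smooth_on_ball_bump open_UNIV)
    have q0: "q x \<ge> 0" for x unfolding q_def by (simp add: sum_nonneg)
    have pin: "p \<in> ball p \<delta>" using r(1) by simp
    have "(\<Sum>k\<in>UNIV. (D k r p)\<^sup>2) > 0"
      using Dk[OF pin] by (intro sum_pos2[of _ k]) auto
    then have pos: "\<eta> p > 0" using r(1) by (simp add: \<eta>_def q_def ball_bump_pos_iff)
    have "W_bounded s (\<lambda>f. \<Sum>u\<in>?N. LINT x|lebesgue_on \<Omega>. (of_real (\<eta> x) * a u x) * foldr D u f x)"
      if "\<And>u. a u \<in> Cinf \<Omega>" "\<And>x. x \<in> frontier \<Omega> \<Longrightarrow> symbol \<nu> (Suc s) a x = 0" for a
    proof -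
      have "W_bounded s (\<lambda>f. \<Sum>u\<in>?N.
        LINT x|lebesgue_on \<Omega>. (of_real (ball_bump p (\<delta>/2) x) * (\<Sum>k\<in>UNIV. (D k R x)\<^sup>2) ^ Suc s) * a u x * foldr D u f x)"
      proof (rule W_bounded_local[OF R, of "cball p (\<delta>/2)" "ball p \<delta>"])
        show "R x = 0" if "x \<in> frontier \<Omega>" "x \<in> ball p \<delta>" for x using r(5) that by (simp add: R_def)
        show "(\<lambda>x. complex_of_real (ball_bump p (\<delta>/2) x)) \<in> Cinf \<Omega>"
          by (intro Cinf_I smooth_on_of_real smooth_on_ball_bump open_UNIV)
        show "complex_of_real (ball_bump p (\<delta>/2) x) = 0" if "x \<notin> cball p (\<delta>/2)" for x
          using that r(1) by (simp add: ball_bump_eq_0_iff)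
        show "(\<Sum>u\<in>?N. a u x * grad_word R u x) = 0" if "x \<in> frontier \<Omega>" "x \<in> ball p \<delta>" for x
          unfolding R_def using normal_like_symbol[OF \<nu> open_ball that(2,1) r(3,4,5) Dk[OF that(2)]]
            \<open>\<And>x. x \<in> frontier \<Omega> \<Longrightarrow> symbol \<nu> (Suc s) a x = 0\<close>[OF that(1)] by blast
      qed (use r(1) that in auto)
      then show ?thesis by (simp add: \<eta>_def q)
    qed
    then show ?thesis using smooth pos q0 by (intro exI[of _ \<eta>]) (auto simp: \<eta>_def)
  qed
  then have "\<forall>p\<in>closure \<Omega>. \<exists>\<eta>. ?good \<eta> \<and> \<eta> p > 0" by blast
  from bchoice[OF this] obtain \<eta> where "\<forall>p\<in>closure \<Omega>. ?good (\<eta> p) \<and> \<eta> p p > 0" ..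
  then have \<eta>: "\<And>p. p \<in> closure \<Omega> \<Longrightarrow> ?good (\<eta> p) \<and> \<eta> p p > 0" by blast
  have "compact (closure \<Omega>)" using bounded_domain by (simp add: compact_closure)
  moreover have "open {x. \<eta> p x > 0}" if "p \<in> closure \<Omega>" for p
    using \<eta>[OF that] smooth_on_continuous_on[of UNIV "\<eta> p"] by (intro open_Collect_less continuous_on_const) auto
  moreover have "closure \<Omega> \<subseteq> (\<Union>p\<in>closure \<Omega>. {x. \<eta> p x > 0})" using \<eta> by auto
  ultimately obtain F where F: "F \<subseteq> closure \<Omega>" "finite F" "closure \<Omega> \<subseteq> (\<Union>p\<in>F. {x. \<eta> p x > 0})"
    using compactE_image[of "closure \<Omega>" "closure \<Omega>" "\<lambda>p. {x. \<eta> p x > 0}"] by blast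
  define \<Sigma> where "\<Sigma> = (\<lambda>x. \<Sum>p\<in>F. complex_of_real (\<eta> p x))"
  have \<eta>C: "(\<lambda>x. complex_of_real (\<eta> p x)) \<in> Cinf \<Omega>" if "p \<in> F" for p
    using \<eta> F(1) that by (intro Cinf_I smooth_on_of_real open_UNIV) auto
  have \<Sigma>C: "\<Sigma> \<in> Cinf \<Omega>" unfolding \<Sigma>_def by (intro Cinf_sum \<eta>C)
  have \<Sigma>0: "\<Sigma> x \<noteq> 0" if x: "x \<in> closure \<Omega>" for x
  proof -
    obtain p where "p \<in> F" "\<eta> p x > 0" using F(3) x by blast
    then have "(\<Sum>p\<in>F. \<eta> p x) > 0" using F \<eta> by (intro sum_pos2[of F p]) auto
    then show ?thesis by (simp add: \<Sigma>_def flip: of_real_sum)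
  qed
  define a' where "a' = (\<lambda>u x. a u x * inverse (\<Sigma> x))"
  have a'C: "a' u \<in> Cinf \<Omega>" for u unfolding a'_def by (intro Cinf_mult a Cinf_inverse \<Sigma>C \<Sigma>0)
  have sym': "symbol \<nu> (Suc s) a' x = 0" if "x \<in> frontier \<Omega>" for x
  proof -
    have "symbol \<nu> (Suc s) a' x = inverse (\<Sigma> x) * symbol \<nu> (Suc s) a x"
      by (simp add: symbol_def a'_def sum_distrib_left mult_ac)
    then show ?thesis using sym[OF that] by simp
  qed
  have "W_bounded s (\<lambda>f. \<Sum>p\<in>F. \<Sum>u\<in>?N. LINT x|lebesgue_on \<Omega>. (of_real (\<eta> p x) * a' u x) * foldr D u f x)"
  proof (rule W_bounded_sum)
    fix p assume "p \<in> F"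
    then have "?good (\<eta> p)" using \<eta> F(1) by blast
    then show "W_bounded s (\<lambda>f. \<Sum>u\<in>?N. LINT x|lebesgue_on \<Omega>. (of_real (\<eta> p x) * a' u x) * foldr D u f x)"
      using a'C sym' by simp
  qed
  then show ?thesis
  proof (rule W_bounded_cong[THEN iffD1, rotated])
    fix f assume f: "f \<in> Cinf \<Omega>"
    have int: "integrable (lebesgue_on \<Omega>) (\<lambda>x. (of_real (\<eta> p x) * a' u x) * foldr D u f x)" if "p \<in> F" for p u
      by (intro Cinf_integrable Cinf_mult \<eta>C that a'C Cinf_foldr_D f)
    have "(\<Sum>p\<in>F. LINT x|lebesgue_on \<Omega>. (of_real (\<eta> p x) * a' u x) * foldr D u f x)
      = (LINT x|lebesgue_on \<Omega>. a u x * foldr D u f x)" for u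
    proof -
      have "(\<Sum>p\<in>F. of_real (\<eta> p x) * a' u x * foldr D u f x) = a u x * foldr D u f x" if "x \<in> \<Omega>" for x
      proof -
        have "(\<Sum>p\<in>F. of_real (\<eta> p x) * a' u x * foldr D u f x) = \<Sigma> x * a' u x * foldr D u f x"
          by (simp add: \<Sigma>_def sum_distrib_right)
        then show ?thesis using \<Sigma>0[OF domain_subset_closure[OF that]] by (simp add: a'_def)
      qed
      then have "(LINT x|lebesgue_on \<Omega>. (\<Sum>p\<in>F. of_real (\<eta> p x) * a' u x * foldr D u f x))
        = (LINT x|lebesgue_on \<Omega>. a u x * foldr D u f x)"
        by (intro Bochner_Integration.integral_cong) auto
      moreover have "(\<Sum>p\<in>F. LINT x|lebesgue_on \<Omega>. of_real (\<eta> p x) * a' u x * foldr D u f x)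
        = (LINT x|lebesgue_on \<Omega>. (\<Sum>p\<in>F. of_real (\<eta> p x) * a' u x * foldr D u f x))"
        by (rule Bochner_Integration.integral_sum[symmetric]) (rule int)
      ultimately show ?thesis by simp
    qed
    then show "(\<Sum>p\<in>F. \<Sum>u\<in>?N. LINT x|lebesgue_on \<Omega>. (of_real (\<eta> p x) * a' u x) * foldr D u f x)
      = (\<Sum>u\<in>?N. LINT x|lebesgue_on \<Omega>. a u x * foldr D u f x)"
      by (subst sum.swap) simp
  qed
qed

end

section \<open>Concentration at the frontier\<close>

lemma D_exp:
  assumes "smooth_on UNIV r"
  shows "D i (\<lambda>x. complex_of_real (exp (t * r x))) x = of_real (t * exp (t * r x) * D i r x)"
proof -
  have d: "r differentiable (at x)" using smooth_on_differentiable[OF assms UNIV_I] .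
  have h: "((\<lambda>y. exp (t * y)) has_real_derivative t * exp (t * r x)) (at (r x))"
    by (auto intro!: derivative_eq_intros)
  show ?thesis
    using D_bounded_linear[OF bounded_linear_of_real differentiable_compose_real[OF h d], of i] D_compose_real[OF h d, of i]
    by simp
qed

lemma smooth_on_exp_complex: "smooth_on UNIV r \<Longrightarrow> smooth_on UNIV (\<lambda>x. complex_of_real (exp (t * r x)))"
  by (intro smooth_on_of_real smooth_on_exp smooth_on_cmult open_UNIV)

text \<open>Derivatives of \<open>exp (t * r) * \<theta>\<close> are \<open>exp (t * r)\<close> times a polynomial in \<open>t\<close> whose leading
  coefficient comes from differentiating the exponential only.\<close>

lemma foldr_D_exp_mult:
  fixes r :: "'n::finite cspace \<Rightarrow> real" and \<theta> :: "'n cspace \<Rightarrow> complex"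
  assumes r: "smooth_on UNIV r" and \<theta>: "smooth_on UNIV \<theta>" "closed S" "\<And>x. x \<notin> S \<Longrightarrow> \<theta> x = 0"
  shows "\<exists>Q. (\<forall>k. smooth_on UNIV (Q k)) \<and> (\<forall>k x. x \<notin> S \<longrightarrow> Q k x = 0) \<and> (\<forall>k>length u. Q k = (\<lambda>x. 0)) \<and>
    Q (length u) = (\<lambda>x. grad_word (\<lambda>x. complex_of_real (r x)) u x * \<theta> x) \<and>
    (\<forall>t. foldr D u (\<lambda>x. of_real (exp (t * r x)) * \<theta> x) =
      (\<lambda>x. of_real (exp (t * r x)) * (\<Sum>k\<le>length u. of_real (t ^ k) * Q k x)))"
proof (induction u)
  case Nil
  show ?case
    by (rule exI[of _ "\<lambda>k::nat. if k = 0 then \<theta> else (\<lambda>x. 0)"]) (use \<theta> in auto)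
next
  case (Cons i u)
  then obtain Q where Q: "\<And>k. smooth_on UNIV (Q k)" "\<And>k x. x \<notin> S \<Longrightarrow> Q k x = 0" "\<And>k. k > length u \<Longrightarrow> Q k = (\<lambda>x. 0)"
    "Q (length u) = (\<lambda>x. grad_word (\<lambda>x. complex_of_real (r x)) u x * \<theta> x)"
    "\<And>t. foldr D u (\<lambda>x. of_real (exp (t * r x)) * \<theta> x) =
      (\<lambda>x. of_real (exp (t * r x)) * (\<Sum>k\<le>length u. of_real (t ^ k) * Q k x))"
    by auto
  let ?d = "\<lambda>x. complex_of_real (D i r x)"
  have dsm: "smooth_on UNIV ?d" by (intro smooth_on_of_real smooth_on_D r open_UNIV)
  \<comment> \<open>The new coefficient of t^k: either \<open>D i\<close> differentiates the old
    one, or it hits the exponential and raises the power from k - 1 to k.\<close>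
  define Q' where "Q' = (\<lambda>k x. D i (Q k) x + (case k of 0 \<Rightarrow> 0 | Suc k' \<Rightarrow> ?d x * Q k' x))"
  have "smooth_on UNIV (Q' k)" for k
    unfolding Q'_def by (cases k) (auto intro!: smooth_on_add smooth_on_mult smooth_on_D Q dsm)
  moreover have "Q' k x = 0" if "x \<notin> S" for k x
  proof -
    have "D i (Q k) x = D i (\<lambda>x. 0) x" for k
      by (rule D_cong_open[of "- S"]) (use \<theta>(2) that Q(2) in auto)
    then show ?thesis using Q(2)[OF that] by (auto simp: Q'_def split: nat.splits)
  qed
  moreover have "Q' k = (\<lambda>x. 0)" if k: "k > length (i # u)" for k
  proof -
    obtain k' where k': "k = Suc k'" using k by (cases k) auto
    then have "k' > length u" using k by simp
    with k' k show ?thesis using Q(3)[of k'] Q(3)[of k] by (simp add: Q'_def)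
  qed
  moreover have "Q' (length (i # u)) = (\<lambda>x. grad_word (\<lambda>x. complex_of_real (r x)) (i # u) x * \<theta> x)"
    using Q(3)[of "Suc (length u)"] by (simp add: Q'_def Q(4) D_of_real[OF r] mult_ac)
  moreover have "foldr D (i # u) (\<lambda>x. of_real (exp (t * r x)) * \<theta> x) =
      (\<lambda>x. of_real (exp (t * r x)) * (\<Sum>k\<le>length (i # u). of_real (t ^ k) * Q' k x))" for t
  proof
    fix x
    let ?E = "complex_of_real (exp (t * r x))" and ?m = "length u"
    let ?P = "\<lambda>x. \<Sum>k\<le>?m. of_real (t ^ k) * Q k x"
    have Psm: "smooth_on UNIV ?P" by (intro smooth_on_sum smooth_on_cmult Q open_UNIV)
    have DP: "D i ?P x = (\<Sum>k\<le>?m. of_real (t ^ k) * D i (Q k) x)"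
    proof -
      have "foldr D [i] ?P x = (\<Sum>k\<le>?m. foldr D [i] (\<lambda>x. of_real (t ^ k) * Q k x) x)"
        by (rule Cinf_foldr_D_sum[of _ _ UNIV]) (auto simp: Cinf_I intro!: Cinf_I smooth_on_cmult Q)
      then show ?thesis using foldr_D_cmult[OF open_UNIV Q(1) UNIV_I, of "[i]"] by simp
    qed
    have "foldr D (i # u) (\<lambda>x. of_real (exp (t * r x)) * \<theta> x) x = D i (\<lambda>x. of_real (exp (t * r x)) * ?P x) x"
      by (simp add: Q(5))
    also have "\<dots> = D i (\<lambda>x. of_real (exp (t * r x))) x * ?P x + ?E * D i ?P x"
      by (intro D_mult smooth_on_differentiable[OF smooth_on_exp_complex[OF r] UNIV_I] smooth_on_differentiable[OF Psm UNIV_I])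
    also have "\<dots> = ?E * ((\<Sum>k\<le>?m. of_real (t ^ k) * D i (Q k) x) + of_real t * ?d x * ?P x)"
      unfolding DP D_exp[OF r] by (simp add: algebra_simps)
    also have "of_real t * ?d x * ?P x = (\<Sum>k\<le>?m. of_real (t ^ Suc k) * (?d x * Q k x))"
      by (simp add: sum_distrib_left mult_ac)
    also have "(\<Sum>k\<le>?m. of_real (t ^ k) * D i (Q k) x) = (\<Sum>k\<le>Suc ?m. of_real (t ^ k) * D i (Q k) x)"
      using Q(3)[of "Suc ?m"] by simp
    also have "(\<Sum>k\<le>Suc ?m. of_real (t ^ k) * D i (Q k) x) + (\<Sum>k\<le>?m. of_real (t ^ Suc k) * (?d x * Q k x))
      = (\<Sum>k\<le>Suc ?m. of_real (t ^ k) * Q' k x)"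
      unfolding sum.atMost_Suc_shift[of _ ?m] Q'_def by (simp add: sum.distrib distrib_left add.assoc)
    finally show "foldr D (i # u) (\<lambda>x. of_real (exp (t * r x)) * \<theta> x) x =
      of_real (exp (t * r x)) * (\<Sum>k\<le>length (i # u). of_real (t ^ k) * Q' k x)" by simp
  qed
  ultimately show ?case by blast
qed

context smooth_domain
begin

text \<open>On \<open>S\<close> inside the domain \<open>r\<close> is negative, so the exponentials
  are at most 1 and tend to 0 pointwise; off \<open>S\<close>, where nothing is known about
  \<open>r\<close>, the factor \<open>H n\<close> vanishes. Dominated convergence gives the limit of
  the integrals and of the squared L2 norms.\<close>

lemma integral_exp_mult_tendsto_0:
  assumes r: "smooth_on UNIV r" and neg: "\<And>x. x \<in> \<Omega> \<Longrightarrow> x \<in> S \<Longrightarrow> r x < 0"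
    and H: "\<And>n::nat. H n \<in> Cinf \<Omega>" "\<And>n x. x \<notin> S \<Longrightarrow> H n x = 0" "\<And>n x. x \<in> \<Omega> \<Longrightarrow> cmod (H n x) \<le> M"
  shows "(\<lambda>n. LINT x|lebesgue_on \<Omega>. of_real (exp (real n * r x)) * H n x) \<longlonglongrightarrow> 0"
    and "(\<lambda>n. LINT x|lebesgue_on \<Omega>. (cmod (of_real (exp (real n * r x)) * H n x))\<^sup>2) \<longlonglongrightarrow> 0"
proof -
  let ?F = "\<lambda>n x. complex_of_real (exp (real n * r x)) * H n x"
  have FC: "?F n \<in> Cinf \<Omega>" for n by (intro Cinf_mult Cinf_I[OF smooth_on_exp_complex[OF r]] H)
  have M0: "M \<ge> 0" if "\<Omega> \<noteq> {}" using that H(3) norm_ge_zero order_trans by blast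
  have lim: "(\<lambda>n. ?F n x) \<longlonglongrightarrow> 0" if x: "x \<in> \<Omega>" for x
  proof (cases "x \<in> S")
    case True
    have "(\<lambda>n. exp (r x) ^ n) \<longlonglongrightarrow> 0" using neg[OF x True] by (intro LIMSEQ_power_zero) simp
    then have "(\<lambda>n. exp (real n * r x) * M) \<longlonglongrightarrow> 0 * M"
      unfolding exp_of_nat_mult by (intro tendsto_mult tendsto_const)
    then have l0: "(\<lambda>n. exp (real n * r x) * M) \<longlonglongrightarrow> 0" by simp
    show ?thesis
    proof (rule Lim_null_comparison[OF always_eventually l0], rule allI)
      show "norm (?F n x) \<le> exp (real n * r x) * M" for n
        unfolding norm_mult using H(3)[OF x] by (intro mult_mono) auto
    qed
  next
    case False then show ?thesis using H(2) by simp
  qed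
  have bd: "cmod (?F n x) \<le> M" if x: "x \<in> \<Omega>" for n x
  proof (cases "x \<in> S")
    case True
    then have "exp (real n * r x) \<le> 1" using neg[OF x True] by (simp add: mult_nonneg_nonpos)
    then have "exp (real n * r x) * cmod (H n x) \<le> 1 * M" using H(3)[OF x] by (intro mult_mono) auto
    then show ?thesis by (simp add: norm_mult)
  next
    case False then show ?thesis using H(2) M0 x by auto
  qed
  have "(\<lambda>n. LINT x|lebesgue_on \<Omega>. ?F n x) \<longlonglongrightarrow> (LINT x|lebesgue_on \<Omega>. 0)"
  proof (rule integral_dominated_convergence[where w = "\<lambda>_. M"])
    show "AE x in lebesgue_on \<Omega>. (\<lambda>n. ?F n x) \<longlonglongrightarrow> 0" using lim by (intro AE_I2) auto
    show "AE x in lebesgue_on \<Omega>. norm (?F n x) \<le> M" for n using bd by (intro AE_I2) auto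
  qed (auto intro: Cinf_measurable FC)
  then show "(\<lambda>n. LINT x|lebesgue_on \<Omega>. ?F n x) \<longlonglongrightarrow> 0" by simp
  have "(\<lambda>n. LINT x|lebesgue_on \<Omega>. (cmod (?F n x))\<^sup>2) \<longlonglongrightarrow> (LINT x|lebesgue_on \<Omega>. 0)"
  proof (rule integral_dominated_convergence[where w = "\<lambda>_. M\<^sup>2"])
    have "(\<lambda>n. (cmod (?F n x))\<^sup>2) \<longlonglongrightarrow> (cmod 0)\<^sup>2" if "x \<in> \<Omega>" for x
      by (intro tendsto_power tendsto_norm lim that)
    then show "AE x in lebesgue_on \<Omega>. (\<lambda>n. (cmod (?F n x))\<^sup>2) \<longlonglongrightarrow> 0" by (intro AE_I2) auto
    show "AE x in lebesgue_on \<Omega>. norm ((cmod (?F n x))\<^sup>2) \<le> M\<^sup>2" for n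
      using bd by (intro AE_I2) (auto intro!: power_mono)
    show "(\<lambda>x. (cmod (?F n x))\<^sup>2) \<in> borel_measurable (lebesgue_on \<Omega>)" for n
      using borel_measurable_integrable[OF L2_D(2)[OF Cinf_L2[OF FC]]] .
  qed auto
  then show "(\<lambda>n. LINT x|lebesgue_on \<Omega>. (cmod (?F n x))\<^sup>2) \<longlonglongrightarrow> 0" by simp
qed

lemma scaled_power_le_1: "k \<le> s \<Longrightarrow> real (Suc n) ^ k / real (Suc n) ^ s \<le> 1"
  by (simp add: power_increasing)

text \<open>The functions \<open>t powr - s * exp (t * r) * \<theta>\<close> tend to zero in \<open>W\<close>, while the top order
  functional picks up \<open>t * exp (t * r)\<close>, which concentrates on the frontier.\<close>

lemma concentration:
  assumes bounded: "W_bounded s (\<lambda>f. \<Sum>u | length u = Suc s. LINT x|lebesgue_on \<Omega>. a u x * foldr D u f x)"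
    and a: "\<And>u. a u \<in> Cinf \<Omega>" and r: "smooth_on UNIV r" and neg: "\<And>x. x \<in> \<Omega> \<Longrightarrow> x \<in> S \<Longrightarrow> r x < 0"
    and \<theta>: "smooth_on UNIV \<theta>" "closed S" "\<And>x. x \<notin> S \<Longrightarrow> \<theta> x = 0"
  shows "(\<lambda>n. LINT x|lebesgue_on \<Omega>. of_real (real (Suc n) * exp (real (Suc n) * r x)) *
     ((\<Sum>u | length u = Suc s. a u x * grad_word (\<lambda>x. complex_of_real (r x)) u x) * \<theta> x)) \<longlonglongrightarrow> 0"
proof -
  let ?N = "{u :: ('n + 'n) list. length u = Suc s}"
  let ?t = "\<lambda>n::nat. real (Suc n)"
  let ?E = "\<lambda>n x. complex_of_real (exp (?t n * r x))"
  let ?g = "grad_word (\<lambda>x. complex_of_real (r x))"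
  obtain Q where Q: "\<And>u k. smooth_on UNIV (Q u k)" "\<And>u k x. x \<notin> S \<Longrightarrow> Q u k x = 0"
    "\<And>u. Q u (length u) = (\<lambda>x. ?g u x * \<theta> x)"
    "\<And>u t. foldr D u (\<lambda>x. of_real (exp (t * r x)) * \<theta> x) =
      (\<lambda>x. of_real (exp (t * r x)) * (\<Sum>k\<le>length u. of_real (t ^ k) * Q u k x))"
  proof -
    have "\<forall>u. \<exists>Q. (\<forall>k. smooth_on UNIV (Q k)) \<and> (\<forall>k x. x \<notin> S \<longrightarrow> Q k x = 0) \<and> (\<forall>k>length u. Q k = (\<lambda>x. 0)) \<and>
      Q (length u) = (\<lambda>x. ?g u x * \<theta> x) \<and>
      (\<forall>t. foldr D u (\<lambda>x. of_real (exp (t * r x)) * \<theta> x) =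
        (\<lambda>x. of_real (exp (t * r x)) * (\<Sum>k\<le>length u. of_real (t ^ k) * Q k x)))"
      using foldr_D_exp_mult[OF r \<theta>] by (intro allI)
    from choice[OF this] obtain Q where "\<forall>u. (\<forall>k. smooth_on UNIV (Q u k)) \<and> (\<forall>k x. x \<notin> S \<longrightarrow> Q u k x = 0) \<and> (\<forall>k>length u. Q u k = (\<lambda>x. 0)) \<and>
      Q u (length u) = (\<lambda>x. ?g u x * \<theta> x) \<and>
      (\<forall>t. foldr D u (\<lambda>x. of_real (exp (t * r x)) * \<theta> x) =
        (\<lambda>x. of_real (exp (t * r x)) * (\<Sum>k\<le>length u. of_real (t ^ k) * Q u k x)))" ..
    then show thesis by (intro that[of Q]) auto
  qed
  define f where "f = (\<lambda>n x. of_real (1 / ?t n ^ s) * (?E n x * \<theta> x))"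
  have EC: "(\<lambda>x. ?E n x * \<theta> x) \<in> Cinf \<Omega>" for n by (intro Cinf_mult Cinf_I[OF smooth_on_exp_complex[OF r]] Cinf_I \<theta>)
  have fC: "f n \<in> Cinf \<Omega>" for n unfolding f_def by (intro Cinf_cmult EC)
  have QC: "Q u k \<in> Cinf \<Omega>" for u k by (intro Cinf_I Q)
  have Df: "foldr D u (f n) x = ?E n x * (\<Sum>k\<le>length u. of_real (?t n ^ k / ?t n ^ s) * Q u k x)" for u n x
  proof -
    have "foldr D u (f n) x = of_real (1 / ?t n ^ s) * foldr D u (\<lambda>x. ?E n x * \<theta> x) x"
      unfolding f_def by (rule foldr_D_cmult[OF open_UNIV _ UNIV_I]) (intro smooth_on_mult smooth_on_exp_complex r \<theta> open_UNIV)
    then show ?thesis unfolding Q(4) by (simp add: sum_distrib_left mult_ac)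
  qed
  \<comment> \<open>The polynomial factor of a scaled derivative. For m \<le> s every power of t in
    it is at most 1, so it is bounded uniformly in \<open>n\<close>.\<close>
  define H where "H = (\<lambda>u m n x. \<Sum>k\<le>m. of_real (?t n ^ k / ?t n ^ s) * Q u k x)"
  have HC: "H u m n \<in> Cinf \<Omega>" for u m n unfolding H_def by (intro Cinf_sum Cinf_cmult QC)
  have H0: "H u m n x = 0" if "x \<notin> S" for u m n x using Q(2)[OF that] by (simp add: H_def)
  have "\<exists>M. \<forall>n. \<forall>x\<in>\<Omega>. cmod (H u m n x) \<le> M" if m: "m \<le> s" for u m
  proof -
    have "\<forall>k. \<exists>B. \<forall>x\<in>\<Omega>. cmod (Q u k x) \<le> B" using Cinf_bounded[OF QC] by metis
    then obtain B where B: "\<And>k x. x \<in> \<Omega> \<Longrightarrow> cmod (Q u k x) \<le> B k" by metis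
    have "cmod (H u m n x) \<le> (\<Sum>k\<le>m. B k)" if x: "x \<in> \<Omega>" for n x
      unfolding H_def
    proof (rule sum_norm_le)
      fix k assume "k \<in> {..m}"
      then have "?t n ^ k / ?t n ^ s \<le> 1" using m by (intro scaled_power_le_1) simp
      then have "(?t n ^ k / ?t n ^ s) * cmod (Q u k x) \<le> 1 * B k"
        using B[OF x, of k] by (intro mult_mono) auto
      then show "cmod (of_real (?t n ^ k / ?t n ^ s) * Q u k x) \<le> B k"
        unfolding norm_mult norm_of_real by (simp add: abs_of_nonneg)
    qed
    then show ?thesis by blast
  qed
  then have "\<forall>u m. \<exists>M. m \<le> s \<longrightarrow> (\<forall>n. \<forall>x\<in>\<Omega>. cmod (H u m n x) \<le> M)" by blast
  then obtain M where "\<forall>u m. m \<le> s \<longrightarrow> (\<forall>n. \<forall>x\<in>\<Omega>. cmod (H u m n x) \<le> M u m)" by metis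
  then have M: "\<And>u m n x. m \<le> s \<Longrightarrow> x \<in> \<Omega> \<Longrightarrow> cmod (H u m n x) \<le> M u m" by blast
  have lim_norm: "(\<lambda>n. W_norm \<Omega> s (f n)) \<longlonglongrightarrow> 0"
  proof -
    have "Re (W_inner \<Omega> s (f n) (f n)) = (\<Sum>w | length w \<le> s. LINT x|lebesgue_on \<Omega>. (cmod (?E n x * H w (length w) n x))\<^sup>2)" for n
      unfolding W_inner_Cinf[OF fC fC] complex_norm_square[symmetric] integral_complex_of_real Df H_def by simp
    \<comment> \<open>The limit lemma has the exponent n where t is n + 1; using the family at index
      n - 1 and then shifting the sequence makes the two agree.\<close>
    moreover have "(\<lambda>n. LINT x|lebesgue_on \<Omega>. (cmod (?E n x * H w (length w) n x))\<^sup>2) \<longlonglongrightarrow> 0" if "length w \<le> s" for w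
      using LIMSEQ_Suc[OF integral_exp_mult_tendsto_0(2)[where S = S and H = "\<lambda>n. H w (length w) (n - 1)" and M = "M w (length w)", OF r neg]] HC H0 M[OF that]
      by simp
    ultimately have "(\<lambda>n. Re (W_inner \<Omega> s (f n) (f n))) \<longlonglongrightarrow> (\<Sum>w\<in>{w :: ('n + 'n) list. length w \<le> s}. 0)"
      by (simp only:) (intro tendsto_sum, simp)
    then show ?thesis unfolding W_norm_def using tendsto_real_sqrt by force
  qed
  obtain C where C: "\<And>f. f \<in> Cinf \<Omega> \<Longrightarrow> cmod (\<Sum>u\<in>?N. LINT x|lebesgue_on \<Omega>. a u x * foldr D u f x) \<le> C * W_norm \<Omega> s f"
    using bounded by (auto simp: W_bounded_def)
  have lim_C: "(\<lambda>n. C * W_norm \<Omega> s (f n)) \<longlonglongrightarrow> 0" using tendsto_mult[OF tendsto_const[of C] lim_norm] by simp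
  have lim_L: "(\<lambda>n. \<Sum>u\<in>?N. LINT x|lebesgue_on \<Omega>. a u x * foldr D u (f n) x) \<longlonglongrightarrow> 0"
    by (rule Lim_null_comparison[OF always_eventually lim_C], rule allI, rule C[OF fC])
  have lim_low: "(\<lambda>n. \<Sum>u\<in>?N. LINT x|lebesgue_on \<Omega>. ?E n x * (a u x * H u s n x)) \<longlonglongrightarrow> 0"
  proof (rule tendsto_null_sum)
    fix u assume "u \<in> ?N"
    obtain B where B: "B \<ge> 0" "\<And>x. x \<in> \<Omega> \<Longrightarrow> cmod (a u x) \<le> B" using Cinf_bounded[OF a] by metis
    have bd: "cmod (a u x * H u s n x) \<le> B * M u s" if "x \<in> \<Omega>" for n x
      unfolding norm_mult using B M[OF order_refl that] that by (intro mult_mono) auto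
    have "(\<lambda>n. LINT x|lebesgue_on \<Omega>. of_real (exp (real n * r x)) * (a u x * H u s (n - 1) x)) \<longlonglongrightarrow> 0"
      by (rule integral_exp_mult_tendsto_0(1)[where S = S and H = "\<lambda>n x. a u x * H u s (n - 1) x" and M = "B * M u s", OF r neg])
         (auto intro!: Cinf_mult a HC bd simp: H0)
    from LIMSEQ_Suc[OF this] show "(\<lambda>n. LINT x|lebesgue_on \<Omega>. ?E n x * (a u x * H u s n x)) \<longlonglongrightarrow> 0" by simp
  qed
  have gC: "?g u \<in> Cinf \<Omega>" for u by (intro Cinf_I smooth_on_grad_word smooth_on_of_real r open_UNIV)
  have \<theta>C: "\<theta> \<in> Cinf \<Omega>" by (intro Cinf_I \<theta>)
  \<comment> \<open>In the derivatives of order s + 1 the powers of t up to s cancel. What is left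
    is the leading term, with t^(s+1) / t^s = t and coefficient \<open>grad_word\<close> times
    \<open>\<theta>\<close>.\<close>
  have "(\<Sum>u\<in>?N. LINT x|lebesgue_on \<Omega>. a u x * foldr D u (f n) x) - (\<Sum>u\<in>?N. LINT x|lebesgue_on \<Omega>. ?E n x * (a u x * H u s n x))
    = (LINT x|lebesgue_on \<Omega>. of_real (?t n * exp (?t n * r x)) * ((\<Sum>u\<in>?N. a u x * ?g u x) * \<theta> x))" for n
  proof -
    have E0C: "(\<lambda>x. ?E n x) \<in> Cinf \<Omega>" by (intro Cinf_I smooth_on_exp_complex r)
    have "(LINT x|lebesgue_on \<Omega>. a u x * foldr D u (f n) x) - (LINT x|lebesgue_on \<Omega>. ?E n x * (a u x * H u s n x))
      = (LINT x|lebesgue_on \<Omega>. of_real (?t n) * (?E n x * (a u x * ?g u x * \<theta> x)))" if u: "u \<in> ?N" for u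
    proof -
      have "(LINT x|lebesgue_on \<Omega>. a u x * foldr D u (f n) x) - (LINT x|lebesgue_on \<Omega>. ?E n x * (a u x * H u s n x))
        = (LINT x|lebesgue_on \<Omega>. a u x * foldr D u (f n) x - ?E n x * (a u x * H u s n x))"
        by (intro Bochner_Integration.integral_diff[symmetric] Cinf_integrable Cinf_mult a Cinf_foldr_D fC E0C HC)
      also have "\<dots> = (LINT x|lebesgue_on \<Omega>. of_real (?t n) * (?E n x * (a u x * ?g u x * \<theta> x)))"
      proof (intro Bochner_Integration.integral_cong refl)
        fix x
        have len: "length u = Suc s" using u by simp
        have top: "?t n ^ Suc s / ?t n ^ s = ?t n" by simp
        have "foldr D u (f n) x = ?E n x * (H u s n x + of_real (?t n) * (?g u x * \<theta> x))"
          unfolding Df len sum.atMost_Suc top H_def using Q(3)[of u] unfolding len by simp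
        then show "a u x * foldr D u (f n) x - ?E n x * (a u x * H u s n x) = of_real (?t n) * (?E n x * (a u x * ?g u x * \<theta> x))"
          by (simp add: algebra_simps)
      qed
      finally show ?thesis .
    qed
    then have "(\<Sum>u\<in>?N. LINT x|lebesgue_on \<Omega>. a u x * foldr D u (f n) x) - (\<Sum>u\<in>?N. LINT x|lebesgue_on \<Omega>. ?E n x * (a u x * H u s n x))
      = (\<Sum>u\<in>?N. LINT x|lebesgue_on \<Omega>. of_real (?t n) * (?E n x * (a u x * ?g u x * \<theta> x)))"
      unfolding sum_subtractf[symmetric] by (intro sum.cong refl)
    also have "\<dots> = (LINT x|lebesgue_on \<Omega>. (\<Sum>u\<in>?N. of_real (?t n) * (?E n x * (a u x * ?g u x * \<theta> x))))"
      by (intro Bochner_Integration.integral_sum[symmetric] Cinf_integrable Cinf_mult Cinf_const a gC \<theta>C E0C)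
    also have "\<dots> = (LINT x|lebesgue_on \<Omega>. of_real (?t n * exp (?t n * r x)) * ((\<Sum>u\<in>?N. a u x * ?g u x) * \<theta> x))"
      by (intro Bochner_Integration.integral_cong refl) (simp add: sum_distrib_left sum_distrib_right mult_ac)
    finally show ?thesis .
  qed
  then show ?thesis using tendsto_diff[OF lim_L lim_low] by simp
qed

text \<open>Moving the centre by h means moving the argument by - h, so this is a Taylor estimate,
  uniform in \<open>x\<close> because the second derivative is continuous with compact support. It
  permits differentiation of the integral of a moving bump.\<close>

lemma second_order_taylor_ball_bump:
  obtains M where "\<And>h x. \<bar>ball_bump (c + h *\<^sub>R unit_vec k) \<eta> x - ball_bump c \<eta> x + h * D k (ball_bump c \<eta>) (x :: 'n cspace)\<bar> \<le> M * h\<^sup>2"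
proof -
  let ?b = "ball_bump c \<eta> :: 'n cspace \<Rightarrow> real"
  have sm: "smooth_on UNIV ?b" by (rule smooth_on_ball_bump)
  have diff: "foldr D w ?b differentiable (at x)" for w x
    using smooth_on_differentiable[OF smooth_on_foldr_D[OF sm] UNIV_I] .
  have "compact (D k (D k ?b) ` cball c (\<bar>\<eta>\<bar>))"
    by (intro compact_continuous_image continuous_on_subset[OF smooth_on_continuous_on[OF smooth_on_D[OF smooth_on_D[OF sm]]]]) auto
  from compact_imp_bounded[OF this] obtain M0 where "\<forall>y\<in>D k (D k ?b) ` cball c (\<bar>\<eta>\<bar>). norm y \<le> M0"
    unfolding bounded_iff by blast
  then have M0: "\<And>x. x \<in> cball c (\<bar>\<eta>\<bar>) \<Longrightarrow> \<bar>D k (D k ?b) x\<bar> \<le> M0"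
    unfolding real_norm_def by blast
  have out: "D k (D k ?b) x = 0" if "x \<notin> cball c (\<bar>\<eta>\<bar>)" for x
  proof -
    have "foldr D [k, k] ?b x = foldr D [k, k] (\<lambda>x. 0) x"
    proof (rule foldr_D_cong[of "- cball c (\<bar>\<eta>\<bar>)"])
      fix y assume "y \<in> - cball c (\<bar>\<eta>\<bar>)"
      then have "\<eta>\<^sup>2 \<le> (dist c y)\<^sup>2" using power_mono[of "\<bar>\<eta>\<bar>" "dist c y" 2] by simp
      then show "?b y = 0" by (simp add: ball_bump_def)
    qed (use that in auto)
    then show ?thesis by simp
  qed
  define M where "M = max M0 0"
  have M: "\<bar>D k (D k ?b) x\<bar> \<le> M" "M \<ge> 0" for x using M0[of x] out[of x] by (cases "x \<in> cball c (\<bar>\<eta>\<bar>)") (auto simp: M_def)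
  have lip: "\<bar>D k ?b (x + t *\<^sub>R unit_vec k) - D k ?b x\<bar> \<le> M * \<bar>t\<bar>" for x t
  proof -
    have pos: "\<bar>D k ?b (y + t *\<^sub>R unit_vec k) - D k ?b y\<bar> \<le> M * t" if t: "t > 0" for y t
    proof -
      obtain z where "D k ?b (y + t *\<^sub>R unit_vec k) - D k ?b (y + 0 *\<^sub>R unit_vec k) = (t - 0) * D k (D k ?b) z"
        using D_mean_value[OF t, of "D k ?b" y k] diff[of "[k]"] by auto
      then show ?thesis using M(1)[of z] t by (simp add: abs_mult mult.commute)
    qed
    consider "t > 0" | "t = 0" | "t < 0" by linarith
    then show ?thesis
    proof cases
      case 3
      then show ?thesis using pos[of "- t" "x + t *\<^sub>R unit_vec k"] by (simp add: abs_minus_commute)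
    qed (use pos[of t x] in auto)
  qed
  have shift: "ball_bump (c + h *\<^sub>R unit_vec k) \<eta> x = ?b (x + (- h) *\<^sub>R unit_vec k)" for h x
  proof -
    have "dist (c + h *\<^sub>R unit_vec k) x = dist c (x + (- h) *\<^sub>R unit_vec k)"
      by (simp add: dist_norm algebra_simps)
    then show ?thesis by (simp add: ball_bump_def)
  qed
  have main: "\<bar>?b (x + h *\<^sub>R unit_vec k) - ?b x - h * D k ?b x\<bar> \<le> M * h\<^sup>2" for h x
  proof -
    have *: "\<exists>t. \<bar>t\<bar> \<le> \<bar>h\<bar> \<and> ?b (x + h *\<^sub>R unit_vec k) - ?b x = h * D k ?b (x + t *\<^sub>R unit_vec k)"
    proof -
      consider "h > 0" | "h = 0" | "h < 0" by linarith
      then show ?thesis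
      proof cases
        case 1
        obtain t where "0 < t" "t < h" "?b (x + h *\<^sub>R unit_vec k) - ?b (x + 0 *\<^sub>R unit_vec k) = (h - 0) * D k ?b (x + t *\<^sub>R unit_vec k)"
          using D_mean_value[OF 1, of ?b x k] diff[of "[]"] by auto
        then show ?thesis by (intro exI[of _ t]) auto
      next
        case 3
        obtain t where "h < t" "t < 0" "?b (x + 0 *\<^sub>R unit_vec k) - ?b (x + h *\<^sub>R unit_vec k) = (0 - h) * D k ?b (x + t *\<^sub>R unit_vec k)"
          using D_mean_value[OF 3, of ?b x k] diff[of "[]"] by auto
        then show ?thesis by (intro exI[of _ t]) (auto simp: algebra_simps)
      qed auto
    qed
    then obtain t where t: "\<bar>t\<bar> \<le> \<bar>h\<bar>" "?b (x + h *\<^sub>R unit_vec k) - ?b x = h * D k ?b (x + t *\<^sub>R unit_vec k)" by blast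
    have "\<bar>?b (x + h *\<^sub>R unit_vec k) - ?b x - h * D k ?b x\<bar> = \<bar>h\<bar> * \<bar>D k ?b (x + t *\<^sub>R unit_vec k) - D k ?b x\<bar>"
      unfolding t(2) abs_mult[symmetric] by (simp add: algebra_simps)
    also have "\<dots> \<le> \<bar>h\<bar> * (M * \<bar>h\<bar>)"
      using lip[of x t] t(1) M(2) mult_left_mono[OF t(1) M(2)] by (intro mult_left_mono) auto
    finally show ?thesis by (simp add: power2_eq_square mult_ac flip: abs_mult)
  qed
  show thesis
  proof (rule that[of M])
    show "\<bar>ball_bump (c + h *\<^sub>R unit_vec k) \<eta> x - ?b x + h * D k ?b x\<bar> \<le> M * h\<^sup>2" for h x
      using main[of x "- h"] unfolding shift by simp
  qed
qed

text \<open>Otherwise the integral over \<open>\<Omega>\<close> of a bump would not change while the bump is moved across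
  the frontier.\<close>

lemma integral_D_bump_nonzero:
  fixes r :: "'n cspace \<Rightarrow> real" and \<sigma> \<epsilon> :: real
  assumes p: "p \<in> frontier \<Omega>" and \<epsilon>: "\<epsilon> > 0" and r: "smooth_on UNIV r"
    and B: "\<And>x. x \<in> ball p \<epsilon> \<Longrightarrow> x \<in> \<Omega> \<longleftrightarrow> r x < 0" "\<And>x. x \<in> ball p \<epsilon> \<Longrightarrow> x \<in> frontier \<Omega> \<longleftrightarrow> r x = 0"
    and \<sigma>: "\<bar>\<sigma>\<bar> = 1" "\<And>x. x \<in> ball p \<epsilon> \<Longrightarrow> \<sigma> * D k r x > 0"
    and zero: "\<And>\<theta>. smooth_on UNIV \<theta> \<Longrightarrow> (\<And>x. x \<notin> ball p \<epsilon> \<Longrightarrow> \<theta> x = 0) \<Longrightarrow> (LINT x|lebesgue_on \<Omega>. D k \<theta> x) = (0 :: complex)"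
  shows False
proof -
  let ?e = "unit_vec k :: 'n cspace"
  \<comment> \<open>A bump of radius at most \<epsilon>/4 whose centre is within \<epsilon>/4 of
    \<open>p\<close> stays inside the ball of radius \<epsilon>, where the hypothesis on integrals
    applies.\<close>
  define \<tau> where "\<tau> = \<epsilon> / 4"
  have \<tau>: "\<tau> > 0" "\<tau> < \<epsilon>" using \<epsilon> by (auto simp: \<tau>_def)
  have inB: "p + t *\<^sub>R ?e \<in> ball p \<epsilon>" if "\<bar>t\<bar> \<le> \<tau>" for t using that \<tau> by (simp add: dist_norm)
  have rp: "r p = 0" using B(2)[of p] p \<epsilon> by simp
  have diff: "r differentiable (at x)" for x using smooth_on_differentiable[OF r UNIV_I] .
  have \<sigma>c: "\<sigma> = 1 \<or> \<sigma> = -1" using \<sigma>(1) by (cases "\<sigma> \<ge> 0") auto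
  have sgn1: "\<sigma> * r (p + \<tau> *\<^sub>R ?e) > 0"
  proof -
    obtain t where t: "0 < t" "t < \<tau>" "r (p + \<tau> *\<^sub>R ?e) - r (p + 0 *\<^sub>R ?e) = (\<tau> - 0) * D k r (p + t *\<^sub>R ?e)"
      using D_mean_value[OF \<tau>(1), of r p k] diff by auto
    have "\<tau> * (\<sigma> * D k r (p + t *\<^sub>R ?e)) > 0" using \<sigma>(2)[OF inB[of t]] t \<tau> by simp
    moreover have "\<sigma> * r (p + \<tau> *\<^sub>R ?e) = \<tau> * (\<sigma> * D k r (p + t *\<^sub>R ?e))" using t(3) rp by simp
    ultimately show ?thesis by linarith
  qed
  have sgn2: "\<sigma> * r (p + (- \<tau>) *\<^sub>R ?e) < 0"
  proof -
    have "- \<tau> < 0" using \<tau> by simp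
    then obtain t where t: "- \<tau> < t" "t < 0" "r (p + 0 *\<^sub>R ?e) - r (p + (- \<tau>) *\<^sub>R ?e) = (0 - (- \<tau>)) * D k r (p + t *\<^sub>R ?e)"
      using D_mean_value[of "- \<tau>" 0 r p k] diff by blast
    have "\<tau> * (\<sigma> * D k r (p + t *\<^sub>R ?e)) > 0" using \<sigma>(2)[OF inB[of t]] t \<tau> by simp
    moreover have "r (p + (- \<tau>) *\<^sub>R ?e) = - (\<tau> * D k r (p + t *\<^sub>R ?e))" using t(3) rp by simp
    then have "\<sigma> * r (p + (- \<tau>) *\<^sub>R ?e) = - (\<tau> * (\<sigma> * D k r (p + t *\<^sub>R ?e)))" by simp
    ultimately show ?thesis by linarith
  qed
  \<comment> \<open>The two ends of the path of the centre: \<open>\<sigma> * r\<close> increases in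
    direction \<open>k\<close> and is 0 at \<open>p\<close>, so \<open>y1\<close> lies in
    \<open>\<Omega>\<close> and \<open>y2\<close> outside its closure. The radius
    \<open>\<eta>\<close> is then taken so small that the whole bump is on one side at each
    end.\<close>
  define y1 where "y1 = p + (- \<sigma> * \<tau>) *\<^sub>R ?e"
  define y2 where "y2 = p + (\<sigma> * \<tau>) *\<^sub>R ?e"
  have y: "y1 \<in> ball p \<epsilon>" "y2 \<in> ball p \<epsilon>" "r y1 < 0" "r y2 > 0"
    using \<sigma>c sgn1 sgn2 \<tau> inB[of "\<tau>"] inB[of "- \<tau>"] by (auto simp: y1_def y2_def)
  have y1: "y1 \<in> \<Omega>" using B(1) y by simp
  have y2: "y2 \<in> - closure \<Omega>" using B(1)[OF y(2)] B(2)[OF y(2)] y(4) open_domain by (auto simp: frontier_def interior_open)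
  obtain e1 where e1: "e1 > 0" "ball y1 e1 \<subseteq> \<Omega>" using y1 open_domain open_contains_ball by blast
  obtain e2 where e2: "e2 > 0" "ball y2 e2 \<subseteq> - closure \<Omega>" using y2 open_contains_ball[of "- closure \<Omega>"] by auto
  define \<eta> where "\<eta> = min \<tau> (min e1 e2)"
  have \<eta>: "\<eta> > 0" "\<eta> \<le> \<tau>" "\<eta> \<le> e1" "\<eta> \<le> e2" using \<tau> e1 e2 by (auto simp: \<eta>_def)
  define bb where "bb = (\<lambda>t x. ball_bump (p + t *\<^sub>R ?e) \<eta> x)"
  define g where "g = (\<lambda>t. LINT x|lebesgue_on \<Omega>. bb t x)"
  have bsm: "smooth_on UNIV (bb t)" for t unfolding bb_def by (rule smooth_on_ball_bump)
  have smi: "integrable (lebesgue_on \<Omega>) h" if "smooth_on UNIV h" for h :: "'n cspace \<Rightarrow> real"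
    by (intro integrable_on_closure open_domain bounded_domain continuous_on_subset[OF smooth_on_continuous_on[OF that]]) simp
  have bint: "integrable (lebesgue_on \<Omega>) (bb t)" "integrable (lebesgue_on \<Omega>) (D k (bb t))" for t
    using smi[OF bsm] smi[OF smooth_on_D[OF bsm]] by blast+
  have Dzero: "(LINT x|lebesgue_on \<Omega>. D k (bb t) x) = 0" if t: "\<bar>t\<bar> \<le> \<tau>" for t
  proof -
    have "(LINT x|lebesgue_on \<Omega>. D k (\<lambda>x. complex_of_real (bb t x)) x) = 0"
    proof (rule zero)
      show "smooth_on UNIV (\<lambda>x. complex_of_real (bb t x))" by (intro smooth_on_of_real bsm open_UNIV)
      fix x assume x: "x \<notin> ball p \<epsilon>"
      have "dist p (p + t *\<^sub>R ?e) \<le> \<tau>" using t by (simp add: dist_norm)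
      then have "dist (p + t *\<^sub>R ?e) x \<ge> \<epsilon> - \<tau>" using x dist_triangle[of p x "p + t *\<^sub>R ?e"] by simp
      then have "x \<notin> ball (p + t *\<^sub>R ?e) \<eta>" using \<eta>(2) \<epsilon> by (simp add: \<tau>_def)
      then show "complex_of_real (bb t x) = 0" using \<eta>(1) by (simp add: bb_def ball_bump_eq_0_iff)
    qed
    then show ?thesis by (simp add: D_of_real[OF bsm])
  qed
  \<comment> \<open>By the Taylor estimate the derivative of the integral is minus the integral of
    the \<open>k\<close>-th derivative of the bump, which is \<open>0\<close> by
    \<open>Dzero\<close>.\<close>
  have deriv: "(g has_real_derivative 0) (at t)" if t: "\<bar>t\<bar> \<le> \<tau>" for t
  proof -
    obtain M where M: "\<And>h x. \<bar>ball_bump ((p + t *\<^sub>R ?e) + h *\<^sub>R ?e) \<eta> x - ball_bump (p + t *\<^sub>R ?e) \<eta> x + h * D k (ball_bump (p + t *\<^sub>R ?e) \<eta>) x\<bar> \<le> M * h\<^sup>2"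
      using second_order_taylor_ball_bump by blast
    define K where "K = M * measure (lebesgue_on \<Omega>) (space (lebesgue_on \<Omega>))"
    have gh: "\<bar>g (t + h) - g t\<bar> \<le> K * h\<^sup>2" for h
    proof -
      have i: "integrable (lebesgue_on \<Omega>) (\<lambda>x. bb (t + h) x - bb t x + h * D k (bb t) x)"
        by (intro Bochner_Integration.integrable_add Bochner_Integration.integrable_diff integrable_mult_right bint)
      have "g (t + h) - g t = (LINT x|lebesgue_on \<Omega>. bb (t + h) x - bb t x + h * D k (bb t) x)"
        unfolding g_def using bint Dzero[OF t] by simp
      also have "\<bar>\<dots>\<bar> \<le> (LINT x|lebesgue_on \<Omega>. \<bar>bb (t + h) x - bb t x + h * D k (bb t) x\<bar>)"
        using integral_norm_bound[of "lebesgue_on \<Omega>"] by simp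
      also have "\<dots> \<le> (LINT x|lebesgue_on \<Omega>. M * h\<^sup>2)"
        using M[of h] by (intro integral_mono integrable_abs i integrable_const) (simp_all add: bb_def scaleR_add_left add.assoc)
      also have "\<dots> = K * h\<^sup>2" by (simp add: K_def)
      finally show ?thesis .
    qed
    have "((\<lambda>h. (g (t + h) - g t) / h) \<longlongrightarrow> 0) (at 0)"
    proof (rule Lim_null_comparison)
      show "\<forall>\<^sub>F h in at 0. norm ((g (t + h) - g t) / h) \<le> K * \<bar>h\<bar>"
      proof (rule always_eventually, rule allI)
        fix h show "norm ((g (t + h) - g t) / h) \<le> K * \<bar>h\<bar>"
          using gh[of h] by (cases "h = 0") (simp_all add: divide_le_eq power2_eq_square mult.assoc)
      qed
      have "((\<lambda>h. K * \<bar>h\<bar>) \<longlongrightarrow> K * \<bar>0\<bar>) (at 0)" by (intro tendsto_intros)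
      then show "((\<lambda>h. K * \<bar>h\<bar>) \<longlongrightarrow> 0) (at 0)" by simp
    qed
    then show ?thesis by (simp add: DERIV_def)
  qed
  have "g \<tau> = g (- \<tau>)"
  proof -
    obtain z where "- \<tau> < z" "z < \<tau>" "g \<tau> - g (- \<tau>) = (\<tau> - (- \<tau>)) * 0"
      using MVT2[of "- \<tau>" \<tau> g "\<lambda>_. 0"] deriv \<tau> by (auto simp: abs_le_iff)
    then show ?thesis by simp
  qed
  then have eq: "(LINT x|lebesgue_on \<Omega>. ball_bump y1 \<eta> x) = (LINT x|lebesgue_on \<Omega>. ball_bump y2 \<eta> x)"
    using \<sigma>c by (auto simp: g_def bb_def y1_def y2_def)
  have "(LINT x|lebesgue_on \<Omega>. ball_bump y2 \<eta> x) = (LINT x|lebesgue_on \<Omega>. 0)"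
  proof (intro Bochner_Integration.integral_cong refl)
    fix x assume "x \<in> space (lebesgue_on \<Omega>)"
    then have "x \<in> closure \<Omega>" using domain_subset_closure by simp
    then have "x \<notin> ball y2 e2" using e2(2) by blast
    then have "x \<notin> ball y2 \<eta>" using \<eta>(4) by simp
    then show "ball_bump y2 \<eta> x = 0" using \<eta>(1) by (simp add: ball_bump_eq_0_iff)
  qed
  then have "(LINT x|lebesgue_on \<Omega>. ball_bump y1 \<eta> x) = 0" using eq by simp
  moreover have "integrable (lebesgue_on \<Omega>) (ball_bump y1 \<eta>)"
    by (rule smi[OF smooth_on_ball_bump])
  ultimately have "AE x in lebesgue_on \<Omega>. ball_bump y1 \<eta> x = 0"
    using integral_nonneg_eq_0_iff_AE[of "lebesgue_on \<Omega>" "ball_bump y1 \<eta>"] by simp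
  then have "AE x in lebesgue. x \<in> \<Omega> \<longrightarrow> ball_bump y1 \<eta> x = 0"
    using open_domain by (subst (asm) AE_restrict_space_iff) auto
  then have "AE x in lebesgue. x \<notin> ball y1 \<eta>"
  proof eventually_elim
    case (elim x)
    show ?case
    proof
      assume x: "x \<in> ball y1 \<eta>"
      then have "x \<in> \<Omega>" using e1(2) \<eta>(3) by auto
      then show False using elim x \<eta>(1) by (simp add: ball_bump_eq_0_iff)
    qed
  qed
  then have "ball y1 \<eta> \<in> null_sets lebesgue"
    by (subst (asm) AE_iff_null) (auto simp: ball_def)
  then have "negligible (ball y1 \<eta>)" by (simp add: negligible_iff_null_sets)
  then show False using open_not_negligible[of "ball y1 \<eta>"] \<eta>(1) by simp
qed

text \<open>Suppose the symbol P, taken at the gradient of \<open>r\<close>, is nonzero at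
  \<open>p\<close>. For any smooth \<theta>1 supported near \<open>p\<close> one may test with
  \<theta> = \<theta>1 (D_k r) / P. Then the concentrating integral is that of \<theta>1 D_k (exp(t
  r)), which after integration by parts tends to the integral of D_k \<theta>1. Boundedness makes
  the limit 0 for every \<theta>1, against \<open>integral_D_bump_nonzero\<close>.\<close>

lemma symbol_vanishes_if_W_bounded:
  assumes \<nu>: "normal_like \<nu>" and a: "\<And>u. a u \<in> Cinf \<Omega>"
    and bounded: "W_bounded s (\<lambda>f. \<Sum>u | length u = Suc s. LINT x|lebesgue_on \<Omega>. a u x * foldr D u f x)"
    and p: "p \<in> frontier \<Omega>"
  shows "symbol \<nu> (Suc s) a p = 0"
proof (rule ccontr)
  let ?N = "{u :: ('n + 'n) list. length u = Suc s}"
  assume nz: "symbol \<nu> (Suc s) a p \<noteq> 0"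
  obtain \<delta> \<sigma> :: real and r :: "'n cspace \<Rightarrow> real" and k
    where r: "\<delta> > 0" "\<bar>\<sigma>\<bar> = 1" "smooth_on UNIV r" "\<And>x. x \<in> ball p \<delta> \<Longrightarrow> x \<in> \<Omega> \<longleftrightarrow> r x < 0"
    "\<And>x. x \<in> ball p \<delta> \<Longrightarrow> x \<in> frontier \<Omega> \<longleftrightarrow> r x = 0" "\<And>x. x \<in> ball p \<delta> \<Longrightarrow> \<sigma> * D k r x > 0"
    using frontier_local_defining[OF smooth_domain p] by metis
  have pin: "p \<in> ball p \<delta>" using r(1) by simp
  define P where "P = (\<lambda>x. \<Sum>u\<in>?N. a u x * grad_word (\<lambda>x. complex_of_real (r x)) u x)"
  have "D k r p \<noteq> 0" using r(6)[OF pin] by auto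
  then have Pp: "P p \<noteq> 0"
    unfolding P_def using normal_like_symbol[OF \<nu> open_ball pin p r(3,4,5)] nz by blast
  have PC: "P \<in> Cinf \<Omega>"
    unfolding P_def by (intro Cinf_sum Cinf_mult a Cinf_I smooth_on_grad_word smooth_on_of_real r(3) open_UNIV)
  obtain U where U: "open U" "closure \<Omega> \<subseteq> U" "smooth_on U P" using Cinf_E[OF PC] .
  have "openin (top_of_set U) (U \<inter> P -` (- {0}))"
    using smooth_on_continuous_on[OF U(3)] by (intro continuous_openin_preimage_gen) auto
  then have oV: "open (U \<inter> P -` (- {0}))" using U(1) openin_open_trans by blast
  have "p \<in> U \<inter> P -` (- {0})" using Pp p U(2) by (auto simp: frontier_def)
  then obtain e0 where e0: "e0 > 0" "ball p e0 \<subseteq> U \<inter> P -` (- {0})" using oV open_contains_ball by blast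
  define \<epsilon> where "\<epsilon> = min \<delta> e0 / 2"
  have \<epsilon>: "\<epsilon> > 0" "\<epsilon> < \<delta>" "\<epsilon> < e0" using r(1) e0(1) by (auto simp: \<epsilon>_def)
  have in\<delta>: "x \<in> ball p \<delta>" if "x \<in> ball p \<epsilon>" for x using that \<epsilon> by simp
  show False
  proof (rule integral_D_bump_nonzero[OF p \<epsilon>(1) r(3) r(4)[OF in\<delta>] r(5)[OF in\<delta>] r(2) r(6)[OF in\<delta>]])
    fix \<theta>1 :: "'n cspace \<Rightarrow> complex"
    assume \<theta>1: "smooth_on UNIV \<theta>1" "\<And>x. x \<notin> ball p \<epsilon> \<Longrightarrow> \<theta>1 x = 0"
    let ?S = "cball p \<epsilon>"
    have S: "?S \<subseteq> ball p e0" "?S \<subseteq> ball p \<delta>" using \<epsilon> by auto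
    have \<theta>1S: "\<theta>1 x = 0" if "x \<notin> ?S" for x using that \<theta>1(2) by simp
    define \<theta> where "\<theta> = (\<lambda>x. \<theta>1 x * of_real (D k r x) * inverse (P x))"
    have \<theta>sm: "smooth_on UNIV \<theta>"
    proof (rule smooth_on_extend_by_0[OF open_ball _ closed_cball S(1)])
      show "smooth_on (ball p e0) \<theta>"
        unfolding \<theta>_def
      proof (intro smooth_on_mult smooth_on_inverse open_ball smooth_on_of_real)
        show "smooth_on (ball p e0) \<theta>1" using \<theta>1(1) smooth_on_subset by blast
        show "smooth_on (ball p e0) (D k r)" using smooth_on_D[OF r(3)] smooth_on_subset by blast
        show "smooth_on (ball p e0) P" using U(3) e0(2) smooth_on_subset by blast
      qed (use e0(2) in auto)
      show "\<theta> x = 0" if "x \<notin> ?S" for x using \<theta>1S[OF that] by (simp add: \<theta>_def)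
    qed
    have \<theta>0: "\<theta> x = 0" if "x \<notin> ?S" for x using \<theta>1S[OF that] by (simp add: \<theta>_def)
    have P\<theta>: "P x * \<theta> x = \<theta>1 x * of_real (D k r x)" for x
    proof (cases "x \<in> ?S")
      case True
      then have "P x \<noteq> 0" using S(1) e0(2) by blast
      then show ?thesis by (simp add: \<theta>_def)
    next
      case False then show ?thesis using \<theta>0 \<theta>1S by simp
    qed
    have neg: "r x < 0" if "x \<in> \<Omega>" "x \<in> ?S" for x using r(4) that S(2) by blast
    let ?t = "\<lambda>n::nat. real (Suc n)"
    let ?E = "\<lambda>n x. complex_of_real (exp (?t n * r x))"
    have lim: "(\<lambda>n. LINT x|lebesgue_on \<Omega>. of_real (?t n * exp (?t n * r x)) * (P x * \<theta> x)) \<longlonglongrightarrow> 0"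
      unfolding P_def by (rule concentration[OF bounded a r(3) neg \<theta>sm closed_cball \<theta>0])
    have \<theta>1C: "\<theta>1 \<in> Cinf \<Omega>" using \<theta>1(1) by (rule Cinf_I)
    have D\<theta>0: "D k \<theta>1 x = 0" if "x \<notin> ?S" for x
    proof -
      have "D k \<theta>1 x = D k (\<lambda>x. 0) x" by (rule D_cong_open[of "- ?S"]) (use that \<theta>1S in auto)
      then show ?thesis by simp
    qed
    have eq: "(LINT x|lebesgue_on \<Omega>. of_real (?t n * exp (?t n * r x)) * (P x * \<theta> x))
      = (LINT x|lebesgue_on \<Omega>. D k \<theta>1 x) - (LINT x|lebesgue_on \<Omega>. ?E n x * D k \<theta>1 x)" for n
    proof -
      have EC: "?E n \<in> Cinf \<Omega>" by (intro Cinf_I smooth_on_exp_complex r(3))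
      \<comment> \<open>Subtracting 1 does not change the derivative but makes the exponential
        vanish where \<open>r\<close> is 0, that is, on the frontier within the support of
        \<open>\<theta>1\<close>; so no boundary term arises.\<close>
      have E1C: "(\<lambda>x. ?E n x - 1) \<in> Cinf \<Omega>" by (intro Cinf_diff EC Cinf_const)
      have DE: "D k (\<lambda>x. ?E n x - 1) x = of_real (?t n * exp (?t n * r x) * D k r x)" if "x \<in> \<Omega>" for x
      proof -
        have "D k (\<lambda>x. ?E n x + (- 1)) x = D k (?E n) x + D k (\<lambda>x. - 1) x"
          by (intro D_add Cinf_differentiable[OF EC] domain_subset_closure[OF that]) simp
        then show ?thesis by (simp add: D_exp[OF r(3)])
      qed
      have "(LINT x|lebesgue_on \<Omega>. of_real (?t n * exp (?t n * r x)) * (P x * \<theta> x))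
        = (LINT x|lebesgue_on \<Omega>. \<theta>1 x * D k (\<lambda>x. ?E n x - 1) x)"
      proof (intro Bochner_Integration.integral_cong refl)
        fix x assume "x \<in> space (lebesgue_on \<Omega>)"
        then have x: "x \<in> \<Omega>" by simp
        show "of_real (?t n * exp (?t n * r x)) * (P x * \<theta> x) = \<theta>1 x * D k (\<lambda>x. ?E n x - 1) x"
          unfolding P\<theta> DE[OF x] by (simp add: mult_ac)
      qed
      also have "\<dots> = - (LINT x|lebesgue_on \<Omega>. D k \<theta>1 x * (?E n x - 1))"
      proof (rule integral_by_parts[OF \<theta>1C E1C])
        fix x assume "x \<in> frontier \<Omega>"
        then show "\<theta>1 x * (?E n x - 1) = 0" using r(5) S(2) \<theta>1S by (cases "x \<in> ?S") auto
      qed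
      also have "(LINT x|lebesgue_on \<Omega>. D k \<theta>1 x * (?E n x - 1))
        = (LINT x|lebesgue_on \<Omega>. ?E n x * D k \<theta>1 x) - (LINT x|lebesgue_on \<Omega>. D k \<theta>1 x)"
        using Cinf_integrable[OF Cinf_D[OF \<theta>1C]] Cinf_integrable[OF Cinf_mult[OF EC Cinf_D[OF \<theta>1C]]]
        by (subst Bochner_Integration.integral_diff[symmetric]) (simp_all add: algebra_simps)
      finally show ?thesis by simp
    qed
    obtain M where M: "\<And>x. x \<in> \<Omega> \<Longrightarrow> cmod (D k \<theta>1 x) \<le> M" using Cinf_bounded[OF Cinf_D[OF \<theta>1C]] by metis
    have "(\<lambda>n. LINT x|lebesgue_on \<Omega>. of_real (exp (real n * r x)) * D k \<theta>1 x) \<longlonglongrightarrow> 0"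
      by (rule integral_exp_mult_tendsto_0(1)[where S = ?S, OF r(3) neg]) (auto intro: Cinf_D \<theta>1C M simp: D\<theta>0)
    from LIMSEQ_Suc[OF this]
    have "(\<lambda>n. (LINT x|lebesgue_on \<Omega>. D k \<theta>1 x) - (LINT x|lebesgue_on \<Omega>. ?E n x * D k \<theta>1 x))
      \<longlonglongrightarrow> (LINT x|lebesgue_on \<Omega>. D k \<theta>1 x) - 0"
      by (intro tendsto_diff tendsto_const)
    from LIMSEQ_unique[OF this lim[unfolded eq]] show "(LINT x|lebesgue_on \<Omega>. D k \<theta>1 x) = 0" by simp
  qed
qed

end

section \<open>The signed distance\<close>

definition gradient :: "('n::finite cspace \<Rightarrow> real) \<Rightarrow> 'n cspace \<Rightarrow> 'n cspace" where
  "gradient r y = (\<Sum>k\<in>UNIV. D k r y *\<^sub>R unit_vec k)"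

definition hessian :: "('n::finite cspace \<Rightarrow> real) \<Rightarrow> 'n cspace \<Rightarrow> 'n cspace \<Rightarrow> 'n cspace" where
  "hessian r y v = (\<Sum>k\<in>UNIV. (\<Sum>j\<in>UNIV. (v \<bullet> unit_vec j) *\<^sub>R D j (D k r) y) *\<^sub>R unit_vec k)"

lemma gradient_inner: "gradient r y \<bullet> v = (\<Sum>k\<in>UNIV. (v \<bullet> unit_vec k) *\<^sub>R D k r y)"
  by (simp add: gradient_def inner_sum_left inner_commute[of v] mult.commute)

lemma gradient_inner_unit_vec: "gradient r y \<bullet> unit_vec k = D k r y"
  by (simp add: gradient_inner inner_unit_vec if_distrib[of "\<lambda>c. c * _"] cong: if_cong)

lemma has_derivative_gradient:
  assumes "r differentiable (at y)"
  shows "(r has_derivative (\<lambda>v. gradient r y \<bullet> v)) (at y)"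
  using has_derivative_sum_D[OF assms] by (simp add: gradient_inner)

lemma gradient_has_derivative_hessian:
  assumes "smooth_on UNIV r"
  shows "(gradient r has_derivative hessian r y) (at y)"
  unfolding gradient_def[abs_def] hessian_def[abs_def]
  by (intro has_derivative_sum has_derivative_scaleR_left has_derivative_sum_D
      smooth_on_differentiable[OF smooth_on_D[OF assms] UNIV_I])

text \<open>The polar cone of an open half-space is a ray. The component z of \<open>g\<close>
  orthogonal to \<open>a\<close> satisfies g . z = |z|^2, and z + \<epsilon> a lies in the
  half-space for every \<epsilon> > 0; letting \<epsilon> tend to 0 gives z = 0.\<close>

lemma eq_scaleR_if_halfspace:
  fixes a g :: "'a::real_inner"
  assumes "a \<noteq> 0" "\<And>w. w \<bullet> a > 0 \<Longrightarrow> g \<bullet> w \<le> 0"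
  obtains \<mu> where "\<mu> \<le> 0" "g = \<mu> *\<^sub>R a"
proof -
  have aa: "a \<bullet> a > 0" using assms(1) by simp
  define \<mu> where "\<mu> = (g \<bullet> a) / (a \<bullet> a)"
  have ga: "g \<bullet> a \<le> 0" using assms(2)[OF aa] .
  define z where "z = g - \<mu> *\<^sub>R a"
  have za: "z \<bullet> a = 0" using aa by (simp add: z_def \<mu>_def inner_diff_left)
  have gz: "g \<bullet> z = z \<bullet> z" using za by (simp add: z_def inner_diff_left inner_commute)
  have "z \<bullet> z \<le> 0"
  proof (rule field_le_epsilon)
    fix e :: real assume e: "e > 0"
    define \<epsilon> where "\<epsilon> = e / (1 - g \<bullet> a)"
    have \<epsilon>: "\<epsilon> > 0" using e ga by (simp add: \<epsilon>_def)
    have "(z + \<epsilon> *\<^sub>R a) \<bullet> a > 0" using za \<epsilon> aa by (simp add: inner_add_left)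
    from assms(2)[OF this] have "z \<bullet> z \<le> \<epsilon> * (- (g \<bullet> a))" using gz by (simp add: inner_add_right)
    also have "\<dots> \<le> \<epsilon> * (1 - g \<bullet> a)" using \<epsilon> by (intro mult_left_mono) auto
    also have "\<dots> = e" using ga by (simp add: \<epsilon>_def)
    finally show "z \<bullet> z \<le> 0 + e" by simp
  qed
  then have "z \<bullet> z = 0" by (intro antisym) simp_all
  then have "z = 0" by (simp only: inner_eq_zero_iff)
  then have "g = \<mu> *\<^sub>R a" by (simp add: z_def)
  moreover have "\<mu> \<le> 0" unfolding \<mu>_def using ga aa by (rule divide_nonpos_pos)
  ultimately show thesis by (intro that)
qed

text \<open>Fermat's interior extremum argument on the largest ball around \<open>x\<close> that avoids the frontier.\<close>

lemma gradient_at_nearest_point: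
  fixes x y :: "'n::finite cspace"
  assumes "r differentiable (at y)" "x \<noteq> y" "r y = (0::real)"
    "\<And>z. z \<in> ball x (dist x y) \<Longrightarrow> \<kappa> * r z \<le> 0"
  obtains \<mu> where "\<mu> \<le> 0" "\<kappa> *\<^sub>R gradient r y = \<mu> *\<^sub>R (x - y)"
proof (rule eq_scaleR_if_halfspace[of "x - y" "\<kappa> *\<^sub>R gradient r y"])
  show "x - y \<noteq> 0" using assms(2) by simp
  fix w assume w: "w \<bullet> (x - y) > 0"
  have "((\<lambda>s. y + s *\<^sub>R w) has_derivative (\<lambda>s. s *\<^sub>R w)) (at 0)" by (auto intro!: derivative_eq_intros)
  from has_derivative_compose[OF this, of r "\<lambda>v. gradient r y \<bullet> v"] has_derivative_gradient[OF assms(1)]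
  have "((\<lambda>s. r (y + s *\<^sub>R w)) has_real_derivative gradient r y \<bullet> w) (at 0)"
    by (simp add: has_field_derivative_def mult_commute_abs)
  from DERIV_cmult[OF this] have "((\<lambda>s. \<kappa> * r (y + s *\<^sub>R w)) has_real_derivative \<kappa> * (gradient r y \<bullet> w)) (at 0)" .
  then have der: "((\<lambda>s. \<kappa> * r (y + s *\<^sub>R w)) has_real_derivative (\<kappa> *\<^sub>R gradient r y) \<bullet> w) (at 0)" by simp
  show "(\<kappa> *\<^sub>R gradient r y) \<bullet> w \<le> 0"
  proof (rule ccontr)
    assume "\<not> (\<kappa> *\<^sub>R gradient r y) \<bullet> w \<le> 0"
    then obtain d where d: "d > 0" "\<And>s. s > 0 \<Longrightarrow> s < d \<Longrightarrow> \<kappa> * r (y + s *\<^sub>R w) > \<kappa> * r (y + 0 *\<^sub>R w)"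
      using DERIV_pos_inc_right[OF der] by auto
    have ww: "w \<bullet> w > 0" using w by (auto simp: inner_gt_zero_iff)
    \<comment> \<open>The second bound ensures s |w|^2 \<le> w . (x - y), which keeps y + s w
      strictly closer to \<open>x\<close> than \<open>y\<close> is, hence inside the ball.\<close>
    define s where "s = min (d / 2) ((w \<bullet> (x - y)) / (w \<bullet> w))"
    have s: "s > 0" "s < d" "s * (w \<bullet> w) \<le> w \<bullet> (x - y)"
      using d(1) w ww by (auto simp: s_def min_def field_simps)
    have "(dist x (y + s *\<^sub>R w))\<^sup>2 = (dist x y)\<^sup>2 - 2 * s * (w \<bullet> (x - y)) + s * (s * (w \<bullet> w))"
      unfolding dist_norm power2_norm_eq_inner
      by (simp add: algebra_simps inner_commute)
    also have "\<dots> \<le> (dist x y)\<^sup>2 - 2 * s * (w \<bullet> (x - y)) + s * (w \<bullet> (x - y))"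
      using s by simp
    also have "\<dots> < (dist x y)\<^sup>2" using s(1) w by simp
    finally have "dist x (y + s *\<^sub>R w) < dist x y" by (rule power2_less_imp_less) simp
    then have "\<kappa> * r (y + s *\<^sub>R w) \<le> 0" using assms(4) by simp
    then show False using d(2)[OF s(1,2)] assms(3) by simp
  qed
qed (use that in blast)

text \<open>The map \<open>(y, t) \<mapsto> (y + t * gradient r y, r y)\<close> is locally invertible; over \<open>(x, 0)\<close> its inverse gives
  the foot of the perpendicular from \<open>x\<close> to the zero set of \<open>r\<close>.\<close>

lemma foot_point_exists:
  fixes r :: "'n::finite cspace \<Rightarrow> real"
  assumes r: "smooth_on UNIV r" and Z: "open Z" "p \<in> Z" and rp: "r p = 0" and g: "gradient r p \<noteq> 0"
  obtains U' Y T Os where "open U'" "(p, 0) \<in> U'" "U' \<subseteq> Z \<times> (UNIV :: real set)" "open Os" "p \<in> Os"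
    "\<And>x. x \<in> Os \<Longrightarrow> (Y x, T x) \<in> U'"
    "\<And>x. x \<in> Os \<Longrightarrow> x = Y x + T x *\<^sub>R gradient r (Y x)" "\<And>x. x \<in> Os \<Longrightarrow> r (Y x) = 0"
    "\<And>x y t. x \<in> Os \<Longrightarrow> (y, t) \<in> U' \<Longrightarrow> x = y + t *\<^sub>R gradient r y \<Longrightarrow> r y = 0 \<Longrightarrow> Y x = y \<and> T x = t"
    "\<And>x. x \<in> Os \<Longrightarrow> Y differentiable (at x)"
proof -
  let ?G = "\<lambda>z :: 'n cspace \<times> real. (fst z + snd z *\<^sub>R gradient r (fst z), r (fst z))"
  define G' where "G' = (\<lambda>(z :: 'n cspace \<times> real) (h :: 'n cspace \<times> real).
    (fst h + (snd z *\<^sub>R hessian r (fst z) (fst h) + snd h *\<^sub>R gradient r (fst z)), gradient r (fst z) \<bullet> fst h))"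
  have der: "(?G has_derivative G' z) (at z)" for z
    unfolding G'_def
    by (intro has_derivative_Pair has_derivative_add has_derivative_scaleR has_derivative_fst has_derivative_snd has_derivative_ident
        has_derivative_compose[OF has_derivative_fst[OF has_derivative_ident], of "gradient r"]
        has_derivative_compose[OF has_derivative_fst[OF has_derivative_ident], of r]
        gradient_has_derivative_hessian[OF r] has_derivative_gradient smooth_on_differentiable[OF r UNIV_I])
  have bl: "bounded_linear (G' z)" for z using der by (rule has_derivative_bounded_linear)
  define F' where "F' = (\<lambda>z. Blinfun (G' z))"
  have F': "blinfun_apply (F' z) = G' z" for z unfolding F'_def by (rule bounded_linear_Blinfun_apply[OF bl])
  have cD: "continuous_on UNIV (D j (D k r))" "continuous_on UNIV (D k r)" for j k
    by (intro smooth_on_continuous_on smooth_on_D r)+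
  have cg: "continuous_on UNIV (gradient r)" unfolding gradient_def[abs_def] by (intro continuous_intros cD)
  have ch: "continuous_on UNIV (\<lambda>y. hessian r y v)" for v unfolding hessian_def by (intro continuous_intros cD)
  have cF: "continuous_on (Z \<times> UNIV) F'"
  proof (rule continuous_on_blinfun_componentwise)
    fix i :: "'n cspace \<times> real"
    show "continuous_on (Z \<times> UNIV) (\<lambda>z. blinfun_apply (F' z) i)"
      unfolding F' G'_def
      by (intro continuous_intros continuous_on_compose2[OF cg] continuous_on_compose2[OF ch]) auto
  qed
  let ?g = "gradient r p"
  have gg: "?g \<bullet> ?g > 0" using g by simp
  \<comment> \<open>The explicit inverse of the derivative at (p, 0), which sends (v, \<tau>) to (v
    + \<tau> g, g . v): the inner product of the first component with g determines \<tau>, and then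
    v follows.\<close>
  define I where "I = (\<lambda>h :: 'n cspace \<times> real. let t = (?g \<bullet> fst h - snd h) / (?g \<bullet> ?g) in (fst h - t *\<^sub>R ?g, t))"
  have lI: "linear I"
    by (rule linearI) (auto simp: I_def Let_def inner_add_right algebra_simps add_divide_distrib diff_divide_distrib)
  have I: "blinfun_apply (Blinfun I) = I"
    using lI by (intro bounded_linear_Blinfun_apply) (simp add: linear_conv_bounded_linear)
  have inv: "Blinfun I o\<^sub>L F' (p, 0) = id_blinfun"
  proof (rule blinfun_eqI)
    fix h :: "'n cspace \<times> real"
    have "(?g \<bullet> (fst h + snd h *\<^sub>R ?g) - ?g \<bullet> fst h) / (?g \<bullet> ?g) = snd h"
      using gg by (simp add: inner_add_right)
    then have "I (G' (p, 0) h) = h" by (simp add: G'_def I_def Let_def prod_eq_iff)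
    then show "blinfun_apply (Blinfun I o\<^sub>L F' (p, 0)) h = blinfun_apply id_blinfun h" by (simp add: I F')
  qed
  have oW: "open (Z \<times> (UNIV :: real set))" using Z by (simp add: open_Times)
  have pin: "(p, 0) \<in> Z \<times> (UNIV :: real set)" using Z by simp
  obtain U' V gI gI' where ift: "open U'" "U' \<subseteq> Z \<times> (UNIV :: real set)" "(p, 0) \<in> U'" "open V" "?G (p, 0) \<in> V"
    "homeomorphism U' V ?G gI" "\<And>y. y \<in> V \<Longrightarrow> (gI has_derivative gI' y) (at y)"
    by (rule inverse_function_theorem[OF oW der[folded F'] cF pin inv]) (rule that)
  define Os where "Os = (\<lambda>x. (x, 0 :: real)) -` V"
  have "open Os" unfolding Os_def by (intro open_vimage ift(4) continuous_intros)
  moreover have "p \<in> Os" using ift(5) rp by (simp add: Os_def)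
  moreover have hom: "gI z \<in> U'" "?G (gI z) = z" if "z \<in> V" for z
    using ift(6) that by (auto simp: homeomorphism_def)
  moreover have "fst (gI (y + t *\<^sub>R gradient r y, 0)) = y \<and> snd (gI (y + t *\<^sub>R gradient r y, 0)) = t"
    if "(y, t) \<in> U'" "r y = 0" for y t
  proof -
    have "gI (?G (y, t)) = (y, t)" using ift(6) that(1) unfolding homeomorphism_def by blast
    then show ?thesis using that(2) by simp
  qed
  moreover have "(\<lambda>x. fst (gI (x, 0))) differentiable (at x)" if "x \<in> Os" for x
  proof -
    have "((\<lambda>x. (x, 0 :: real)) has_derivative (\<lambda>v. (v, 0))) (at x)" by (auto intro!: derivative_eq_intros)
    from has_derivative_fst[OF has_derivative_compose[OF this ift(7)]] that show ?thesis
      by (auto simp: Os_def differentiable_def)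
  qed
  ultimately show thesis
    by (intro that[of U' Os "\<lambda>x. fst (gI (x, 0))" "\<lambda>x. snd (gI (x, 0))"] ift(1,2,3)) (auto simp: Os_def prod_eq_iff)
qed

context smooth_domain
begin

section \<open>The signed distance near the frontier and its gradient\<close>

lemma infdist_frontier_attained:
  assumes "frontier \<Omega> \<noteq> {}"
  obtains y where "y \<in> frontier \<Omega>" "infdist x (frontier \<Omega>) = dist x y"
  using infdist_attains_inf[OF frontier_closed assms] by metis

text \<open>A nearest frontier point \<open>y\<close> of \<open>x\<close> is a zero of
  \<open>r\<close> at which the gradient is parallel to x - y, and the sign of the factor tells on
  which side of the frontier \<open>x\<close> lies. For \<open>x\<close> close to \<open>p\<close>
  the pair \<open>(y, t)\<close> falls into the given neighbourhood, where
  \<open>foot_point_exists\<close> makes such pairs unique.\<close>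

lemma signed_dist_foot_point:
  fixes r :: "'n cspace \<Rightarrow> real"
  assumes p: "p \<in> frontier \<Omega>" and B: "open B" "p \<in> B" and r: "smooth_on UNIV r"
    and rB: "\<And>y. y \<in> B \<Longrightarrow> y \<in> \<Omega> \<longleftrightarrow> r y < 0" "\<And>y. y \<in> B \<Longrightarrow> y \<in> frontier \<Omega> \<longleftrightarrow> r y = 0"
    and g: "gradient r p \<noteq> 0" and U': "open U'" "(p, 0) \<in> U'"
  shows "\<exists>\<epsilon>>0. \<forall>x\<in>ball p \<epsilon>. \<exists>y t. (y, t) \<in> U' \<and> x = y + t *\<^sub>R gradient r y \<and> r y = 0 \<and>
    signed_dist \<Omega> x = t * norm (gradient r y)"
proof -
  have cg: "continuous_on UNIV (\<lambda>y. norm (gradient r y))"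
    unfolding gradient_def by (intro continuous_intros smooth_on_continuous_on smooth_on_D r)
  define m where "m = norm (gradient r p) / 2"
  have m: "m > 0" "norm (gradient r p) > m" using g by (auto simp: m_def)
  have "open {y. norm (gradient r y) > m}" by (intro open_Collect_less continuous_on_const cg)
  then obtain d1 where d1: "d1 > 0" "ball p d1 \<subseteq> {y. norm (gradient r y) > m}"
    using m(2) open_contains_ball by blast
  obtain d2 where d2: "d2 > 0" "ball p d2 \<subseteq> B" using B open_contains_ball by blast
  obtain A1 A2 where A: "open A1" "open A2" "(p, 0) \<in> A1 \<times> A2" "A1 \<times> A2 \<subseteq> U'"
    using open_prod_elim[OF U'(1) U'(2)] by metis
  obtain d3 where d3: "d3 > 0" "ball p d3 \<subseteq> A1" using A open_contains_ball by blast
  obtain d4 where d4: "d4 > 0" "ball 0 d4 \<subseteq> A2" using A open_contains_ball by blast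
  \<comment> \<open>The nearest point is within \<open>2 * \<epsilon>\<close> of \<open>p\<close>,
    which explains the halving. Since |t| times the norm of the gradient is the distance and that
    norm exceeds \<open>m\<close>, the bound \<open>d4 * m\<close> on the distance yields |t| <
    \<open>d4\<close>.\<close>
  define \<epsilon> where "\<epsilon> = min (min d1 d2) (min d3 (d4 * m)) / 2"
  have \<epsilon>: "\<epsilon> > 0" "2 * \<epsilon> \<le> d1" "2 * \<epsilon> \<le> d2" "2 * \<epsilon> \<le> d3" "\<epsilon> < d4 * m"
    using d1 d2 d3 d4 m by (auto simp: \<epsilon>_def min_def)
  have "\<exists>y t. (y, t) \<in> U' \<and> x = y + t *\<^sub>R gradient r y \<and> r y = 0 \<and> signed_dist \<Omega> x = t * norm (gradient r y)"
    if x: "x \<in> ball p \<epsilon>" for x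
  proof -
    obtain y where y: "y \<in> frontier \<Omega>" "infdist x (frontier \<Omega>) = dist x y"
      using infdist_frontier_attained p by blast
    have dxy: "dist x y < \<epsilon>" using infdist_le[OF p, of x] y(2) x by (simp add: dist_commute)
    have yp: "dist p y < 2 * \<epsilon>" using dxy x dist_triangle[of p y x] by simp
    then have yB: "y \<in> B" using d2(2) \<epsilon>(3) by (auto simp: subset_iff)
    have ym: "norm (gradient r y) > m" using subsetD[OF d1(2), of y] \<epsilon>(2) yp by simp
    have yA: "y \<in> A1" using subsetD[OF d3(2), of y] \<epsilon>(4) yp by simp
    have ry: "r y = 0" using rB(2)[OF yB] y(1) by simp
    show ?thesis
    proof (cases "x = y")
      case True
      have "0 \<in> A2" using A(3) by simp
      moreover have "signed_dist \<Omega> x = 0" using y(2) True by (simp add: signed_dist_def)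
      ultimately show ?thesis using yA A(4) ry True by (intro exI[of _ y] exI[of _ 0]) auto
    next
      case False
      \<comment> \<open>The side of \<open>x\<close>. The ball around \<open>x\<close> up to the
        nearest point is connected and misses the frontier, so it stays on this side and
        \<open>\<kappa> * r\<close> is nonpositive on it.\<close>
      define \<kappa> :: real where "\<kappa> = (if x \<in> \<Omega> then 1 else - 1)"
      have nofr: "ball x (dist x y) \<inter> frontier \<Omega> = {}"
        using infdist_le[of _ "frontier \<Omega>" x] y(2) by fastforce
      have xin: "x \<in> ball x (dist x y)" using False by simp
      have "\<kappa> * r z \<le> 0" if z: "z \<in> ball x (dist x y)" for z
      proof -
        have "dist p z < 2 * \<epsilon>" using z dxy x dist_triangle[of p z x] by simp
        then have zB: "z \<in> B" using d2(2) \<epsilon>(3) by (auto simp: subset_iff)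
        have "x \<in> \<Omega> \<longleftrightarrow> z \<in> \<Omega>"
          using connected_Int_frontier[OF connected_ball, of x "dist x y" \<Omega>] nofr xin z by blast
        then show ?thesis using rB(1)[OF zB] by (auto simp: \<kappa>_def)
      qed
      then obtain \<mu> where \<mu>: "\<mu> \<le> 0" "\<kappa> *\<^sub>R gradient r y = \<mu> *\<^sub>R (x - y)"
        using gradient_at_nearest_point[OF smooth_on_differentiable[OF r UNIV_I] False ry] by blast
      have \<kappa>: "\<kappa> * \<kappa> = 1" "\<bar>\<kappa>\<bar> = 1" by (auto simp: \<kappa>_def)
      have "\<kappa> *\<^sub>R gradient r y \<noteq> 0" using ym m(1) \<kappa> by auto
      then have \<mu>0: "\<mu> < 0" using \<mu> by (cases "\<mu> = 0") auto
      define t where "t = \<kappa> / \<mu>"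
      have xy: "x - y = t *\<^sub>R gradient r y"
      proof -
        have "t *\<^sub>R gradient r y = (1 / \<mu>) *\<^sub>R (\<kappa> *\<^sub>R gradient r y)" by (simp add: t_def)
        then show ?thesis using \<mu>(2) \<mu>0 by simp
      qed
      have tabs: "\<bar>t\<bar> = - \<kappa> * t" using \<kappa> \<mu>0 by (simp add: t_def abs_divide abs_of_neg)
      have d: "dist x y = \<bar>t\<bar> * norm (gradient r y)" using xy by (simp add: dist_norm)
      have "\<bar>t\<bar> * m \<le> \<bar>t\<bar> * norm (gradient r y)" using ym by (intro mult_left_mono) auto
      then have "\<bar>t\<bar> * m < d4 * m" using d dxy \<epsilon>(5) by linarith
      then have "t \<in> A2" using d4(2) m(1) by (auto simp: subset_iff)
      moreover have "signed_dist \<Omega> x = - \<kappa> * dist x y" using y(2) by (simp add: signed_dist_def \<kappa>_def)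
      then have "signed_dist \<Omega> x = (\<kappa> * \<kappa>) * t * norm (gradient r y)" unfolding d tabs by simp
      ultimately show ?thesis using yA A(4) ry xy \<kappa>(1) by (intro exI[of _ y] exI[of _ t]) (auto simp: algebra_simps)
    qed
  qed
  then show ?thesis using \<epsilon>(1) by blast
qed

text \<open>Near the frontier, x = Y(x) + d(x) N(x) with d the signed distance, Y the foot point and
  N the unit normal at Y, so d = (x - Y) . N. On differentiation two terms drop out: dY is
  orthogonal to N because r(Y) = 0, and dN is orthogonal to N because |N| = 1. Hence the gradient of
  d is N. It is differentiable since Y is, and it is constant along the normal line because the foot
  point does not move there; this is the identity with the sum over \<open>k\<close>.\<close>

lemma signed_dist_local:
  fixes r :: "'n cspace \<Rightarrow> real"
  assumes p: "p \<in> frontier \<Omega>" and B: "open B" "p \<in> B" and r: "smooth_on UNIV r"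
    and rB: "\<And>y. y \<in> B \<Longrightarrow> y \<in> \<Omega> \<longleftrightarrow> r y < 0" "\<And>y. y \<in> B \<Longrightarrow> y \<in> frontier \<Omega> \<longleftrightarrow> r y = 0"
    and g: "gradient r p \<noteq> 0"
  obtains Os where "open Os" "p \<in> Os" "\<And>x. x \<in> Os \<Longrightarrow> signed_dist \<Omega> differentiable (at x)"
    "\<And>k x. x \<in> Os \<Longrightarrow> D k (signed_dist \<Omega>) differentiable (at x)"
    "\<And>j x. x \<in> Os \<Longrightarrow> (\<Sum>k\<in>UNIV. D k (signed_dist \<Omega>) x * D k (D j (signed_dist \<Omega>)) x) = 0"
    "\<And>k. D k (signed_dist \<Omega>) p = D k r p / norm (gradient r p)"
proof -
  define Z where "Z = {y. gradient r y \<noteq> 0}"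
  have cg: "continuous_on UNIV (gradient r)"
    unfolding gradient_def[abs_def] by (intro continuous_intros smooth_on_continuous_on smooth_on_D r)
  have "open Z" unfolding Z_def by (rule open_Collect_neq[OF cg continuous_on_const])
  have pW: "p \<in> Z" using g by (simp add: Z_def)
  have rp: "r p = 0" using rB(2)[OF B(2)] p by simp
  obtain U' Y T O1 where ft: "open U'" "(p, 0) \<in> U'" "U' \<subseteq> Z \<times> (UNIV :: real set)" "open O1" "p \<in> O1"
    "\<And>x. x \<in> O1 \<Longrightarrow> (Y x, T x) \<in> U'"
    "\<And>x. x \<in> O1 \<Longrightarrow> x = Y x + T x *\<^sub>R gradient r (Y x)" "\<And>x. x \<in> O1 \<Longrightarrow> r (Y x) = 0"
    "\<And>x y t. x \<in> O1 \<Longrightarrow> (y, t) \<in> U' \<Longrightarrow> x = y + t *\<^sub>R gradient r y \<Longrightarrow> r y = 0 \<Longrightarrow> Y x = y \<and> T x = t"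
    "\<And>x. x \<in> O1 \<Longrightarrow> Y differentiable (at x)"
    by (rule foot_point_exists[OF r \<open>open Z\<close> pW rp g]; (rule that; assumption))
  obtain \<epsilon> where \<epsilon>: "\<epsilon> > 0" "\<And>x. x \<in> ball p \<epsilon> \<Longrightarrow> \<exists>y t. (y, t) \<in> U' \<and> x = y + t *\<^sub>R gradient r y \<and> r y = 0 \<and>
    signed_dist \<Omega> x = t * norm (gradient r y)"
    using signed_dist_foot_point[OF p B r rB g ft(1,2)] by blast
  define Os where "Os = O1 \<inter> ball p \<epsilon>"
  have oO: "open Os" "p \<in> Os" using ft(4,5) \<epsilon>(1) by (auto simp: Os_def)
  have OO: "x \<in> O1" if "x \<in> Os" for x using that by (simp add: Os_def)
  define n where "n = (\<lambda>y. inverse (norm (gradient r y)) *\<^sub>R gradient r y)"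
  define N where "N = (\<lambda>x. n (Y x))"
  have gY: "gradient r (Y x) \<noteq> 0" if "x \<in> Os" for x using ft(3,6) OO[OF that] by (auto simp: Z_def)
  have nn: "n y \<bullet> n y = 1" if "gradient r y \<noteq> 0" for y
    using that by (simp add: n_def dot_square_norm power2_eq_square)
  have sd: "signed_dist \<Omega> x = T x * norm (gradient r (Y x))" if x: "x \<in> Os" for x
  proof -
    obtain y t where "(y, t) \<in> U'" "x = y + t *\<^sub>R gradient r y" "r y = 0" "signed_dist \<Omega> x = t * norm (gradient r y)"
      using \<epsilon>(2)[of x] x by (auto simp: Os_def)
    then show ?thesis using ft(9)[OF OO[OF x]] by metis
  qed
  have xY: "x - Y x = signed_dist \<Omega> x *\<^sub>R N x" if x: "x \<in> Os" for x
  proof -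
    have "signed_dist \<Omega> x *\<^sub>R N x = T x *\<^sub>R gradient r (Y x)"
      using gY[OF x] by (simp add: sd[OF x] N_def n_def)
    moreover have "x - Y x = T x *\<^sub>R gradient r (Y x)" using ft(7)[OF OO[OF x]] by (metis add_diff_cancel_left')
    ultimately show ?thesis by simp
  qed
  have sd': "signed_dist \<Omega> x = (x - Y x) \<bullet> N x" if x: "x \<in> Os" for x
    unfolding xY[OF x] using nn[OF gY[OF x]] by (simp add: N_def)
  have nd: "n differentiable (at y)" if "gradient r y \<noteq> 0" for y
  proof -
    have gd: "gradient r differentiable (at y)"
      using gradient_has_derivative_hessian[OF r] by (auto simp: differentiable_def)
    have "(\<lambda>y. norm (gradient r y)) differentiable (at y)"
      using differentiable_compose[OF differentiable_norm_at[OF that] gd] .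
    then show ?thesis unfolding n_def using that gd by (intro differentiable_scaleR differentiable_inverse) auto
  qed
  have Nd: "N differentiable (at x)" if x: "x \<in> Os" for x
    unfolding N_def by (rule differentiable_compose[OF nd[OF gY[OF x]] ft(10)[OF OO[OF x]]])
  have der: "(signed_dist \<Omega> has_derivative (\<lambda>v. v \<bullet> N x)) (at x)" if x: "x \<in> Os" for x
  proof -
    define Y' where "Y' = frechet_derivative Y (at x)"
    define N' where "N' = frechet_derivative N (at x)"
    have dY: "(Y has_derivative Y') (at x)" using ft(10)[OF OO[OF x]] by (simp add: Y'_def frechet_derivative_works)
    have dN: "(N has_derivative N') (at x)" using Nd[OF x] by (simp add: N'_def frechet_derivative_works)
    have NY: "N x \<bullet> Y' v = 0" for v
    proof -
      have d1: "((\<lambda>x. r (Y x)) has_derivative (\<lambda>v. gradient r (Y x) \<bullet> Y' v)) (at x)"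
        by (rule has_derivative_compose[OF dY has_derivative_gradient[OF smooth_on_differentiable[OF r UNIV_I]]])
      have d2: "((\<lambda>x. r (Y x)) has_derivative (\<lambda>v. 0)) (at x)"
        by (rule has_derivative_transform_within_open[OF has_derivative_const oO(1) x]) (simp add: ft(8) OO)
      have "gradient r (Y x) \<bullet> Y' v = 0" by (rule fun_cong[OF has_derivative_unique[OF d1 d2]])
      then show ?thesis by (simp add: N_def n_def)
    qed
    have NN: "N x \<bullet> N' v = 0" for v
    proof -
      have d1: "((\<lambda>x. N x \<bullet> N x) has_derivative (\<lambda>v. N x \<bullet> N' v + N' v \<bullet> N x)) (at x)"
        by (rule has_derivative_inner[OF dN dN])
      have d2: "((\<lambda>x. N x \<bullet> N x) has_derivative (\<lambda>v. 0)) (at x)"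
        by (rule has_derivative_transform_within_open[OF has_derivative_const oO(1) x]) (use nn gY in \<open>simp add: N_def\<close>)
      have "N x \<bullet> N' v + N' v \<bullet> N x = 0" by (rule fun_cong[OF has_derivative_unique[OF d1 d2]])
      then show ?thesis by (simp add: inner_commute)
    qed
    have "((\<lambda>x. (x - Y x) \<bullet> N x) has_derivative (\<lambda>v. (x - Y x) \<bullet> N' v + (v - Y' v) \<bullet> N x)) (at x)"
      by (intro has_derivative_inner has_derivative_diff has_derivative_ident dY dN)
    moreover have "(x - Y x) \<bullet> N' v + (v - Y' v) \<bullet> N x = v \<bullet> N x" for v
      unfolding xY[OF x] using NN[of v] NY[of v] by (simp add: inner_diff_left inner_commute[of "Y' v"])
    ultimately have "((\<lambda>x. (x - Y x) \<bullet> N x) has_derivative (\<lambda>v. v \<bullet> N x)) (at x)" by simp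
    then show ?thesis
      by (rule has_derivative_transform_within_open[OF _ oO(1) x]) (simp add: sd')
  qed
  have Dk: "D k (signed_dist \<Omega>) x = unit_vec k \<bullet> N x" if "x \<in> Os" for k x
    by (rule D_eqI[OF der[OF that]])
  have innerd: "(\<lambda>x. unit_vec k \<bullet> N x) differentiable (at x)" if "x \<in> Os" for k x
    by (rule differentiable_bounded_linear[OF bounded_linear_inner_right Nd[OF that]])
  have Dd: "D k (signed_dist \<Omega>) differentiable (at x)" if x: "x \<in> Os" for k x
    using innerd[OF x] differentiable_cong_open[OF oO(1) x, of "D k (signed_dist \<Omega>)" "\<lambda>x. unit_vec k \<bullet> N x"] Dk by blast
  have flow: "(\<Sum>k\<in>UNIV. D k (signed_dist \<Omega>) x * D k (D j (signed_dist \<Omega>)) x) = 0" if x: "x \<in> Os" for j x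
  proof -
    have "(\<Sum>k\<in>UNIV. D k (signed_dist \<Omega>) x * D k (D j (signed_dist \<Omega>)) x)
      = frechet_derivative (D j (signed_dist \<Omega>)) (at x) (N x)"
      unfolding frechet_derivative_eq_sum_D[OF Dd[OF x]] Dk[OF x] by (simp add: inner_commute)
    moreover have "frechet_derivative (D j (signed_dist \<Omega>)) (at x) (N x) = 0"
    proof -
      let ?c = "inverse (norm (gradient r (Y x)))"
      have line: "((\<lambda>h. x + h *\<^sub>R N x) has_derivative (\<lambda>h. h *\<^sub>R N x)) (at 0)" by (auto intro!: derivative_eq_intros)
      have "(D j (signed_dist \<Omega>) has_derivative frechet_derivative (D j (signed_dist \<Omega>)) (at x)) (at (x + 0 *\<^sub>R N x))"
        using Dd[OF x] by (simp add: frechet_derivative_works)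
      from has_derivative_compose[OF line this]
      have d1: "((\<lambda>h. D j (signed_dist \<Omega>) (x + h *\<^sub>R N x)) has_derivative
        (\<lambda>h. frechet_derivative (D j (signed_dist \<Omega>)) (at x) (h *\<^sub>R N x))) (at 0)" .
      \<comment> \<open>A step \<open>h\<close> along \<open>N x\<close> keeps the foot point and
        changes \<open>T\<close> by h divided by the norm of the gradient. For \<open>h\<close> in
        this open set the new pair is still in the region where foot points are unique.\<close>
      define A where "A = {h. x + h *\<^sub>R N x \<in> Os \<and> (Y x, T x + h * ?c) \<in> U'}"
      have "A = (\<lambda>h. x + h *\<^sub>R N x) -` Os \<inter> (\<lambda>h. (Y x, T x + h * ?c)) -` U'" by (auto simp: A_def)
      moreover have "open ((\<lambda>h. x + h *\<^sub>R N x) -` Os)" "open ((\<lambda>h. (Y x, T x + h * ?c)) -` U')"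
        by (intro open_vimage oO(1) ft(1) continuous_intros)+
      ultimately have oA: "open A" by (simp add: open_Int)
      have A0: "0 \<in> A" using x ft(6)[OF OO[OF x]] by (simp add: A_def)
      have const: "D j (signed_dist \<Omega>) (x + h *\<^sub>R N x) = D j (signed_dist \<Omega>) x" if h: "h \<in> A" for h
      proof -
        have hO: "x + h *\<^sub>R N x \<in> Os" "(Y x, T x + h * ?c) \<in> U'" using h by (auto simp: A_def)
        have "x + h *\<^sub>R N x = (Y x + T x *\<^sub>R gradient r (Y x)) + h *\<^sub>R N x" using ft(7)[OF OO[OF x]] by simp
        also have "\<dots> = Y x + (T x + h * ?c) *\<^sub>R gradient r (Y x)"
          by (simp add: N_def n_def scaleR_add_left add.assoc)
        finally have "Y (x + h *\<^sub>R N x) = Y x" using ft(9)[OF OO[OF hO(1)] hO(2) _ ft(8)[OF OO[OF x]]] by blast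
        then show ?thesis using Dk[OF hO(1)] Dk[OF x] by (simp add: N_def)
      qed
      have d2: "((\<lambda>h. D j (signed_dist \<Omega>) (x + h *\<^sub>R N x)) has_derivative (\<lambda>h. 0)) (at 0)"
        by (rule has_derivative_transform_within_open[OF has_derivative_const oA A0]) (simp add: const)
      have "frechet_derivative (D j (signed_dist \<Omega>)) (at x) (1 *\<^sub>R N x) = 0"
        by (rule fun_cong[OF has_derivative_unique[OF d1 d2]])
      then show ?thesis by simp
    qed
    ultimately show ?thesis by simp
  qed
  have "Y p = p" using ft(9)[OF ft(5,2)] rp by simp
  then have Dp: "D k (signed_dist \<Omega>) p = D k r p / norm (gradient r p)" for k
    using Dk[OF oO(2), of k] by (simp add: N_def n_def inner_commute[of "unit_vec _"] gradient_inner_unit_vec divide_inverse mult.commute)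
  have "signed_dist \<Omega> differentiable (at x)" if "x \<in> Os" for x using der[OF that] by (auto simp: differentiable_def)
  then show thesis using that[OF oO _ Dd flow Dp] by blast
qed

lemma normal_like_signed_dist: "normal_like (\<lambda>k. D k (signed_dist \<Omega>))"
  unfolding normal_like_def
proof (intro allI impI)
  fix r :: "'n cspace \<Rightarrow> real" and B x
  assume a: "open B" "x \<in> B" "x \<in> frontier \<Omega>" "smooth_on UNIV r"
    "\<forall>y\<in>B. (y \<in> \<Omega> \<longleftrightarrow> r y < 0) \<and> (y \<in> frontier \<Omega> \<longleftrightarrow> r y = 0)" "\<exists>k. D k r x \<noteq> 0"
  have g: "gradient r x \<noteq> 0" using a(6) gradient_inner_unit_vec[of r x] by (metis inner_zero_left)
  obtain Os where "\<And>k. D k (signed_dist \<Omega>) x = D k r x / norm (gradient r x)"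
    using signed_dist_local[OF a(3,1,2,4) _ _ g] a(5) by blast
  then show "\<exists>c. c \<noteq> 0 \<and> (\<forall>k. D k r x = c * D k (signed_dist \<Omega>) x)"
    using g by (intro exI[of _ "norm (gradient r x)"]) simp
qed

lemma signed_dist_regular:
  assumes p: "p \<in> frontier \<Omega>"
  obtains Os where "open Os" "p \<in> Os" "\<And>x. x \<in> Os \<Longrightarrow> signed_dist \<Omega> differentiable (at x)"
    "\<And>k x. x \<in> Os \<Longrightarrow> D k (signed_dist \<Omega>) differentiable (at x)"
    "\<And>j x. x \<in> Os \<Longrightarrow> (\<Sum>k\<in>UNIV. D k (signed_dist \<Omega>) x * D k (D j (signed_dist \<Omega>)) x) = 0"
proof -
  obtain \<delta> \<sigma> :: real and r :: "'n cspace \<Rightarrow> real" and k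
    where r: "\<delta> > 0" "smooth_on UNIV r" "\<And>x. x \<in> ball p \<delta> \<Longrightarrow> x \<in> \<Omega> \<longleftrightarrow> r x < 0"
    "\<And>x. x \<in> ball p \<delta> \<Longrightarrow> x \<in> frontier \<Omega> \<longleftrightarrow> r x = 0" "\<And>x. x \<in> ball p \<delta> \<Longrightarrow> \<sigma> * D k r x > 0"
    using frontier_local_defining[OF smooth_domain p] by metis
  have pin: "p \<in> ball p \<delta>" using r(1) by simp
  have "D k r p \<noteq> 0" using r(5)[OF pin] by auto
  then have g: "gradient r p \<noteq> 0" using gradient_inner_unit_vec[of r p k] by auto
  show thesis by (rule signed_dist_local[OF p open_ball pin r(2,3,4) g]; (assumption | rule that; assumption))
qed

end

section \<open>The adjoint\<close>

lemma sum_Plus_UNIV: "(\<Sum>j\<in>UNIV. F (j :: 'n::finite + 'n)) = (\<Sum>k\<in>UNIV. F (Inl k)) + (\<Sum>k\<in>UNIV. F (Inr k))"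
  using sum.Plus[of "UNIV :: 'n set" "UNIV :: 'n set" F] by (simp add: UNIV_Plus_UNIV comp_def)

lemma finite_tuples: "finite (tuples q :: 'n::{finite,linorder} list set)"
  by (rule finite_subset[OF _ finite_words_eq[of q]]) (auto simp: tuples_def)

lemma cnj_eps: "cnj (eps K k J) = eps K k J"
  by (simp add: eps_def)

lemma cnj_prod_list_of_real: "cnj (\<Prod>k\<leftarrow>u. of_real (f k)) = (\<Prod>k\<leftarrow>u. complex_of_real (f k))"
  by (induction u) simp_all

lemma D_sum:
  assumes "\<And>i. i \<in> I \<Longrightarrow> f i differentiable (at x)"
  shows "D k (\<lambda>x. \<Sum>i\<in>I. f i x) x = (\<Sum>i\<in>I. D k (f i) x)"
  using assms
  by (induction I rule: infinite_finite_induct) (simp_all add: D_add differentiable_sum)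

text \<open>Along the flow of a field \<open>\<nu>\<close> that is constant on its own trajectories, the iterated
  derivative only differentiates the other factors.\<close>

lemma field_derivative_power:
  fixes \<nu> :: "'n + 'n \<Rightarrow> 'n::finite cspace \<Rightarrow> real" and g :: "'n + 'n \<Rightarrow> 'n cspace \<Rightarrow> complex"
  assumes V: "open V" and \<nu>: "\<And>k x. x \<in> V \<Longrightarrow> \<nu> k differentiable (at x)"
    and flow: "\<And>j x. x \<in> V \<Longrightarrow> (\<Sum>k\<in>UNIV. \<nu> k x * D k (\<nu> j) x) = 0"
    and g: "\<And>j. smooth_on V (g j)" and F: "\<And>x. x \<in> V \<Longrightarrow> F x = (\<Sum>j\<in>UNIV. of_real (\<nu> j x) * g j x)"
    and x: "x \<in> V"
  shows "((\<lambda>f x. \<Sum>k\<in>UNIV. \<nu> k x *\<^sub>R D k f x) ^^ m) F x =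
    (\<Sum>j\<in>UNIV. \<Sum>w | length w = m. (\<Prod>k\<leftarrow>j # w. of_real (\<nu> k x)) * foldr D w (g j) x)"
  using x
proof (induction m arbitrary: x)
  case 0
  then show ?case by (simp add: F)
next
  case (Suc m)
  let ?N = "\<lambda>f x. \<Sum>k\<in>UNIV. \<nu> k x *\<^sub>R D k f x"
  let ?p = "\<lambda>u x. \<Prod>k\<leftarrow>u. complex_of_real (\<nu> k x)"
  have \<nu>c: "(\<lambda>x. complex_of_real (\<nu> k x)) differentiable (at x)" if "x \<in> V" for k x
    by (rule differentiable_bounded_linear[OF bounded_linear_of_real \<nu>[OF that]])
  have p_diff: "?p u differentiable (at x)" if "x \<in> V" for u x
  proof (induction u)
    case (Cons k u)
    then show ?case using differentiable_mult[OF \<nu>c[OF that] Cons] by simp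
  qed simp
  have p_flow: "?N (?p u) x = 0" if xV: "x \<in> V" for u x
  proof (induction u)
    case (Cons j u)
    have Dn: "D k (\<lambda>x. complex_of_real (\<nu> j x)) x = of_real (D k (\<nu> j) x)" for k
      by (rule D_bounded_linear[OF bounded_linear_of_real \<nu>[OF xV]])
    have "?N (?p (j # u)) x = (\<Sum>k\<in>UNIV. of_real (\<nu> k x * D k (\<nu> j) x) * ?p u x + of_real (\<nu> j x) * (\<nu> k x *\<^sub>R D k (?p u) x))"
      using D_mult[OF \<nu>c[OF xV] p_diff[OF xV]] by (intro sum.cong refl) (simp add: Dn scaleR_conv_of_real algebra_simps)
    also have "\<dots> = of_real (\<Sum>k\<in>UNIV. \<nu> k x * D k (\<nu> j) x) * ?p u x + of_real (\<nu> j x) * ?N (?p u) x"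
      by (simp add: sum.distrib sum_distrib_left sum_distrib_right)
    also have "\<dots> = 0" using flow[OF xV] Cons by simp
    finally show ?case .
  qed simp
  let ?h = "\<lambda>j w x. ?p (j # w) x * foldr D w (g j) x"
  have gd: "foldr D w (g j) differentiable (at x)" if "x \<in> V" for w j x
    using smooth_on_differentiable[OF smooth_on_foldr_D[OF g] that] .
  have hd: "?h j w differentiable (at x)" if "x \<in> V" for j w x
    by (intro differentiable_mult p_diff[OF that] gd[OF that])
  have Dh: "D k ((?N ^^ m) F) x = (\<Sum>j\<in>UNIV. \<Sum>w | length w = m. D k (?h j w) x)" for k
  proof -
    have "D k ((?N ^^ m) F) x = D k (\<lambda>x. \<Sum>j\<in>UNIV. \<Sum>w | length w = m. ?h j w x) x"
      by (rule D_cong_open[OF V Suc.prems Suc.IH])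
    also have "\<dots> = (\<Sum>j\<in>UNIV. D k (\<lambda>x. \<Sum>w | length w = m. ?h j w x) x)"
      by (rule D_sum) (intro differentiable_sum finite_words_eq ballI hd Suc.prems)
    also have "\<dots> = (\<Sum>j\<in>UNIV. \<Sum>w | length w = m. D k (?h j w) x)"
      by (intro sum.cong refl D_sum hd Suc.prems)
    finally show ?thesis .
  qed
  have Nh: "?N (?h j w) x = (\<Sum>k\<in>UNIV. ?p (j # k # w) x * foldr D (k # w) (g j) x)" for j w
  proof -
    have "?N (?h j w) x = (\<Sum>k\<in>UNIV. (\<nu> k x *\<^sub>R D k (?p (j # w)) x) * foldr D w (g j) x + ?p (j # k # w) x * foldr D (k # w) (g j) x)"
      using D_mult[OF p_diff[OF Suc.prems] gd[OF Suc.prems], of _ "j # w" w j]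
      by (intro sum.cong refl) (simp add: scaleR_conv_of_real algebra_simps)
    also have "\<dots> = ?N (?p (j # w)) x * foldr D w (g j) x + (\<Sum>k\<in>UNIV. ?p (j # k # w) x * foldr D (k # w) (g j) x)"
      by (simp only: sum.distrib sum_distrib_right)
    finally show ?thesis unfolding p_flow[OF Suc.prems] by simp
  qed
  have "(?N ^^ Suc m) F x = (\<Sum>k\<in>UNIV. \<Sum>j\<in>UNIV. \<Sum>w | length w = m. \<nu> k x *\<^sub>R D k (?h j w) x)"
    by (simp add: Dh scaleR_sum_right)
  also have "\<dots> = (\<Sum>j\<in>UNIV. \<Sum>w | length w = m. ?N (?h j w) x)"
    by (subst sum.swap, intro sum.cong refl, rule sum.swap)
  also have "\<dots> = (\<Sum>j\<in>UNIV. \<Sum>k\<in>UNIV. \<Sum>w | length w = m. ?p (j # k # w) x * foldr D (k # w) (g j) x)"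
    unfolding Nh by (intro sum.cong refl, rule sum.swap)
  also have "\<dots> = (\<Sum>j\<in>UNIV. \<Sum>w | length w = Suc m. ?p (j # w) x * foldr D w (g j) x)"
    by (simp only: sum_words_Suc)
  finally show ?case .
qed

context smooth_domain
begin

section \<open>Reduction of the pairing of dbar with a smooth form to scalar functionals\<close>

lemma W_inner_Cinf_sum_left:
  assumes "\<And>i. i \<in> A \<Longrightarrow> f i \<in> Cinf \<Omega>" "h \<in> Cinf \<Omega>"
  shows "W_inner \<Omega> s (\<lambda>x. \<Sum>i\<in>A. c i * f i x) h = (\<Sum>i\<in>A. c i * W_inner \<Omega> s (f i) h)"
  using assms(1)
proof (induction A rule: infinite_finite_induct)
  case (insert i A)
  have "W_inner \<Omega> s (\<lambda>x. c i * f i x + (\<Sum>i\<in>A. c i * f i x)) h = c i * W_inner \<Omega> s (f i) h + W_inner \<Omega> s (\<lambda>x. \<Sum>i\<in>A. c i * f i x) h"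
    using insert.prems assms(2)
    by (subst W_inner_Cinf_add_left) (auto intro!: Cinf_cmult Cinf_sum simp: W_inner_Cinf_cmult_left)
  then show ?case using insert by simp
qed (use W_inner_Cinf_cmult_left[OF Cinf_const assms(2), of s 0 0] in simp_all)

lemma W_inner_Cinf_sum_right:
  assumes "\<And>i. i \<in> A \<Longrightarrow> f i \<in> Cinf \<Omega>" "h \<in> Cinf \<Omega>"
  shows "W_inner \<Omega> s h (\<lambda>x. \<Sum>i\<in>A. c i * f i x) = (\<Sum>i\<in>A. cnj (c i) * W_inner \<Omega> s h (f i))"
proof -
  have S: "h \<in> S_space s" "(\<lambda>x. \<Sum>i\<in>A. c i * f i x) \<in> S_space s"
    using Cinf_subset_S_space assms by (auto intro!: subsetD[OF Cinf_subset_S_space] Cinf_sum Cinf_cmult)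
  have Si: "f i \<in> S_space s" if "i \<in> A" for i using Cinf_subset_S_space assms(1)[OF that] by blast
  have "W_inner \<Omega> s h (\<lambda>x. \<Sum>i\<in>A. c i * f i x) = cnj (W_inner \<Omega> s (\<lambda>x. \<Sum>i\<in>A. c i * f i x) h)"
    using W_inner_cnj[OF S(2,1)] by simp
  also have "\<dots> = (\<Sum>i\<in>A. cnj (c i) * cnj (W_inner \<Omega> s (f i) h))"
    by (simp add: W_inner_Cinf_sum_left[OF assms])
  also have "\<dots> = (\<Sum>i\<in>A. cnj (c i) * W_inner \<Omega> s h (f i))"
    by (intro sum.cong refl) (simp add: W_inner_cnj[OF Si S(1)])
  finally show ?thesis .
qed

text \<open>The weak form of a divergence: the gradient of \<open>f\<close> paired with the field
  \<open>g\<close>. The pairing of \<open>dbar q \<phi>\<close> with \<open>\<psi>\<close> splits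
  into such functionals, one for each coefficient of \<open>\<phi>\<close>.\<close>

definition div_functional :: "nat \<Rightarrow> ('n + 'n \<Rightarrow> 'n cspace \<Rightarrow> complex) \<Rightarrow> ('n cspace \<Rightarrow> complex) \<Rightarrow> complex" where
  "div_functional s g f = (\<Sum>j\<in>UNIV. W_inner \<Omega> s (D j f) (g j))"

lemma div_functional_eq:
  assumes "\<And>j. g j \<in> Cinf \<Omega>" "f \<in> Cinf \<Omega>"
  shows "div_functional s g f = (\<Sum>j\<in>UNIV. \<Sum>w | length w \<le> s. LINT x|lebesgue_on \<Omega>. cnj (foldr D w (g j) x) * foldr D (w @ [j]) f x)"
  unfolding div_functional_def W_inner_Cinf[OF Cinf_D[OF assms(2)] assms(1)] by (simp add: mult.commute)

lemma div_functional_add: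
  assumes g: "\<And>j. g j \<in> Cinf \<Omega>" and f: "f \<in> Cinf \<Omega>" "h \<in> Cinf \<Omega>"
  shows "div_functional s g (\<lambda>x. f x + h x) = div_functional s g f + div_functional s g h"
proof -
  have "(LINT x|lebesgue_on \<Omega>. cnj (foldr D w (g j) x) * foldr D v (\<lambda>x. f x + h x) x)
    = (LINT x|lebesgue_on \<Omega>. cnj (foldr D w (g j) x) * foldr D v f x) + (LINT x|lebesgue_on \<Omega>. cnj (foldr D w (g j) x) * foldr D v h x)" for w v j
  proof -
    have "(LINT x|lebesgue_on \<Omega>. cnj (foldr D w (g j) x) * foldr D v (\<lambda>x. f x + h x) x)
      = (LINT x|lebesgue_on \<Omega>. cnj (foldr D w (g j) x) * foldr D v f x + cnj (foldr D w (g j) x) * foldr D v h x)"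
      using Cinf_foldr_D_add[OF f domain_subset_closure] by (intro Bochner_Integration.integral_cong) (auto simp: distrib_left)
    also have "\<dots> = (LINT x|lebesgue_on \<Omega>. cnj (foldr D w (g j) x) * foldr D v f x) + (LINT x|lebesgue_on \<Omega>. cnj (foldr D w (g j) x) * foldr D v h x)"
      by (intro Bochner_Integration.integral_add Cinf_integrable Cinf_mult Cinf_cnj Cinf_foldr_D g f)
    finally show ?thesis .
  qed
  then show ?thesis by (simp add: div_functional_eq g f Cinf_add sum.distrib del: foldr_append)
qed

lemma div_functional_cmult:
  assumes g: "\<And>j. g j \<in> Cinf \<Omega>" and f: "f \<in> Cinf \<Omega>"
  shows "div_functional s g (\<lambda>x. c * f x) = c * div_functional s g f"
proof -
  have "(LINT x|lebesgue_on \<Omega>. cnj (foldr D w (g j) x) * foldr D v (\<lambda>x. c * f x) x)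
    = c * (LINT x|lebesgue_on \<Omega>. cnj (foldr D w (g j) x) * foldr D v f x)" for w v j
  proof -
    have "(LINT x|lebesgue_on \<Omega>. cnj (foldr D w (g j) x) * foldr D v (\<lambda>x. c * f x) x)
      = (LINT x|lebesgue_on \<Omega>. c * (cnj (foldr D w (g j) x) * foldr D v f x))"
      using Cinf_foldr_D_cmult[OF f domain_subset_closure] by (intro Bochner_Integration.integral_cong) (auto simp: mult_ac)
    then show ?thesis by simp
  qed
  then show ?thesis by (simp add: div_functional_eq g f Cinf_cmult sum_distrib_left del: foldr_append)
qed

text \<open>The component index \<open>j\<close> becomes the first letter of the word; the conjugate
  stems from the second argument of the product. The value at the empty word is a dummy, as only
  words of length \<open>s + 1\<close> occur.\<close>

definition top_coeff :: "('n + 'n \<Rightarrow> 'n cspace \<Rightarrow> complex) \<Rightarrow> ('n + 'n) list \<Rightarrow> 'n cspace \<Rightarrow> complex" where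
  "top_coeff g u = (case u of [] \<Rightarrow> (\<lambda>x. 0) | j # w \<Rightarrow> (\<lambda>x. cnj (foldr D w (g j) x)))"

lemma top_coeff_Cinf: "(\<And>j. g j \<in> Cinf \<Omega>) \<Longrightarrow> top_coeff g u \<in> Cinf \<Omega>"
  unfolding top_coeff_def by (cases u) (auto intro: Cinf_cnj Cinf_foldr_D)

text \<open>Words \<open>w\<close> shorter than \<open>s\<close> lead to derivatives of
  \<open>f\<close> of order at most \<open>s\<close>, which are bounded; adding or subtracting them
  does not affect boundedness of the rest.\<close>

lemma W_bounded_div_functional_iff:
  assumes g: "\<And>j. g j \<in> Cinf \<Omega>"
  shows "W_bounded s (div_functional s g) \<longleftrightarrow>
    W_bounded s (\<lambda>f. \<Sum>u | length u = Suc s. LINT x|lebesgue_on \<Omega>. top_coeff g u x * foldr D u f x)"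
    (is "_ \<longleftrightarrow> W_bounded s ?top")
proof -
  let ?I = "\<lambda>j w f. LINT x|lebesgue_on \<Omega>. cnj (foldr D w (g j) x) * foldr D (w @ [j]) f x"
  define low where "low = (\<lambda>f. \<Sum>j\<in>UNIV. \<Sum>w | length w < s. ?I j w f)"
  have low: "W_bounded s low"
    unfolding low_def by (intro W_bounded_sum W_bounded_low_order Cinf_cnj Cinf_foldr_D g) auto
  have top: "?top f = (\<Sum>j\<in>UNIV. \<Sum>w | length w = s. ?I j w f)" if f: "f \<in> Cinf \<Omega>" for f
  proof -
    have "foldr D (w @ [j]) f x = foldr D (j # w) f x" if "x \<in> \<Omega>" for w j x
      by (rule Cinf_foldr_D_perm[OF f domain_subset_closure[OF that]]) simp
    then have "?I j w f = (LINT x|lebesgue_on \<Omega>. top_coeff g (j # w) x * foldr D (j # w) f x)" for j w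
      by (intro Bochner_Integration.integral_cong) (auto simp: top_coeff_def)
    then show ?thesis by (simp only: sum_words_Suc)
  qed
  have eq: "div_functional s g f = ?top f + low f" if f: "f \<in> Cinf \<Omega>" for f
  proof -
    have "{w :: ('n + 'n) list. length w \<le> s} = {w. length w = s} \<union> {w. length w < s}" by auto
    moreover have "finite {w :: ('n + 'n) list. length w < s}" by (rule finite_subset[OF _ finite_words[of s]]) auto
    ultimately have "(\<Sum>w | length w \<le> s. ?I j w f) = (\<Sum>w | length w = s. ?I j w f) + (\<Sum>w | length w < s. ?I j w f)" for j
      using finite_words_eq by (simp only:) (rule sum.union_disjoint; auto)
    then show ?thesis unfolding div_functional_eq[OF g f] low_def top[OF f] sum.distrib[symmetric] by (intro sum.cong refl)
  qed
  show ?thesis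
  proof
    assume "W_bounded s (div_functional s g)"
    from W_bounded_diff[OF this low] show "W_bounded s ?top"
      by (rule W_bounded_cong[THEN iffD1, rotated]) (simp add: eq)
  next
    assume "W_bounded s ?top"
    from W_bounded_add[OF this low] show "W_bounded s (div_functional s g)"
      by (rule W_bounded_cong[THEN iffD1, rotated]) (simp add: eq)
  qed
qed

lemma W_bounded_div_functional_iff_symbol:
  assumes g: "\<And>j. g j \<in> Cinf \<Omega>"
  shows "W_bounded s (div_functional s g) \<longleftrightarrow>
    (\<forall>x\<in>frontier \<Omega>. symbol (\<lambda>k. D k (signed_dist \<Omega>)) (Suc s) (top_coeff g) x = 0)"
proof -
  have a: "top_coeff g u \<in> Cinf \<Omega>" for u using top_coeff_Cinf[of g] g by blast
  show ?thesis
    unfolding W_bounded_div_functional_iff[OF g]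
    using W_bounded_if_symbol_vanishes[where a = "top_coeff g", OF normal_like_signed_dist a]
      symbol_vanishes_if_W_bounded[where a = "top_coeff g", OF normal_like_signed_dist a] by blast
qed

text \<open>The real components of the contraction: half of D_x + i D_y in the first slot of the
  product becomes the factors 1/2 and -i/2 in the second, antilinear one. The same components,
  multiplied by the partial derivatives of the signed distance and summed, give the contraction with
  \<open>dbar_rho\<close> near the frontier.\<close>

definition contract_coeff :: "nat \<Rightarrow> 'n form \<Rightarrow> 'n list \<Rightarrow> 'n + 'n \<Rightarrow> 'n cspace \<Rightarrow> complex" where
  "contract_coeff q \<psi> I j = (case j of
     Inl k \<Rightarrow> (\<lambda>x. \<Sum>K\<in>tuples (q + 1). (eps K k I / 2) * \<psi> K x)
   | Inr k \<Rightarrow> (\<lambda>x. \<Sum>K\<in>tuples (q + 1). (- \<i> * eps K k I / 2) * \<psi> K x))"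

lemma contract_coeff_Cinf: "\<psi> \<in> Cinf_form \<Omega> (q + 1) \<Longrightarrow> contract_coeff q \<psi> I j \<in> Cinf \<Omega>"
proof -
  assume \<psi>: "\<psi> \<in> Cinf_form \<Omega> (q + 1)"
  have "(\<lambda>x. \<Sum>K\<in>tuples (q + 1). c K * \<psi> K x) \<in> Cinf \<Omega>" for c
    by (intro Cinf_sum Cinf_cmult) (use \<psi> in \<open>auto simp: Cinf_form_def\<close>)
  then show ?thesis unfolding contract_coeff_def by (cases j) (simp_all only: sum.case)
qed

text \<open>Near a frontier point the contraction is the sum of \<nu>_j g_j with smooth g_j and
  \<nu> the gradient of the signed distance. As \<nu> is constant along its own flow,
  \<open>field_derivative_power\<close> evaluates N^s of this sum; the result is the complex
  conjugate of the symbol.\<close>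

lemma symbol_eq_0_iff_normal_derivative:
  assumes \<psi>: "\<psi> \<in> Cinf_form \<Omega> (q + 1)" and I: "I \<in> tuples q" and x: "x \<in> frontier \<Omega>"
  shows "symbol (\<lambda>k. D k (signed_dist \<Omega>)) (Suc s) (top_coeff (contract_coeff q \<psi> I)) x = 0 \<longleftrightarrow>
    (normal_field \<Omega> ^^ s) (contract q \<psi> (dbar_rho \<Omega>) I) x = 0"
proof -
  let ?\<nu> = "\<lambda>k. D k (signed_dist \<Omega>)" and ?g = "contract_coeff q \<psi> I"
  obtain Os where Os: "open Os" "x \<in> Os" "\<And>x. x \<in> Os \<Longrightarrow> signed_dist \<Omega> differentiable (at x)"
    "\<And>k x. x \<in> Os \<Longrightarrow> ?\<nu> k differentiable (at x)"
    "\<And>j x. x \<in> Os \<Longrightarrow> (\<Sum>k\<in>UNIV. ?\<nu> k x * D k (?\<nu> j) x) = 0"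
    by (rule signed_dist_regular[OF x]) (rule that)
  have "\<forall>j. \<exists>U. open U \<and> closure \<Omega> \<subseteq> U \<and> smooth_on U (?g j)"
    using contract_coeff_Cinf[OF \<psi>] by (auto simp: Cinf_def)
  from choice[OF this] obtain U where U: "\<And>j. open (U j)" "\<And>j. closure \<Omega> \<subseteq> U j" "\<And>j. smooth_on (U j) (?g j)" by blast
  define V where "V = Os \<inter> (\<Inter>j. U j)"
  have V: "open V" unfolding V_def using Os(1) U(1) by (intro open_Int open_INT) auto
  have xV: "x \<in> V" using Os(2) U(2) x by (auto simp: V_def frontier_def)
  have F: "contract q \<psi> (dbar_rho \<Omega>) I y = (\<Sum>j\<in>UNIV. of_real (?\<nu> j y) * ?g j y)" if y: "y \<in> V" for y
  proof -
    have "signed_dist \<Omega> differentiable (at y)" using Os(3) y by (simp add: V_def)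
    then have D: "D j (\<lambda>x. complex_of_real (signed_dist \<Omega> x)) y = of_real (?\<nu> j y)" for j
      by (rule D_bounded_linear[OF bounded_linear_of_real])
    have "contract q \<psi> (dbar_rho \<Omega>) I y
      = (\<Sum>k\<in>UNIV. \<Sum>K\<in>tuples (q + 1). of_real (?\<nu> (Inl k) y) * ((eps K k I / 2) * \<psi> K y)
          + of_real (?\<nu> (Inr k) y) * ((- \<i> * eps K k I / 2) * \<psi> K y))"
      using I by (simp add: contract_def dbar_rho_def dzbar_def D field_simps)
    also have "\<dots> = (\<Sum>j\<in>UNIV. of_real (?\<nu> j y) * ?g j y)"
      unfolding sum_Plus_UNIV by (simp add: contract_coeff_def sum.distrib sum_distrib_left sum_subtractf sum_negf)
    finally show ?thesis .
  qed
  have nf: "normal_field \<Omega> = (\<lambda>f x. \<Sum>k\<in>UNIV. ?\<nu> k x *\<^sub>R D k f x)"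
    by (intro ext) (simp add: normal_field_def)
  let ?S = "\<Sum>j\<in>UNIV. \<Sum>w | length w = s. (\<Prod>k\<leftarrow>j # w. of_real (?\<nu> k x)) * foldr D w (?g j) x"
  have A: "(normal_field \<Omega> ^^ s) (contract q \<psi> (dbar_rho \<Omega>) I) x = ?S"
    unfolding nf
  proof (rule field_derivative_power[OF V _ _ _ F xV])
    show "smooth_on V (?g j)" for j by (rule smooth_on_subset[OF U(3)]) (auto simp: V_def)
  qed (use Os(4,5) in \<open>auto simp: V_def\<close>)
  have "symbol ?\<nu> (Suc s) (top_coeff ?g) x =
    (\<Sum>j\<in>UNIV. \<Sum>w | length w = s. top_coeff ?g (j # w) x * (\<Prod>k\<leftarrow>j # w. of_real (?\<nu> k x)))"
    unfolding symbol_def sum_words_Suc ..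
  also have "\<dots> = cnj ?S"
    unfolding cnj_sum complex_cnj_mult cnj_prod_list_of_real by (simp add: top_coeff_def mult.commute)
  finally have B: "symbol ?\<nu> (Suc s) (top_coeff ?g) x = cnj ?S" .
  show ?thesis unfolding A B complex_cnj_zero_iff ..
qed

lemma dzbar_Cinf: "f \<in> Cinf \<Omega> \<Longrightarrow> dzbar k f \<in> Cinf \<Omega>"
proof -
  assume f: "f \<in> Cinf \<Omega>"
  have "(\<lambda>x. (1/2) * (D (Inl k) f x + \<i> * D (Inr k) f x)) \<in> Cinf \<Omega>"
    by (intro Cinf_cmult Cinf_add Cinf_D f)
  then show ?thesis by (simp add: dzbar_def[abs_def])
qed

lemma dbar_Cinf_form:
  assumes "\<phi> \<in> Cinf_form \<Omega> q" shows "dbar q \<phi> \<in> Cinf_form \<Omega> (q + 1)"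
  unfolding dbar_def Cinf_form_def
  by (intro restrict_PiE_iff[THEN iffD2] ballI Cinf_sum Cinf_cmult dzbar_Cinf) (use assms in \<open>auto simp: Cinf_form_def\<close>)

lemma W_inner_dzbar:
  assumes f: "f \<in> Cinf \<Omega>" and h: "h \<in> Cinf \<Omega>"
  shows "W_inner \<Omega> s (dzbar k f) h = (W_inner \<Omega> s (D (Inl k) f) h + \<i> * W_inner \<Omega> s (D (Inr k) f) h) / 2"
proof -
  have e: "dzbar k f = (\<lambda>x. (1/2) * (D (Inl k) f x + \<i> * D (Inr k) f x))" by (simp add: dzbar_def[abs_def])
  show ?thesis
    unfolding e W_inner_Cinf_cmult_left[OF Cinf_add[OF Cinf_D[OF f] Cinf_cmult[OF Cinf_D[OF f]]] h]
      W_inner_Cinf_add_left[OF Cinf_D[OF f] Cinf_cmult[OF Cinf_D[OF f]] h] W_inner_Cinf_cmult_left[OF Cinf_D[OF f] h]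
    by simp
qed

lemma form_inner_dbar:
  assumes \<phi>: "\<phi> \<in> Cinf_form \<Omega> q" and \<psi>: "\<psi> \<in> Cinf_form \<Omega> (q + 1)"
  shows "form_inner \<Omega> s (q + 1) (dbar q \<phi>) \<psi> = (\<Sum>J\<in>tuples q. div_functional s (contract_coeff q \<psi> J) (\<phi> J))"
proof -
  have \<phi>C: "\<phi> J \<in> Cinf \<Omega>" if "J \<in> tuples q" for J using \<phi> that by (auto simp: Cinf_form_def)
  have \<psi>C: "\<psi> K \<in> Cinf \<Omega>" if "K \<in> tuples (q + 1)" for K using \<psi> that by (auto simp: Cinf_form_def)
  let ?w = "\<lambda>J j K. W_inner \<Omega> s (D j (\<phi> J)) (\<psi> K)"
  have left: "W_inner \<Omega> s (dbar q \<phi> K) (\<psi> K) = (\<Sum>k\<in>UNIV. \<Sum>J\<in>tuples q. eps K k J * ((?w J (Inl k) K + \<i> * ?w J (Inr k) K) / 2))"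
    if K: "K \<in> tuples (q + 1)" for K
  proof -
    have "W_inner \<Omega> s (dbar q \<phi> K) (\<psi> K) = W_inner \<Omega> s (\<lambda>x. \<Sum>k\<in>UNIV. 1 * (\<Sum>J\<in>tuples q. eps K k J * dzbar k (\<phi> J) x)) (\<psi> K)"
      using K by (simp add: dbar_def)
    also have "\<dots> = (\<Sum>k\<in>UNIV. 1 * W_inner \<Omega> s (\<lambda>x. \<Sum>J\<in>tuples q. eps K k J * dzbar k (\<phi> J) x) (\<psi> K))"
      by (intro W_inner_Cinf_sum_left Cinf_sum Cinf_cmult dzbar_Cinf \<phi>C \<psi>C K)
    also have "\<dots> = (\<Sum>k\<in>UNIV. \<Sum>J\<in>tuples q. eps K k J * W_inner \<Omega> s (dzbar k (\<phi> J)) (\<psi> K))"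
      by (intro sum.cong refl, subst W_inner_Cinf_sum_left) (auto intro: dzbar_Cinf \<phi>C \<psi>C K)
    also have "\<dots> = (\<Sum>k\<in>UNIV. \<Sum>J\<in>tuples q. eps K k J * ((?w J (Inl k) K + \<i> * ?w J (Inr k) K) / 2))"
      by (intro sum.cong refl) (simp add: W_inner_dzbar[OF \<phi>C \<psi>C[OF K]])
    finally show ?thesis .
  qed
  have right: "div_functional s (contract_coeff q \<psi> J) (\<phi> J)
    = (\<Sum>k\<in>UNIV. \<Sum>K\<in>tuples (q + 1). eps K k J * ((?w J (Inl k) K + \<i> * ?w J (Inr k) K) / 2))"
    if J: "J \<in> tuples q" for J
  proof -
    have l: "W_inner \<Omega> s (D (Inl k) (\<phi> J)) (contract_coeff q \<psi> J (Inl k)) = (\<Sum>K\<in>tuples (q + 1). cnj (eps K k J / 2) * ?w J (Inl k) K)" for k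
      unfolding contract_coeff_def sum.case by (intro W_inner_Cinf_sum_right \<psi>C Cinf_D \<phi>C J)
    have r: "W_inner \<Omega> s (D (Inr k) (\<phi> J)) (contract_coeff q \<psi> J (Inr k)) = (\<Sum>K\<in>tuples (q + 1). cnj (- \<i> * eps K k J / 2) * ?w J (Inr k) K)" for k
      unfolding contract_coeff_def sum.case by (intro W_inner_Cinf_sum_right \<psi>C Cinf_D \<phi>C J)
    show ?thesis
      unfolding div_functional_def sum_Plus_UNIV l r sum.distrib[symmetric]
      by (intro sum.cong refl) (simp add: cnj_eps algebra_simps add_divide_distrib)
  qed
  have "form_inner \<Omega> s (q + 1) (dbar q \<phi>) \<psi>
    = (\<Sum>K\<in>tuples (q + 1). \<Sum>k\<in>UNIV. \<Sum>J\<in>tuples q. eps K k J * ((?w J (Inl k) K + \<i> * ?w J (Inr k) K) / 2))"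
    unfolding form_inner_def by (intro sum.cong refl left)
  also have "\<dots> = (\<Sum>K\<in>tuples (q + 1). \<Sum>J\<in>tuples q. \<Sum>k\<in>UNIV. eps K k J * ((?w J (Inl k) K + \<i> * ?w J (Inr k) K) / 2))"
    by (intro sum.cong refl sum.swap)
  also have "\<dots> = (\<Sum>J\<in>tuples q. \<Sum>K\<in>tuples (q + 1). \<Sum>k\<in>UNIV. eps K k J * ((?w J (Inl k) K + \<i> * ?w J (Inr k) K) / 2))"
    by (rule sum.swap)
  also have "\<dots> = (\<Sum>J\<in>tuples q. \<Sum>k\<in>UNIV. \<Sum>K\<in>tuples (q + 1). eps K k J * ((?w J (Inl k) K + \<i> * ?w J (Inr k) K) / 2))"
    by (intro sum.cong refl sum.swap)
  also have "\<dots> = (\<Sum>J\<in>tuples q. div_functional s (contract_coeff q \<psi> J) (\<phi> J))"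
    by (intro sum.cong refl right[symmetric])
  finally show ?thesis .
qed

lemma Cinf_form_subset_W_form: "Cinf_form \<Omega> q \<subseteq> W_form \<Omega> s q"
  unfolding Cinf_form_def W_form_def by (intro PiE_mono Cinf_subset_W)

lemma zero_in_S_space: "(\<lambda>x. 0) \<in> S_space s"
  using Cinf_subset_S_space Cinf_const by blast

lemma W_inner_0_left: "h \<in> S_space s \<Longrightarrow> W_inner \<Omega> s (\<lambda>x. 0) h = 0"
  using W_inner_diff_left[OF zero_in_S_space zero_in_S_space, of h s] by simp

lemma form_dist_self: "form_dist \<Omega> s q \<phi> \<phi> = 0"
  by (simp add: form_dist_def form_inner_def W_inner_0_left[OF zero_in_S_space])

lemma graph_dbar_in_closure:
  assumes "\<phi> \<in> Cinf_form \<Omega> q" shows "(\<phi>, dbar q \<phi>) \<in> dbar_closure \<Omega> s q"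
proof -
  have "\<phi> \<in> W_form \<Omega> s q" "dbar q \<phi> \<in> W_form \<Omega> s (q + 1)"
    using assms dbar_Cinf_form[OF assms] Cinf_form_subset_W_form by blast+
  then show ?thesis unfolding dbar_closure_def using assms
    by (auto simp: form_dist_self intro!: exI[of _ "\<lambda>_. \<phi>"])
qed

lemma W_form_S_space: "\<phi> \<in> W_form \<Omega> s q \<Longrightarrow> J \<in> tuples q \<Longrightarrow> \<phi> J \<in> S_space s"
  using W_subset_S_space by (auto simp: W_form_def)

lemma form_inner_tendsto:
  assumes u: "\<And>m::nat. u m \<in> W_form \<Omega> s q" and \<phi>: "\<phi> \<in> W_form \<Omega> s q" and \<theta>: "\<theta> \<in> W_form \<Omega> s q"
    and lim: "(\<lambda>m. form_dist \<Omega> s q (u m) \<phi>) \<longlonglongrightarrow> 0"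
  shows "(\<lambda>m. form_inner \<Omega> s q (u m) \<theta>) \<longlonglongrightarrow> form_inner \<Omega> s q \<phi> \<theta>"
  unfolding form_inner_def
proof (rule tendsto_sum)
  fix J :: "'n list" assume J: "J \<in> tuples q"
  have le: "W_norm \<Omega> s (\<lambda>x. u m J x - \<phi> J x) \<le> form_dist \<Omega> s q (u m) \<phi>" for m
  proof -
    let ?\<delta> = "\<lambda>J x. u m J x - \<phi> J x"
    have "Re (W_inner \<Omega> s (?\<delta> J) (?\<delta> J)) \<le> (\<Sum>J\<in>tuples q. Re (W_inner \<Omega> s (?\<delta> J) (?\<delta> J)))"
      by (rule member_le_sum[OF J _ finite_tuples])
         (use W_inner_self_nonneg[OF S_space_diff[OF W_form_S_space[OF u] W_form_S_space[OF \<phi>]]] in auto)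
    then show ?thesis by (simp add: W_norm_def form_dist_def form_inner_def)
  qed
  have ge: "0 \<le> W_norm \<Omega> s (\<lambda>x. u m J x - \<phi> J x)" for m
    unfolding W_norm_def using W_inner_self_nonneg[OF S_space_diff[OF W_form_S_space[OF u J] W_form_S_space[OF \<phi> J]]] by simp
  have "(\<lambda>m. W_norm \<Omega> s (\<lambda>x. u m J x - \<phi> J x)) \<longlonglongrightarrow> 0"
    by (rule tendsto_sandwich[OF always_eventually always_eventually tendsto_const lim]) (auto simp: le ge)
  then show "(\<lambda>m. W_inner \<Omega> s (u m J) (\<theta> J)) \<longlonglongrightarrow> W_inner \<Omega> s (\<phi> J) (\<theta> J)"
    by (rule W_inner_tendsto[OF W_form_S_space[OF u J] W_form_S_space[OF \<phi> J] W_form_S_space[OF \<theta> J]])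
qed

text \<open>If the adjoint is defined at \<open>\<psi>\<close>, testing with forms that have a
  single nonzero coefficient bounds each functional by Cauchy-Schwarz. Conversely, the Riesz
  representatives of the functionals are the coefficients of the adjoint form, and the identity
  extends from smooth forms to the graph of the closure because the product is continuous.\<close>

lemma in_Domain_dbar_adjoint_iff:
  assumes \<psi>: "\<psi> \<in> Cinf_form \<Omega> (q + 1)"
  shows "\<psi> \<in> Domain (dbar_adjoint \<Omega> s q) \<longleftrightarrow> (\<forall>I\<in>tuples q. W_bounded s (div_functional s (contract_coeff q \<psi> I)))"
proof
  assume "\<psi> \<in> Domain (dbar_adjoint \<Omega> s q)"
  then obtain \<theta> where \<theta>: "\<theta> \<in> W_form \<Omega> s q"
    "\<And>\<phi> \<eta>. (\<phi>, \<eta>) \<in> dbar_closure \<Omega> s q \<Longrightarrow> form_inner \<Omega> s (q + 1) \<eta> \<psi> = form_inner \<Omega> s q \<phi> \<theta>"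
    by (auto simp: dbar_adjoint_def)
  show "\<forall>I\<in>tuples q. W_bounded s (div_functional s (contract_coeff q \<psi> I))"
  proof
    fix I :: "'n list" assume I: "I \<in> tuples q"
    have "cmod (div_functional s (contract_coeff q \<psi> I) f) \<le> W_norm \<Omega> s (\<theta> I) * W_norm \<Omega> s f" if f: "f \<in> Cinf \<Omega>" for f
    proof -
      define \<phi> where "\<phi> = (\<lambda>J\<in>tuples q. if J = I then f else (\<lambda>x. 0))"
      have \<phi>: "\<phi> \<in> Cinf_form \<Omega> q" using f by (auto simp: \<phi>_def Cinf_form_def)
      have \<phi>J: "\<phi> J = (if J = I then f else (\<lambda>x. 0))" if "J \<in> tuples q" for J using that by (simp add: \<phi>_def)
      have z: "div_functional s (contract_coeff q \<psi> J) (\<lambda>x. 0) = 0" for J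
        using div_functional_cmult[of "contract_coeff q \<psi> J" "\<lambda>x. 0" s 0] contract_coeff_Cinf[OF \<psi>] by simp
      have "div_functional s (contract_coeff q \<psi> I) f = (\<Sum>J\<in>tuples q. if J = I then div_functional s (contract_coeff q \<psi> I) f else 0)"
        using I by (simp add: finite_tuples)
      also have "\<dots> = (\<Sum>J\<in>tuples q. div_functional s (contract_coeff q \<psi> J) (\<phi> J))"
        by (intro sum.cong refl) (simp add: \<phi>J z)
      also have "\<dots> = form_inner \<Omega> s q \<phi> \<theta>"
        unfolding form_inner_dbar[OF \<phi> \<psi>, symmetric] by (rule \<theta>(2)[OF graph_dbar_in_closure[OF \<phi>]])
      also have "\<dots> = (\<Sum>J\<in>tuples q. if J = I then W_inner \<Omega> s f (\<theta> I) else 0)"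
        unfolding form_inner_def
        by (intro sum.cong refl) (simp add: \<phi>J W_inner_0_left W_form_S_space[OF \<theta>(1)])
      also have "\<dots> = W_inner \<Omega> s f (\<theta> I)" using I by (simp add: finite_tuples)
      finally show ?thesis
        using W_cauchy_schwarz[OF subsetD[OF Cinf_subset_S_space f] W_form_S_space[OF \<theta>(1) I]] by (simp add: mult.commute)
    qed
    then show "W_bounded s (div_functional s (contract_coeff q \<psi> I))" unfolding W_bounded_def by blast
  qed
next
  assume bd: "\<forall>I\<in>tuples q. W_bounded s (div_functional s (contract_coeff q \<psi> I))"
  have "\<forall>I\<in>tuples q. \<exists>\<theta>. \<theta> \<in> W \<Omega> s \<and> (\<forall>f\<in>Cinf \<Omega>. div_functional s (contract_coeff q \<psi> I) f = W_inner \<Omega> s f \<theta>)"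
  proof
    fix I :: "'n list" assume "I \<in> tuples q"
    then obtain C where "\<forall>f\<in>Cinf \<Omega>. cmod (div_functional s (contract_coeff q \<psi> I) f) \<le> C * W_norm \<Omega> s f"
      using bd unfolding W_bounded_def by blast
    then have C: "\<And>f. f \<in> Cinf \<Omega> \<Longrightarrow> cmod (div_functional s (contract_coeff q \<psi> I) f) \<le> C * W_norm \<Omega> s f" by blast
    obtain \<theta> where "\<theta> \<in> W \<Omega> s" "\<And>f. f \<in> Cinf \<Omega> \<Longrightarrow> div_functional s (contract_coeff q \<psi> I) f = W_inner \<Omega> s f \<theta>"
      by (rule W_riesz[where l = "div_functional s (contract_coeff q \<psi> I)" and C = C and s = s])
         (auto intro: div_functional_add div_functional_cmult contract_coeff_Cinf[OF \<psi>] C that)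
    then show "\<exists>\<theta>. \<theta> \<in> W \<Omega> s \<and> (\<forall>f\<in>Cinf \<Omega>. div_functional s (contract_coeff q \<psi> I) f = W_inner \<Omega> s f \<theta>)" by blast
  qed
  from bchoice[OF this] obtain t where t: "\<And>I. I \<in> tuples q \<Longrightarrow> t I \<in> W \<Omega> s"
    "\<And>I f. I \<in> tuples q \<Longrightarrow> f \<in> Cinf \<Omega> \<Longrightarrow> div_functional s (contract_coeff q \<psi> I) f = W_inner \<Omega> s f (t I)" by blast
  define \<theta> where "\<theta> = (\<lambda>I\<in>tuples q. t I)"
  have \<theta>: "\<theta> \<in> W_form \<Omega> s q" using t(1) by (auto simp: \<theta>_def W_form_def)
  have \<psi>W: "\<psi> \<in> W_form \<Omega> s (q + 1)" using \<psi> Cinf_form_subset_W_form by blast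
  have smooth: "form_inner \<Omega> s (q + 1) (dbar q \<phi>) \<psi> = form_inner \<Omega> s q \<phi> \<theta>" if \<phi>: "\<phi> \<in> Cinf_form \<Omega> q" for \<phi>
  proof (subst form_inner_dbar[OF \<phi> \<psi>], subst form_inner_def, rule sum.cong[OF refl])
    fix J :: "'n list" assume J: "J \<in> tuples q"
    then have "\<phi> J \<in> Cinf \<Omega>" using \<phi> by (auto simp: Cinf_form_def)
    then show "div_functional s (contract_coeff q \<psi> J) (\<phi> J) = W_inner \<Omega> s (\<phi> J) (\<theta> J)"
      using t(2)[OF J] J by (simp add: \<theta>_def)
  qed
  have "form_inner \<Omega> s (q + 1) \<eta> \<psi> = form_inner \<Omega> s q \<phi> \<theta>" if cl: "(\<phi>, \<eta>) \<in> dbar_closure \<Omega> s q" for \<phi> \<eta>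
  proof -
    obtain u where u: "\<phi> \<in> W_form \<Omega> s q" "\<eta> \<in> W_form \<Omega> s (q + 1)" "\<And>m::nat. u m \<in> Cinf_form \<Omega> q"
      "(\<lambda>m. form_dist \<Omega> s q (u m) \<phi>) \<longlonglongrightarrow> 0" "(\<lambda>m. form_dist \<Omega> s (q + 1) (dbar q (u m)) \<eta>) \<longlonglongrightarrow> 0"
      using cl by (auto simp: dbar_closure_def)
    have uW: "u m \<in> W_form \<Omega> s q" for m using u(3) Cinf_form_subset_W_form by blast
    have dW: "dbar q (u m) \<in> W_form \<Omega> s (q + 1)" for m using dbar_Cinf_form[OF u(3)] Cinf_form_subset_W_form by blast
    have l1: "(\<lambda>m. form_inner \<Omega> s q (u m) \<theta>) \<longlonglongrightarrow> form_inner \<Omega> s q \<phi> \<theta>"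
      by (rule form_inner_tendsto[OF uW u(1) \<theta> u(4)])
    have "(\<lambda>m. form_inner \<Omega> s (q + 1) (dbar q (u m)) \<psi>) \<longlonglongrightarrow> form_inner \<Omega> s (q + 1) \<eta> \<psi>"
      by (rule form_inner_tendsto[OF dW u(2) \<psi>W u(5)])
    then have l2: "(\<lambda>m. form_inner \<Omega> s q (u m) \<theta>) \<longlonglongrightarrow> form_inner \<Omega> s (q + 1) \<eta> \<psi>" by (simp only: smooth[OF u(3)])
    show ?thesis by (rule LIMSEQ_unique[OF l2 l1])
  qed
  then have "(\<psi>, \<theta>) \<in> dbar_adjoint \<Omega> s q" using \<psi>W \<theta> by (auto simp: dbar_adjoint_def)
  then show "\<psi> \<in> Domain (dbar_adjoint \<Omega> s q)" by blast
qed

end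

theorem proposition3p1:
  fixes \<Omega> :: "'n::{finite,linorder} cspace set" and s q :: nat
  assumes "smoothly_bounded_domain \<Omega>"
    and "q \<le> CARD('n) - 1"
  shows "Domain (dbar_adjoint \<Omega> s q) \<inter> Cinf_form \<Omega> (q + 1) =
    {\<psi> \<in> Cinf_form \<Omega> (q + 1). \<forall>I\<in>tuples q. \<forall>x\<in>frontier \<Omega>.
       (normal_field \<Omega> ^^ s) (contract q \<psi> (dbar_rho \<Omega>) I) x = 0}"
proof -
  interpret smooth_domain \<Omega> by standard (rule assms(1))
  have "\<psi> \<in> Domain (dbar_adjoint \<Omega> s q) \<longleftrightarrow> (\<forall>I\<in>tuples q. \<forall>x\<in>frontier \<Omega>.
       (normal_field \<Omega> ^^ s) (contract q \<psi> (dbar_rho \<Omega>) I) x = 0)" if \<psi>: "\<psi> \<in> Cinf_form \<Omega> (q + 1)" for \<psi>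
    unfolding in_Domain_dbar_adjoint_iff[OF \<psi>] W_bounded_div_functional_iff_symbol[OF contract_coeff_Cinf[OF \<psi>]]
    using symbol_eq_0_iff_normal_derivative[OF \<psi>] by blast
  then show ?thesis by blast
qed

end
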